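(* Let $N\ge1$, $\lambda\in\mathbb{R}\setminus\{0\}$, $m\in\{0,1\}$, $0\le\alpha\le\frac{4}{N-2m}$ ($0\le\alpha<\infty$ if $N=m=1$ and $0\le\alpha<\frac{4}{N-2}$ if $N\ge2$ and $m=1$), $\varphi\in H^m(\mathbb{R}^N)$, and let $u\in C((-T_*,T^* );H^m(\mathbb{R}^N))$ be the corresponding solution of $$i\frac{\partial u}{\partial t}+\Delta u+\lambda|u|^\alpha u=0,\qquad u(0)=\varphi .$$ Assume that $T^*=\infty$. If $\varphi\not\equiv0$ and if there exists $u_+\in L^2(\mathbb{R}^N)$ such that $\lim_{t\to\infty}\|T(-t)u(t)-u_+\|_{L^2}=0$, then for every $r\in[2,\infty]$, $$\liminf_{t\to\infty}|t|^{N\left(\frac12-\frac1r\right)}\|u(t)\|_{L^r}>0 .$$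
   Context: $(T(t))_{t\in\mathbb{R}}=(e^{it\Delta})_{t\in\mathbb{R}}$ is the free Schrödinger group on $L^2(\mathbb{R}^N;\mathbb{C})$. Conventions: $H^0=L^2$; $\|f\|_{L^p}=\infty$ if $f\notin L^p$; for $N=2$, $\frac{4}{N-2}$ is read as $\infty$. The corresponding solution is the unique maximal solution with $u(0)=\varphi$: in $C((-T_*,T^* );H^1(\mathbb{R}^N))$ if $m=1$; in $C((-T_*,T^* );L^2(\mathbb{R}^N))\cap L^{\frac{4(\alpha+2)}{N\alpha}}_{\mathrm{loc}}((-T_*,T^* );L^{\alpha+2}(\mathbb{R}^N))$ if $m=0$ and $\alpha>0$; and $u(t)=e^{i\lambda t}T(t)\varphi$ if $\alpha=0$. It satisfies $\|u(t)\|_{L^2}=\|\varphi\|_{L^2}$ for all $t$. *)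

theory Defs
  imports "HOL-Analysis.Analysis" "HOL-Probability.Essential_Supremum"
begin

text \<open>Elements of Lebesgue and Sobolev spaces are represented by Borel functions; equality in
  these spaces is equality almost everywhere with respect to \<^const>\<open>lborel\<close>.\<close>

subsection \<open>Lebesgue norms\<close>

definition ennreal_powr :: "ennreal \<Rightarrow> real \<Rightarrow> ennreal" where
  "ennreal_powr a p = (if a = \<infinity> then \<infinity> else ennreal (enn2real a powr p))"
  \<comment> \<open>only used for exponents \<open>p > 0\<close>\<close>

definition Lp_norm :: "ennreal \<Rightarrow> ('a::euclidean_space \<Rightarrow> complex) \<Rightarrow> ennreal" where
  "Lp_norm p f =
    (if f \<notin> borel_measurable lborel then \<infinity>
     else if p = \<infinity> then esssup lborel (\<lambda>x. ennreal (cmod (f x)))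
     else ennreal_powr (\<integral>\<^sup>+x. ennreal (cmod (f x) powr enn2real p) \<partial>lborel) (1 / enn2real p))"

definition L2 :: "('a::euclidean_space \<Rightarrow> complex) set" where
  "L2 = {f \<in> borel_measurable lborel. Lp_norm 2 f < \<infinity>}"

subsection \<open>Fourier transform on \<open>L\<^sup>2\<close>, Sobolev spaces, and the free group\<close>

text \<open>For \<open>f \<in> L\<^sup>2\<close>, the unitary Fourier transform is the \<open>L\<^sup>2\<close>-limit of the transforms of the
  integrable functions obtained by truncating \<open>f\<close> to balls. It is determined up to null sets.\<close>

definition truncated_fourier ::
    "real \<Rightarrow> ('a::euclidean_space \<Rightarrow> complex) \<Rightarrow> 'a \<Rightarrow> complex" where
  "truncated_fourier R f \<xi> =
     complex_of_real ((2 * pi) powr (- real DIM('a) / 2)) *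
     (LINT x:cball 0 R|lborel. cis (- (x \<bullet> \<xi>)) * f x)"

definition fourier_L2 :: "('a::euclidean_space \<Rightarrow> complex) \<Rightarrow> 'a \<Rightarrow> complex" where
  "fourier_L2 f = (SOME g. g \<in> L2 \<and>
     ((\<lambda>R. Lp_norm 2 (\<lambda>\<xi>. truncated_fourier R f \<xi> - g \<xi>)) \<longlongrightarrow> 0) at_top)"

definition inverse_fourier_L2 :: "('a::euclidean_space \<Rightarrow> complex) \<Rightarrow> 'a \<Rightarrow> complex" where
  "inverse_fourier_L2 g x = fourier_L2 g (- x)"

definition schroedinger_group ::
    "real \<Rightarrow> ('a::euclidean_space \<Rightarrow> complex) \<Rightarrow> 'a \<Rightarrow> complex" where
  "schroedinger_group t f =
     inverse_fourier_L2 (\<lambda>\<xi>. cis (- t * (norm \<xi>)\<^sup>2) * fourier_L2 f \<xi>)"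

definition sobolev_norm :: "nat \<Rightarrow> ('a::euclidean_space \<Rightarrow> complex) \<Rightarrow> ennreal" where
  "sobolev_norm m f =
    (if f \<in> L2
     then Lp_norm 2 (\<lambda>\<xi>. complex_of_real (sqrt (1 + (norm \<xi>)\<^sup>2) ^ m) * fourier_L2 f \<xi>)
     else \<infinity>)"

definition sobolev :: "nat \<Rightarrow> ('a::euclidean_space \<Rightarrow> complex) set" where
  "sobolev m = {f \<in> L2. sobolev_norm m f < \<infinity>}"

subsection \<open>Test functions\<close>

primrec Ck :: "nat \<Rightarrow> ('a::real_normed_vector \<Rightarrow> 'b::real_normed_vector) \<Rightarrow> bool" where
  "Ck 0 f \<longleftrightarrow> continuous_on UNIV f"
| "Ck (Suc k) f \<longleftrightarrow>
     (\<forall>x. f differentiable (at x)) \<and> (\<forall>v. Ck k (\<lambda>x. frechet_derivative f (at x) v))"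

definition test_function :: "('a::euclidean_space \<Rightarrow> complex) \<Rightarrow> bool" where
  "test_function w \<longleftrightarrow> (\<forall>k. Ck k w) \<and> compact (closure {x. w x \<noteq> 0})"

definition laplacian :: "('a::euclidean_space \<Rightarrow> complex) \<Rightarrow> 'a \<Rightarrow> complex" where
  "laplacian w x =
     (\<Sum>b\<in>Basis. frechet_derivative (\<lambda>y. frechet_derivative w (at y) b) (at x) b)"

subsection \<open>Solutions of the nonlinear Schroedinger equation\<close>

definition continuous_into_sobolev ::
    "nat \<Rightarrow> real set \<Rightarrow> (real \<Rightarrow> 'a::euclidean_space \<Rightarrow> complex) \<Rightarrow> bool" where
  "continuous_into_sobolev m I u \<longleftrightarrow>
     (\<forall>t\<in>I. u t \<in> sobolev m \<and>
        ((\<lambda>s. sobolev_norm m (\<lambda>x. u s x - u t x)) \<longlongrightarrow> 0) (at t within I))"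

text \<open>Membership in \<open>L\<^sup>q\<^sub>l\<^sub>o\<^sub>c(I; L\<^sup>p)\<close> for finite \<open>q, p\<close>. Only used for functions that are
  continuous into \<open>L\<^sup>2\<close>, for which strong measurability into \<open>L\<^sup>p\<close> is automatic.\<close>

definition locally_Lq_Lp ::
    "real \<Rightarrow> real \<Rightarrow> real set \<Rightarrow> (real \<Rightarrow> 'a::euclidean_space \<Rightarrow> complex) \<Rightarrow> bool" where
  "locally_Lq_Lp q p I u \<longleftrightarrow>
     (\<forall>a b. {a..b} \<subseteq> I \<longrightarrow>
        (\<lambda>s. indicator {a..b} s * Lp_norm (ennreal p) (u s)) \<in> borel_measurable lborel \<and>
        (\<integral>\<^sup>+s\<in>{a..b}. ennreal_powr (Lp_norm (ennreal p) (u s)) q \<partial>lborel) < \<infinity>)"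

text \<open>The equation \<open>i \<partial>\<^sub>t u + \<Delta> u + \<lambda> |u|\<^sup>\<alpha> u = 0\<close> in the sense of distributions, integrated in
  time from \<open>0\<close> to \<open>t\<close> and tested against \<open>w\<close> in the space variable. The set \<open>I\<close> is meant to be
  an open interval containing \<open>0\<close>. Testing in space first makes the condition independent
  of the representatives chosen for the individual \<open>u t\<close>.\<close>

definition satisfies_nls ::
    "real \<Rightarrow> real \<Rightarrow> real set \<Rightarrow> (real \<Rightarrow> 'a::euclidean_space \<Rightarrow> complex) \<Rightarrow> bool" where
  "satisfies_nls lam \<alpha> I u \<longleftrightarrow>
     (\<forall>w. test_function w \<longrightarrow>
        (let F = (\<lambda>s. (LINT x|lborel. u s x * laplacian w x)
                    + complex_of_real lam *
                      (LINT x|lborel. complex_of_real (cmod (u s x) powr \<alpha>) * u s x * w x))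
         in \<forall>t\<in>I. interval_lebesgue_integrable lborel (ereal 0) (ereal t) F \<and>
              \<i> * ((LINT x|lborel. u t x * w x) - (LINT x|lborel. u 0 x * w x))
                + (LBINT s=ereal 0..ereal t. F s) = 0))"

definition time_interval :: "ereal \<Rightarrow> ereal \<Rightarrow> real set" where
  "time_interval T1 T2 = {t. - T1 < ereal t \<and> ereal t < T2}"

text \<open>The case \<open>\<alpha> > 0\<close>: solutions in \<open>C(I; H\<^sup>1)\<close> for \<open>m = 1\<close>, and in
  \<open>C(I; L\<^sup>2) \<inter> L\<^sup>q\<^sub>l\<^sub>o\<^sub>c(I; L\<^sup>\<alpha>\<^sup>+\<^sup>2)\<close> with \<open>q = 4 (\<alpha> + 2) / (N \<alpha>)\<close> for \<open>m = 0\<close>,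
  where \<open>I = (- T1, T2)\<close>.\<close>

definition nls_solution ::
    "nat \<Rightarrow> real \<Rightarrow> real \<Rightarrow> ('a::euclidean_space \<Rightarrow> complex) \<Rightarrow> ereal \<Rightarrow> ereal \<Rightarrow>
     (real \<Rightarrow> 'a \<Rightarrow> complex) \<Rightarrow> bool" where
  "nls_solution m lam \<alpha> \<phi> T1 T2 u \<longleftrightarrow>
     0 < T1 \<and> 0 < T2 \<and>
     continuous_into_sobolev m (time_interval T1 T2) u \<and>
     (m = 0 \<longrightarrow>
        locally_Lq_Lp (4 * (\<alpha> + 2) / (real DIM('a) * \<alpha>)) (\<alpha> + 2) (time_interval T1 T2) u) \<and>
     satisfies_nls lam \<alpha> (time_interval T1 T2) u \<and>
     (AE x in lborel. u 0 x = \<phi> x)"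

definition maximal_nls_solution ::
    "nat \<Rightarrow> real \<Rightarrow> real \<Rightarrow> ('a::euclidean_space \<Rightarrow> complex) \<Rightarrow> ereal \<Rightarrow> ereal \<Rightarrow>
     (real \<Rightarrow> 'a \<Rightarrow> complex) \<Rightarrow> bool" where
  "maximal_nls_solution m lam \<alpha> \<phi> T1 T2 u \<longleftrightarrow>
     nls_solution m lam \<alpha> \<phi> T1 T2 u \<and>
     (\<forall>S1 S2 v. T1 \<le> S1 \<and> T2 \<le> S2 \<and> nls_solution m lam \<alpha> \<phi> S1 S2 v \<and>
        (\<forall>t\<in>time_interval T1 T2. AE x in lborel. v t x = u t x)
        \<longrightarrow> S1 = T1 \<and> S2 = T2)"

text \<open>In the linear case \<open>\<alpha> = 0\<close> the solution is given by an explicit global formula.\<close>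

definition corresponding_solution ::
    "nat \<Rightarrow> real \<Rightarrow> real \<Rightarrow> ('a::euclidean_space \<Rightarrow> complex) \<Rightarrow> ereal \<Rightarrow> ereal \<Rightarrow>
     (real \<Rightarrow> 'a \<Rightarrow> complex) \<Rightarrow> bool" where
  "corresponding_solution m lam \<alpha> \<phi> T1 T2 u \<longleftrightarrow>
     (if \<alpha> = 0
      then T1 = \<infinity> \<and> T2 = \<infinity> \<and> continuous_into_sobolev m UNIV u \<and>
           (\<forall>t. AE x in lborel. u t x = cis (lam * t) * schroedinger_group t \<phi> x)
      else maximal_nls_solution m lam \<alpha> \<phi> T1 T2 u)"

end

theory Submission
  imports Defs "HOL-Probability.Characteristic_Functions"
begin

text \<open>Since \<open>u\<close> conserves its \<open>L\<^sup>2\<close> norm and \<open>T (-t) (u t)\<close> is Cauchy, the Fourier transform of \<open>u t\<close> stays close, for all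
  \<open>t \<ge> t\<^sub>0\<close>, to \<open>exp (- i (t - t\<^sub>0) |\<xi>|\<^sup>2)\<close> times a fixed function, and hence is nearly invariant under translations of
  length \<open>\<kappa> / t\<close>. By Plancherel, \<open>(exp (i a \<bullet> x) - 1) u t\<close> is small for \<open>|a| \<le> \<kappa> / t\<close>, and averaging over \<open>a\<close> shows that a
  fixed part of the mass of \<open>u t\<close> lies in a cube of side of order \<open>t\<close>. An elementary form of Hoelder's inequality on that cube
  bounds \<open>L\<^sup>r\<close> norms from below by \<open>t\<close> to the power \<open>- N (1/2 - 1/r)\<close>.

  Mass conservation comes from mollifying the equation with an even bump function: the contribution of the Laplacian
  to the time derivative of the mollified mass vanishes by symmetry, and that of the nonlinearity tends to
  the imaginary part of the integral of \<open>|u|\<^sup>\<alpha>\<^sup>+\<^sup>2\<close>, which is dominated in time by the \<open>L\<^sup>q L\<^sup>\<alpha>\<^sup>+\<^sup>2\<close> bound for \<open>m = 0\<close> and by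
  subcritical Sobolev embedding for \<open>m = 1\<close>.\<close>

section \<open>Translations in Lebesgue spaces\<close>

text \<open>A solution is specified only by the equation integrated in time and tested in space, so
  conservation of mass has to be derived. It keeps the mass of \<open>u t\<close> equal to that of
  \<open>\<phi>\<close>; convergence of the profiles alone would allow a zero limit. Multiplying the
  equation by the conjugate of \<open>u\<close> makes no sense at this regularity. Testing with a
  bump centred at \<open>x\<close> yields, for each \<open>x\<close>, a scalar function of time with
  integrable derivative; its squared modulus obeys an elementary identity, and Fubini integrates
  this over \<open>x\<close>.

  The length \<open>t\<close> stems from the quadratic phase: a shift by \<open>a\<close> with
  \<open>|a| \<le> 1\<close> changes \<open>\<tau> |\<xi>|\<^sup>2\<close> by at most
  \<open>\<tau> |a| (2 |\<xi>| + 1)\<close>, small on the bulk of a fixed profile while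
  \<open>\<tau> |a| \<le> \<kappa>\<close> with small \<open>\<kappa>\<close>.

  The upper bounds on \<alpha> enter through conservation of mass. For \<open>m = 0\<close>,
  \<open>\<alpha> \<le> 4 / N\<close> makes the time exponent at least \<open>\<alpha> + 2\<close>;
  for \<open>m = 1\<close>, \<open>\<alpha> < 4 / (N - 2)\<close> leaves room for a number between
  \<open>(N - 2) / 2\<close> and \<open>2 / \<alpha>\<close>.\<close>

lemma nn_integral_lborel_affine:
  fixes f :: "'a::euclidean_space \<Rightarrow> ennreal"
  assumes [measurable]: "f \<in> borel_measurable borel" and c: "c \<noteq> 0"
  shows "(\<integral>\<^sup>+x. f x \<partial>lborel) = ennreal (\<bar>c\<bar> ^ DIM('a)) * (\<integral>\<^sup>+x. f (t + c *\<^sub>R x) \<partial>lborel)"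
  by (subst lborel_affine[OF c, of t])
     (simp add: nn_integral_density nn_integral_distr nn_integral_cmult)

lemma lborel_affine_change:
  fixes f :: "'a::euclidean_space \<Rightarrow> 'b::{banach, second_countable_topology}"
  assumes "integrable lborel f" and c: "c \<noteq> 0"
  shows "integrable lborel (\<lambda>x. f (t + c *\<^sub>R x))"
    and "(LINT x|lborel. f x) = \<bar>c\<bar> ^ DIM('a) *\<^sub>R (LINT x|lborel. f (t + c *\<^sub>R x))"
proof -
  have [measurable]: "f \<in> borel_measurable borel" using assms(1) by auto
  have "integrable (density (distr lborel borel (\<lambda>x. t + c *\<^sub>R x)) (\<lambda>_. ennreal (\<bar>c\<bar>^DIM('a)))) f"
    using assms(1) lborel_affine[OF c, of t] by simp
  then have "integrable lborel (\<lambda>x. (\<bar>c\<bar> ^ DIM('a)) *\<^sub>R f (t + c *\<^sub>R x))"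
    by (subst (asm) integrable_density) (auto simp: integrable_distr_eq)
  then show "integrable lborel (\<lambda>x. f (t + c *\<^sub>R x))"
    using integrable_scaleR_right[of "1 / \<bar>c\<bar> ^ DIM('a)" lborel "\<lambda>x. \<bar>c\<bar> ^ DIM('a) *\<^sub>R f (t + c *\<^sub>R x)"] c
    by (simp del: integrable_scaleR_right)
  show "(LINT x|lborel. f x) = \<bar>c\<bar> ^ DIM('a) *\<^sub>R (LINT x|lborel. f (t + c *\<^sub>R x))"
    by (subst lborel_affine[OF c, of t]) (simp add: integral_density integral_distr)
qed

lemma nn_integral_shift:
  fixes f :: "'a::euclidean_space \<Rightarrow> ennreal"
  assumes [measurable]: "f \<in> borel_measurable borel"
  shows "(\<integral>\<^sup>+x. f (x + a) \<partial>lborel) = (\<integral>\<^sup>+x. f x \<partial>lborel)"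
  using nn_integral_lborel_affine[of f 1 a] by (simp add: add.commute)

lemma integrable_shift:
  fixes f :: "'a::euclidean_space \<Rightarrow> 'b::{banach, second_countable_topology}"
  assumes "integrable lborel f"
  shows "integrable lborel (\<lambda>x. f (x + a))"
  using lborel_affine_change(1)[OF assms, of 1 a] by (simp add: add.commute)

lemma integrable_shift_iff:
  fixes f :: "'a::euclidean_space \<Rightarrow> 'b::{banach, second_countable_topology}"
  shows "integrable lborel (\<lambda>x. f (x + a)) \<longleftrightarrow> integrable lborel f"
  using integrable_shift[of f a] integrable_shift[of "\<lambda>x. f (x + a)" "-a"] by auto

text \<open>A function and its translate are integrable together; if they are not, both integrals
  take the default value 0, so the equation is unconditional.\<close>

lemma integral_shift:
  fixes f :: "'a::euclidean_space \<Rightarrow> 'b::{banach, second_countable_topology}"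
  shows "(LINT x|lborel. f (x + a)) = (LINT x|lborel. f x)"
proof (cases "integrable lborel f")
  case True
  show ?thesis
    using lborel_affine_change(2)[OF True, of 1 a] by (simp add: add.commute)
next
  case False
  then show ?thesis
    by (simp add: not_integrable_integral_eq integrable_shift_iff)
qed

lemma integral_reflect:
  fixes f :: "'a::euclidean_space \<Rightarrow> 'b::{banach, second_countable_topology}"
  shows "(LINT x|lborel. f (- x)) = (LINT x|lborel. f x)"
proof -
  have *: "(LINT x|lborel. g (- x)) = (LINT x|lborel. g x)" "integrable lborel (\<lambda>x. g (- x))"
    if "integrable lborel g" for g :: "'a \<Rightarrow> 'b"
    using lborel_affine_change[OF that, of "-1" 0] by simp_all
  show ?thesis
  proof (cases "integrable lborel f")
    case False
    then have "\<not> integrable lborel (\<lambda>x. f (- x))"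
      using *(2)[of "\<lambda>x. f (- x)"] by auto
    with False show ?thesis by (simp add: not_integrable_integral_eq)
  qed (use * in simp)
qed

text \<open>The indicator of an open set is lower semicontinuous: a point of \<open>U\<close> stays
  in \<open>U\<close> under small shifts. So the part of \<open>U\<close> lost by shifting tends to
  0 pointwise and is dominated by the indicator of \<open>U\<close>. As both indicators have the
  same integral, loss and gain are equal, which gives the factor 2.\<close>

lemma translation_continuous_open:
  fixes U :: "'a::euclidean_space set"
  assumes U: "open U" "emeasure lborel U < \<infinity>" and z: "z \<longlonglongrightarrow> 0"
  shows "(\<lambda>n. LINT x|lborel. \<bar>indicat_real U (x + z n) - indicat_real U x\<bar>) \<longlonglongrightarrow> 0"
proof -
  have [measurable]: "U \<in> sets borel" using U by auto
  have iU: "integrable lborel (indicat_real U)" using U by simp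
  define h where "h n x = max 0 (indicat_real U x - indicat_real U (x + z n))" for n x
  have "(\<lambda>n. LINT x|lborel. h n x) \<longlonglongrightarrow> (LINT x::'a|lborel. (0::real))"
  proof (rule integral_dominated_convergence[where w="indicat_real U"])
    show "AE x in lborel. (\<lambda>n. h n x) \<longlonglongrightarrow> 0"
    proof (rule AE_I2)
      fix x
      show "(\<lambda>n. h n x) \<longlonglongrightarrow> 0"
      proof (cases "x \<in> U")
        case True
        have "(\<lambda>n. x + z n) \<longlonglongrightarrow> x + 0" by (intro tendsto_intros z)
        then have "\<forall>\<^sub>F n in sequentially. x + z n \<in> U"
          using topological_tendstoD[OF _ U(1), of "\<lambda>n. x + z n" x sequentially] True by simp
        then have "\<forall>\<^sub>F n in sequentially. h n x = 0"
          by eventually_elim (simp add: h_def True)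
        then show ?thesis by (simp add: tendsto_eventually)
      qed (simp add: h_def indicator_def)
    qed
    show "AE x in lborel. norm (h n x) \<le> indicat_real U x" for n
      by (auto simp: h_def indicator_def)
  qed (use iU in \<open>auto simp: h_def\<close>)
  then have lim: "(\<lambda>n. 2 * (LINT x|lborel. h n x)) \<longlonglongrightarrow> 2 * 0"
    by (intro tendsto_mult_left) simp
  have "(LINT x|lborel. \<bar>indicat_real U (x + z n) - indicat_real U x\<bar>) = 2 * (LINT x|lborel. h n x)" for n
  proof -
    have i: "integrable lborel (h n)"
      unfolding h_def using iU integrable_shift[OF iU, of "z n"] by auto
    have "(LINT x|lborel. \<bar>indicat_real U (x + z n) - indicat_real U x\<bar>)
        = (LINT x|lborel. 2 * h n x + (indicat_real U (x + z n) - indicat_real U x))"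
      by (intro Bochner_Integration.integral_cong) (auto simp: h_def max_def indicator_def)
    also have "\<dots> = 2 * (LINT x|lborel. h n x) + (LINT x|lborel. indicat_real U (x + z n)) - (LINT x|lborel. indicat_real U x)"
      using i iU integrable_shift[OF iU, of "z n"] by simp
    finally show ?thesis by (simp add: integral_shift)
  qed
  with lim show ?thesis by simp
qed

text \<open>Translation invariance makes the approximation error at \<open>x + z\<close> as large as
  the one at \<open>x\<close>; this is the factor 2.\<close>

lemma L1_approx_translation:
  fixes f g :: "'a::euclidean_space \<Rightarrow> 'b::{banach, second_countable_topology}"
  assumes f: "integrable lborel f" and g: "integrable lborel g"
  shows "(LINT x|lborel. norm (f (x + z) - f x))
     \<le> (LINT x|lborel. norm (g (x + z) - g x)) + 2 * (LINT x|lborel. norm (f x - g x))"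
proof -
  note i = integrable_shift[OF f, of z] integrable_shift[OF g, of z] f g
  have "(LINT x|lborel. norm (f (x + z) - f x))
     \<le> (LINT x|lborel. norm (g (x + z) - g x) + norm (f (x + z) - g (x + z)) + norm (f x - g x))"
  proof (rule integral_mono)
    fix x
    have "f (x + z) - f x = (g (x + z) - g x) + (f (x + z) - g (x + z)) - (f x - g x)" by simp
    then show "norm (f (x + z) - f x) \<le> norm (g (x + z) - g x) + norm (f (x + z) - g (x + z)) + norm (f x - g x)"
      using norm_triangle_ineq4[of "(g (x + z) - g x) + (f (x + z) - g (x + z))" "f x - g x"]
        norm_triangle_ineq[of "g (x + z) - g x" "f (x + z) - g (x + z)"] by simp
  qed (use i in auto)
  also have "\<dots> = (LINT x|lborel. norm (g (x + z) - g x)) + (LINT x|lborel. norm (f (x + z) - g (x + z))) + (LINT x|lborel. norm (f x - g x))"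
    using i by simp
  also have "(LINT x|lborel. norm (f (x + z) - g (x + z))) = (LINT x|lborel. norm (f x - g x))"
    using integral_shift[of "\<lambda>x. norm (f x - g x)" z] by simp
  finally show ?thesis by simp
qed

text \<open>The epsilon argument for approximations: the comparison sequence \<open>b\<close> may
  depend on \<open>e\<close>.\<close>

lemma tendsto_zero_squeeze_eps:
  fixes a :: "nat \<Rightarrow> real"
  assumes "\<And>n. 0 \<le> a n" and "\<And>e. e > 0 \<Longrightarrow> \<exists>b. b \<longlonglongrightarrow> 0 \<and> (\<forall>n. a n \<le> b n + e)"
  shows "a \<longlonglongrightarrow> 0"
proof (rule LIMSEQ_I)
  fix r :: real assume "0 < r"
  then obtain b where b: "b \<longlonglongrightarrow> 0" "\<forall>n. a n \<le> b n + r / 2" using assms(2)[of "r/2"] by auto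
  obtain N where "\<forall>n\<ge>N. norm (b n - 0) < r / 2" using LIMSEQ_D[OF b(1), of "r/2"] \<open>0 < r\<close> by auto
  then show "\<exists>no. \<forall>n\<ge>no. norm (a n - 0) < r"
    using assms(1) b(2) by (intro exI[of _ N]) (smt (verit) real_norm_def diff_zero field_sum_of_halves)
qed

text \<open>Induction over integrable functions. Indicators are reached from open sets by outer
  regularity, sums by the triangle inequality, and limits because the approximation error does not
  depend on the shift.\<close>

lemma L1_translation_continuous:
  fixes f :: "'a::euclidean_space \<Rightarrow> 'b::{banach, second_countable_topology}"
  assumes "integrable lborel f" and z: "z \<longlonglongrightarrow> 0"
  shows "(\<lambda>n. LINT x|lborel. norm (f (x + z n) - f x)) \<longlonglongrightarrow> 0"
  using assms(1)
proof (induction rule: integrable_induct)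
  case (base A c)
  then have A[measurable]: "A \<in> sets borel" by simp
  show ?case
  proof (rule tendsto_zero_squeeze_eps)
    fix e :: real assume e: "0 < e"
    \<comment> \<open>Chosen so that twice \<open>d * norm c\<close> is at most \<open>e\<close>;
      the summand 1 covers \<open>c = 0\<close>.\<close>
    define d where "d = e / (2 * norm c + 1)"
    have d: "d > 0" unfolding d_def by (intro divide_pos_pos add_nonneg_pos e) simp_all
    obtain U where U: "open U" "A \<subseteq> U" "emeasure lebesgue (U - A) < ennreal d"
      by (rule sets_lebesgue_outer_open[OF sets_completionI_sets[of A lborel] d]) (simp_all add: A)
    have [measurable]: "U \<in> sets borel" using U by auto
    have UA: "emeasure lborel (U - A) < ennreal d" using U(3) by simp
    have "emeasure lborel U \<le> emeasure lborel A + emeasure lborel (U - A)"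
      using U(2) emeasure_subadditive[of A lborel "U - A"] by (simp add: Un_absorb1)
    also have "\<dots> < \<infinity>" using base UA less_trans[OF UA ennreal_less_top] by simp
    finally have Uf: "emeasure lborel U < \<infinity>" .
    have i: "integrable lborel (\<lambda>x. indicat_real A x *\<^sub>R c)" "integrable lborel (\<lambda>x. indicat_real U x *\<^sub>R c)"
      using base Uf by simp_all
    have "(LINT x|lborel. norm (indicat_real A x *\<^sub>R c - indicat_real U x *\<^sub>R c))
       = (LINT x|lborel. indicat_real (U - A) x * norm c)"
    proof (intro Bochner_Integration.integral_cong refl)
      fix x show "norm (indicat_real A x *\<^sub>R c - indicat_real U x *\<^sub>R c) = indicat_real (U - A) x * norm c"
        using U(2) by (cases "x \<in> A"; cases "x \<in> U") auto
    qed
    also have "\<dots> = measure lborel (U - A) * norm c" by simp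
    also have "measure lborel (U - A) \<le> d" using UA d unfolding measure_def
      by (intro enn2real_leI) auto
    finally have "2 * (LINT x|lborel. norm (indicat_real A x *\<^sub>R c - indicat_real U x *\<^sub>R c)) \<le> 2 * (d * norm c)"
      by (simp add: mult_right_mono)
    also have "\<dots> = e * (2 * norm c / (2 * norm c + 1))" by (simp add: d_def)
    also have "\<dots> \<le> e * 1" using e
      by (intro mult_left_mono) (auto simp: divide_le_eq add_nonneg_pos)
    also have "\<dots> = e" by simp
    finally have le: "2 * (LINT x|lborel. norm (indicat_real A x *\<^sub>R c - indicat_real U x *\<^sub>R c)) \<le> e" .
    let ?b = "\<lambda>n. LINT x|lborel. norm (indicat_real U (x + z n) *\<^sub>R c - indicat_real U x *\<^sub>R c)"
    have "?b = (\<lambda>n. (LINT x|lborel. \<bar>indicat_real U (x + z n) - indicat_real U x\<bar>) * norm c)"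
      by (simp only: scaleR_diff_left[symmetric] norm_scaleR Bochner_Integration.integral_mult_left_zero real_norm_def)
    moreover have "\<dots> \<longlonglongrightarrow> 0 * norm c"
      by (intro tendsto_intros translation_continuous_open U Uf z)
    ultimately have "?b \<longlonglongrightarrow> 0" by (simp only: mult_zero_left)
    moreover have "(LINT x|lborel. norm (indicat_real A (x + z n) *\<^sub>R c - indicat_real A x *\<^sub>R c)) \<le> ?b n + e" for n
      using L1_approx_translation[OF i, of "z n"] le by linarith
    ultimately show "\<exists>b. b \<longlonglongrightarrow> 0 \<and> (\<forall>n. (LINT x|lborel. norm (indicat_real A (x + z n) *\<^sub>R c - indicat_real A x *\<^sub>R c)) \<le> b n + e)"
      by (intro exI[of _ ?b] conjI allI)
  qed (intro integral_nonneg_AE AE_I2 norm_ge_zero)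
next
  case (add f g)
  have "(\<lambda>n. (LINT x|lborel. norm (f (x + z n) - f x)) + (LINT x|lborel. norm (g (x + z n) - g x))) \<longlonglongrightarrow> 0 + 0"
    by (intro tendsto_add add.IH)
  moreover have "(LINT x|lborel. norm (f (x + z n) + g (x + z n) - (f x + g x)))
     \<le> (LINT x|lborel. norm (f (x + z n) - f x)) + (LINT x|lborel. norm (g (x + z n) - g x))" for n
  proof -
    note i = add.hyps integrable_shift[OF add.hyps(1), of "z n"] integrable_shift[OF add.hyps(2), of "z n"]
    have "(LINT x|lborel. norm (f (x + z n) + g (x + z n) - (f x + g x)))
       \<le> (LINT x|lborel. norm (f (x + z n) - f x) + norm (g (x + z n) - g x))"
      using i by (intro integral_mono) (auto simp: add_diff_add intro: norm_triangle_ineq)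
    then show ?thesis using i by simp
  qed
  ultimately show ?case
    using tendsto_sandwich[of "\<lambda>_. 0" "\<lambda>n. LINT x|lborel. norm (f (x + z n) + g (x + z n) - (f x + g x))" sequentially
        "\<lambda>n. (LINT x|lborel. norm (f (x + z n) - f x)) + (LINT x|lborel. norm (g (x + z n) - g x))" 0]
    by (simp add: always_eventually)
next
  case (lim f s)
  \<comment> \<open>The approximants are bounded by \<open>2 * norm (f x)\<close>, hence the error
    by \<open>3 * norm (f x)\<close>.\<close>
  have "(\<lambda>i. LINT x|lborel. norm (f x - s i x)) \<longlonglongrightarrow> (LINT x::'a|lborel. 0)"
  proof (rule integral_dominated_convergence[where w="\<lambda>x. 3 * norm (f x)"])
    show "AE x in lborel. (\<lambda>i. norm (f x - s i x)) \<longlonglongrightarrow> 0"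
    proof (rule AE_I2)
      fix x
      have "(\<lambda>i. norm (f x - s i x)) \<longlonglongrightarrow> norm (f x - f x)" by (intro tendsto_intros lim.hyps) simp
      then show "(\<lambda>i. norm (f x - s i x)) \<longlonglongrightarrow> 0" by simp
    qed
    show "AE x in lborel. norm (norm (f x - s i x)) \<le> 3 * norm (f x)" for i
    proof (rule AE_I2)
      fix x
      show "norm (norm (f x - s i x)) \<le> 3 * norm (f x)"
        using lim.hyps(3)[of x i] norm_triangle_ineq4[of "f x" "s i x"] by simp
    qed
  next
    have "f \<in> borel_measurable lborel" "s i \<in> borel_measurable lborel" for i
      using lim.hyps(1,4) by auto
    then show "(\<lambda>x. norm (f x - s i x)) \<in> borel_measurable lborel" for i by auto
    show "integrable lborel (\<lambda>x. 3 * norm (f x))" using lim.hyps(4) by auto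
  qed simp
  then have l: "(\<lambda>i. LINT x|lborel. norm (f x - s i x)) \<longlonglongrightarrow> 0" by simp
  show ?case
  proof (rule tendsto_zero_squeeze_eps)
    fix e :: real assume "0 < e"
    then obtain i where i: "\<bar>LINT x|lborel. norm (f x - s i x)\<bar> < e / 2"
      using LIMSEQ_D[OF l, of "e/2"] by auto
    show "\<exists>b. b \<longlonglongrightarrow> 0 \<and> (\<forall>n. (LINT x|lborel. norm (f (x + z n) - f x)) \<le> b n + e)"
    proof (intro exI[of _ "\<lambda>n. LINT x|lborel. norm (s i (x + z n) - s i x)"] conjI allI lim.IH)
      fix n
      show "(LINT x|lborel. norm (f (x + z n) - f x)) \<le> (LINT x|lborel. norm (s i (x + z n) - s i x)) + e"
        using L1_approx_translation[OF lim.hyps(4) lim.hyps(1)[of i], of "z n"] i by linarith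
    qed
  qed (intro integral_nonneg_AE AE_I2 norm_ge_zero)
qed

section \<open>Truncation, translations in L^p, and correlations with the nonlinearity\<close>

lemma cnj_measurable[measurable]: "cnj \<in> borel_measurable borel"
  by (intro borel_measurable_continuous_onI continuous_intros)

text \<open>Cut in height and in space at once: the result is bounded and integrable for every
  measurable function, so it links L^p, for any exponent, to L^1.\<close>

definition truncation :: "real \<Rightarrow> ('a::euclidean_space \<Rightarrow> complex) \<Rightarrow> 'a \<Rightarrow> complex" where
  "truncation M f x = (if cmod (f x) \<le> M \<and> norm x \<le> M then f x else 0)"

lemma truncation_measurable[measurable (raw)]:
  assumes [measurable]: "f \<in> borel_measurable borel"
  shows "truncation M f \<in> borel_measurable borel"
  unfolding truncation_def[abs_def] by measurable

lemma norm_truncation_le_const: "0 \<le> M \<Longrightarrow> cmod (truncation M f x) \<le> M"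
  by (simp add: truncation_def)

lemma integrable_truncation:
  fixes f :: "'a::euclidean_space \<Rightarrow> complex"
  assumes [measurable]: "f \<in> borel_measurable borel" and M: "0 \<le> M"
  shows "integrable lborel (truncation M f)"
proof (rule Bochner_Integration.integrable_bound)
  have "emeasure lborel (cball (0::'a) M) < \<infinity>" by (rule emeasure_lborel_cball_finite)
  then show "integrable lborel (\<lambda>x::'a. M * indicat_real (cball 0 M) x)" by simp
  show "AE x in lborel. norm (truncation M f x) \<le> norm (M * indicat_real (cball 0 M) x)"
    using M by (auto simp: truncation_def indicator_def)
qed simp

lemma truncation_eventually:
  "\<forall>\<^sub>F k in sequentially. truncation (real k) f x = f x"
proof -
  obtain N :: nat where "max (cmod (f x)) (norm x) \<le> real N" using real_arch_simple by blast
  then have "truncation (real k) f x = f x" if "k \<ge> N" for k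
    using that by (auto simp: truncation_def)
  then show ?thesis unfolding eventually_sequentially by blast
qed

lemma Lp_truncation_tendsto:
  fixes f :: "'a::euclidean_space \<Rightarrow> complex"
  assumes [measurable]: "f \<in> borel_measurable borel" and p: "0 < p"
    and i: "integrable lborel (\<lambda>x. cmod (f x) powr p)"
  shows "(\<lambda>k. LINT x|lborel. cmod (f x - truncation (real k) f x) powr p) \<longlonglongrightarrow> 0"
proof -
  have "(\<lambda>k. LINT x|lborel. cmod (f x - truncation (real k) f x) powr p) \<longlonglongrightarrow> (LINT x::'a|lborel. 0)"
  proof (rule integral_dominated_convergence[where w="\<lambda>x. cmod (f x) powr p"])
    show "AE x in lborel. (\<lambda>k. cmod (f x - truncation (real k) f x) powr p) \<longlonglongrightarrow> 0"
    proof (rule AE_I2, rule tendsto_eventually)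
      fix x show "\<forall>\<^sub>F k in sequentially. cmod (f x - truncation (real k) f x) powr p = 0"
        using truncation_eventually[of f x] by eventually_elim simp
    qed
    show "AE x in lborel. norm (cmod (f x - truncation (real k) f x) powr p) \<le> cmod (f x) powr p" for k
      by (rule AE_I2) (simp add: truncation_def)
  qed (use i in simp_all)
  then show ?thesis by simp
qed

text \<open>The sum is at most three times its largest term. Unlike convexity this works for every
  \<open>p \<ge> 0\<close>.\<close>

lemma powr_sum3_le:
  fixes a b c :: real
  assumes "0 \<le> a" "0 \<le> b" "0 \<le> c" "0 \<le> p"
  shows "(a + b + c) powr p \<le> 3 powr p * (a powr p + b powr p + c powr p)"
proof -
  define m where "m = max a (max b c)"
  have "(a + b + c) powr p \<le> (3 * m) powr p"
    using assms by (intro powr_mono2) (auto simp: m_def)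
  also have "\<dots> = 3 powr p * m powr p" using assms by (simp add: powr_mult m_def)
  also have "m powr p \<le> a powr p + b powr p + c powr p"
    by (auto simp: m_def max_def)
  finally show ?thesis by simp
qed

lemma integrable_powr_diff_shift:
  fixes f :: "'a::euclidean_space \<Rightarrow> complex"
  assumes [measurable]: "f \<in> borel_measurable borel" and p: "0 \<le> p"
    and i: "integrable lborel (\<lambda>x. cmod (f x) powr p)"
  shows "integrable lborel (\<lambda>x. cmod (f (x + z) - f x) powr p)"
proof (rule Bochner_Integration.integrable_bound)
  show "integrable lborel (\<lambda>x. 3 powr p * (cmod (f (x + z)) powr p + cmod (f x) powr p + 0 powr p))"
    using i integrable_shift[OF i, of z] by auto
  show "AE x in lborel. norm (cmod (f (x + z) - f x) powr p)
     \<le> norm (3 powr p * (cmod (f (x + z)) powr p + cmod (f x) powr p + 0 powr p))"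
  proof (rule AE_I2)
    fix x
    have "cmod (f (x + z) - f x) powr p \<le> (cmod (f (x + z)) + cmod (f x) + 0) powr p"
      using p by (intro powr_mono2) (auto intro: norm_triangle_ineq4)
    also have "\<dots> \<le> 3 powr p * (cmod (f (x + z)) powr p + cmod (f x) powr p + 0 powr p)"
      by (rule powr_sum3_le) (use p in auto)
    finally show "norm (cmod (f (x + z) - f x) powr p)
     \<le> norm (3 powr p * (cmod (f (x + z)) powr p + cmod (f x) powr p + 0 powr p))" by simp
  qed
qed simp

text \<open>Truncation reduces the claim to L^1: differences of values of a function bounded by
  \<open>M\<close> are at most \<open>2 * M\<close>, so their power \<open>p\<close> is at most
  \<open>(2 * M) powr (p - 1)\<close> times their absolute value.\<close>

lemma Lp_translation_continuous:
  fixes f :: "'a::euclidean_space \<Rightarrow> complex"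
  assumes f[measurable]: "f \<in> borel_measurable borel" and p: "1 \<le> p"
    and i: "integrable lborel (\<lambda>x. cmod (f x) powr p)" and z: "z \<longlonglongrightarrow> 0"
  shows "(\<lambda>n. LINT x|lborel. cmod (f (x + z n) - f x) powr p) \<longlonglongrightarrow> 0"
proof (rule tendsto_zero_squeeze_eps)
  show "0 \<le> (LINT x|lborel. cmod (f (x + z n) - f x) powr p)" for n
    by (intro integral_nonneg_AE AE_I2) simp
  fix e :: real assume e: "0 < e"
  \<comment> \<open>The factor 2 counts the truncation errors at \<open>x\<close> and at
    \<open>x + z n\<close>, the factor \<open>3 powr p\<close> comes from
    \<open>powr_sum3_le\<close>.\<close>
  have "(\<lambda>k. 2 * 3 powr p * (LINT x|lborel. cmod (f x - truncation (real k) f x) powr p)) \<longlonglongrightarrow> 2 * 3 powr p * 0"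
    by (intro tendsto_mult_left Lp_truncation_tendsto f i) (use p in simp)
  then have "(\<lambda>k. 2 * 3 powr p * (LINT x|lborel. cmod (f x - truncation (real k) f x) powr p)) \<longlonglongrightarrow> 0" by simp
  from LIMSEQ_D[OF this e] obtain k where
    "norm (2 * 3 powr p * (LINT x|lborel. cmod (f x - truncation (real k) f x) powr p) - 0) < e"
    by blast
  then have k: "2 * 3 powr p * (LINT x|lborel. cmod (f x - truncation (real k) f x) powr p) \<le> e"
    by (simp only: real_norm_def diff_zero abs_less_iff) (rule less_imp_le, blast)
  define M where "M = real k"
  define g where "g = truncation M f"
  have M: "0 \<le> M" by (simp add: M_def)
  have g[measurable]: "g \<in> borel_measurable borel" by (simp add: g_def)
  have gi: "integrable lborel g" unfolding g_def by (rule integrable_truncation[OF f M])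
  define C where "C = 3 powr p * (2 * M) powr (p - 1)"
  let ?b = "\<lambda>n. C * (LINT x|lborel. cmod (g (x + z n) - g x))"
  have "?b \<longlonglongrightarrow> C * 0"
    by (intro tendsto_mult_left L1_translation_continuous gi z)
  then have b: "?b \<longlonglongrightarrow> 0" by simp
  define E where "E = (\<lambda>x. cmod (f x - g x) powr p)"
  have Ei: "integrable lborel E"
  proof (rule Bochner_Integration.integrable_bound[OF i])
    show "AE x in lborel. norm (E x) \<le> norm (cmod (f x) powr p)"
      by (rule AE_I2) (simp add: E_def g_def truncation_def)
  qed (simp add: E_def[abs_def])
  have "(LINT x|lborel. cmod (f (x + z n) - f x) powr p) \<le> ?b n + e" for n
  proof -
    have "(LINT x|lborel. cmod (f (x + z n) - f x) powr p)
      \<le> (LINT x|lborel. 3 powr p * E (x + z n) + C * cmod (g (x + z n) - g x) + 3 powr p * E x)"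
    proof (rule integral_mono)
      show "integrable lborel (\<lambda>x. cmod (f (x + z n) - f x) powr p)"
        by (rule integrable_powr_diff_shift) (use p i in auto)
      show "integrable lborel (\<lambda>x. 3 powr p * E (x + z n) + C * cmod (g (x + z n) - g x) + 3 powr p * E x)"
        using Ei gi integrable_shift[OF Ei, of "z n"] integrable_shift[OF gi, of "z n"] by simp
      fix x
      let ?t = "cmod (g (x + z n) - g x)"
      have "f (x + z n) - f x = (f (x + z n) - g (x + z n)) + (g (x + z n) - g x) - (f x - g x)" by simp
      then have "cmod (f (x + z n) - f x) \<le> cmod (f (x + z n) - g (x + z n)) + ?t + cmod (f x - g x)"
        using norm_triangle_ineq4[of "(f (x + z n) - g (x + z n)) + (g (x + z n) - g x)" "f x - g x"]
          norm_triangle_ineq[of "f (x + z n) - g (x + z n)" "g (x + z n) - g x"] by simp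
      then have "cmod (f (x + z n) - f x) powr p
         \<le> (cmod (f (x + z n) - g (x + z n)) + ?t + cmod (f x - g x)) powr p"
        using p by (intro powr_mono2) auto
      also have "\<dots> \<le> 3 powr p * (E (x + z n) + ?t powr p + E x)"
        unfolding E_def by (rule powr_sum3_le) (use p in auto)
      also have "?t powr p \<le> (2 * M) powr (p - 1) * ?t"
      proof (cases "?t = 0")
        case False
        have "?t \<le> 2 * M"
          using norm_triangle_ineq4[of "g (x + z n)" "g x"] norm_truncation_le_const[OF M, of f x]
            norm_truncation_le_const[OF M, of f "x + z n"] by (simp add: g_def)
        then have "?t powr (p - 1) \<le> (2 * M) powr (p - 1)"
          using p by (intro powr_mono2) auto
        moreover have "?t powr p = ?t powr (p - 1) * ?t"
          using False powr_add[of ?t "p - 1" 1] by simp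
        ultimately show ?thesis by (simp add: mult_right_mono)
      qed (use p in simp)
      finally show "cmod (f (x + z n) - f x) powr p \<le> 3 powr p * E (x + z n) + C * ?t + 3 powr p * E x"
        by (simp add: C_def algebra_simps mult_left_mono)
    qed
    also have "\<dots> = ?b n + 2 * 3 powr p * (LINT x|lborel. E x)"
      using Ei gi integrable_shift[OF Ei, of "z n"] integrable_shift[OF gi, of "z n"]
      by (simp add: integral_shift[of E])
    also have "\<dots> \<le> ?b n + e" using k by (simp add: E_def g_def M_def)
    finally show ?thesis .
  qed
  with b show "\<exists>b. b \<longlonglongrightarrow> 0 \<and> (\<forall>n. (LINT x|lborel. cmod (f (x + z n) - f x) powr p) \<le> b n + e)"
    by (intro exI[of _ ?b] conjI allI)
qed

text \<open>A substitute for Hoelder's inequality, obtained by comparing \<open>a\<close> with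
  \<open>d * b\<close>. The free weight \<open>d\<close> makes the term that is merely bounded
  small, at the cost of a large constant in front of the term that will tend to 0.\<close>

lemma weighted_young:
  fixes a b d \<alpha> :: real
  assumes "0 \<le> a" "0 \<le> b" "0 < d" "0 \<le> \<alpha>"
  shows "a * b powr (\<alpha> + 1) \<le> d * b powr (\<alpha> + 2) + d powr (- (\<alpha> + 1)) * a powr (\<alpha> + 2)"
proof (cases "a \<le> d * b")
  case True
  have "a * b powr (\<alpha> + 1) \<le> d * (b * b powr (\<alpha> + 1))" using True by (simp add: mult.assoc[symmetric] mult_right_mono)
  also have "b * b powr (\<alpha> + 1) = b powr (\<alpha> + 2)"
    using assms powr_mult_base[of b "\<alpha> + 1"] by (simp add: add.commute add.left_commute)
  finally show ?thesis using assms by (simp add: mult.assoc add_increasing2)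
next
  case False
  then have ab: "d * b < a" by simp
  then have "b \<le> a / d" using assms by (simp add: field_simps)
  have "0 \<le> d * b" using assms by simp
  with ab have "a > 0" by linarith
  have "a * b powr (\<alpha> + 1) \<le> a * (a / d) powr (\<alpha> + 1)"
    using assms \<open>b \<le> a / d\<close> by (intro mult_left_mono powr_mono2) auto
  also have "\<dots> = d powr (- (\<alpha> + 1)) * (a * a powr (\<alpha> + 1))"
    using powr_divide[of a d "\<alpha> + 1"] assms \<open>a > 0\<close> by (simp only: powr_minus divide_inverse mult_ac less_imp_le)
  also have "a * a powr (\<alpha> + 1) = a powr (\<alpha> + 2)"
    using assms powr_mult_base[of a "\<alpha> + 1"] by (simp add: add.commute add.left_commute)
  finally show ?thesis using assms by (simp add: add_increasing)
qed

text \<open>For \<open>\<alpha> = 0\<close> this is \<open>f\<close> itself, so that statements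
  about it also cover the plain L^2 pairings.\<close>

definition nonlinearity :: "real \<Rightarrow> ('a \<Rightarrow> complex) \<Rightarrow> 'a \<Rightarrow> complex" where
  "nonlinearity \<alpha> f x = complex_of_real (cmod (f x) powr \<alpha>) * f x"

lemma nonlinearity_measurable[measurable (raw)]:
  assumes [measurable]: "f \<in> borel_measurable M"
  shows "nonlinearity \<alpha> f \<in> borel_measurable M"
  unfolding nonlinearity_def[abs_def] by measurable

lemma norm_nonlinearity: "0 \<le> \<alpha> \<Longrightarrow> cmod (nonlinearity \<alpha> f x) = cmod (f x) powr (\<alpha> + 1)"
  using powr_mult_base[of "cmod (f x)" \<alpha>] by (simp add: nonlinearity_def norm_mult mult.commute add.commute)

lemma cnj_mult_nonlinearity:
  "0 \<le> \<alpha> \<Longrightarrow> cnj (f x) * nonlinearity \<alpha> f x = complex_of_real (cmod (f x) powr (\<alpha> + 2))"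
proof -
  assume "0 \<le> \<alpha>"
  have "cnj (f x) * nonlinearity \<alpha> f x = complex_of_real (cmod (f x) powr \<alpha>) * (f x * cnj (f x))"
    by (simp add: nonlinearity_def)
  also have "\<dots> = complex_of_real (cmod (f x) powr \<alpha> * (cmod (f x))\<^sup>2)"
    by (simp only: complex_norm_square[symmetric] of_real_mult)
  also have "cmod (f x) powr \<alpha> * (cmod (f x))\<^sup>2 = cmod (f x) powr (\<alpha> + 2)"
    by (cases "f x = 0") (simp_all add: powr_add)
  finally show ?thesis .
qed

text \<open>Assuming only a bound on \<open>g\<close> treats the nonlinearity and, with
  \<open>\<alpha> = 0\<close>, \<open>f\<close> itself together. Young's inequality with weight 1
  bounds the product by the sum of \<open>|f|^(\<alpha> + 2)\<close> at the two shifted points; this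
  is the constant 2.\<close>

lemma integral_translate_mult_bound:
  fixes f g :: "'a::euclidean_space \<Rightarrow> complex"
  assumes [measurable]: "f \<in> borel_measurable borel" "g \<in> borel_measurable borel" and \<alpha>: "0 \<le> \<alpha>"
    and i: "integrable lborel (\<lambda>x. cmod (f x) powr (\<alpha> + 2))"
    and g: "\<And>x. cmod (g x) \<le> cmod (f x) powr (\<alpha> + 1)"
  shows "integrable lborel (\<lambda>x. cnj (f (x + a)) * g (x + b))"
    and "(\<integral>\<^sup>+x. ennreal (cmod (cnj (f (x + a)) * g (x + b))) \<partial>lborel)
      \<le> 2 * (\<integral>\<^sup>+x. ennreal (cmod (f x) powr (\<alpha> + 2)) \<partial>lborel)"
proof -
  have le: "cmod (cnj (f (x + a)) * g (x + b)) \<le> cmod (f (x + b)) powr (\<alpha> + 2) + cmod (f (x + a)) powr (\<alpha> + 2)" for x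
  proof -
    have "cmod (cnj (f (x + a)) * g (x + b)) \<le> cmod (f (x + a)) * cmod (f (x + b)) powr (\<alpha> + 1)"
      using g[of "x + b"] by (simp add: norm_mult mult_left_mono)
    also have "\<dots> \<le> cmod (f (x + b)) powr (\<alpha> + 2) + cmod (f (x + a)) powr (\<alpha> + 2)"
      using weighted_young[of "cmod (f (x + a))" "cmod (f (x + b))" 1 \<alpha>] \<alpha> by simp
    finally show ?thesis .
  qed
  show "integrable lborel (\<lambda>x. cnj (f (x + a)) * g (x + b))"
  proof (rule Bochner_Integration.integrable_bound)
    show "integrable lborel (\<lambda>x. cmod (f (x + b)) powr (\<alpha> + 2) + cmod (f (x + a)) powr (\<alpha> + 2))"
      using integrable_shift[OF i, of a] integrable_shift[OF i, of b] by simp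
    show "AE x in lborel. norm (cnj (f (x + a)) * g (x + b)) \<le> norm (cmod (f (x + b)) powr (\<alpha> + 2) + cmod (f (x + a)) powr (\<alpha> + 2))"
      using le by (intro AE_I2) (simp add: abs_of_nonneg)
  qed simp
  have "(\<integral>\<^sup>+x. ennreal (cmod (cnj (f (x + a)) * g (x + b))) \<partial>lborel)
    \<le> (\<integral>\<^sup>+x. ennreal (cmod (f (x + b)) powr (\<alpha> + 2)) + ennreal (cmod (f (x + a)) powr (\<alpha> + 2)) \<partial>lborel)"
    using le by (intro nn_integral_mono) (simp add: ennreal_leI flip: ennreal_plus)
  also have "\<dots> = (\<integral>\<^sup>+x. ennreal (cmod (f (x + b)) powr (\<alpha> + 2)) \<partial>lborel) + (\<integral>\<^sup>+x. ennreal (cmod (f (x + a)) powr (\<alpha> + 2)) \<partial>lborel)"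
    by (rule nn_integral_add) auto
  also have "\<dots> = 2 * (\<integral>\<^sup>+x. ennreal (cmod (f x) powr (\<alpha> + 2)) \<partial>lborel)"
    using nn_integral_shift[of "\<lambda>x. ennreal (cmod (f x) powr (\<alpha> + 2))" a] nn_integral_shift[of "\<lambda>x. ennreal (cmod (f x) powr (\<alpha> + 2))" b]
    by (simp add: mult_2)
  finally show "(\<integral>\<^sup>+x. ennreal (cmod (cnj (f (x + a)) * g (x + b))) \<partial>lborel)
      \<le> 2 * (\<integral>\<^sup>+x. ennreal (cmod (f x) powr (\<alpha> + 2)) \<partial>lborel)" .
qed

text \<open>The difference from the limit is the integral of \<open>cnj (f (x + z n) - f x)\<close>
  times the nonlinearity. Weighted Young separates the two factors: one term is small by the choice
  of \<open>d\<close>, the other by continuity of translations in L^(\<alpha> + 2).\<close>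

lemma correlation_tendsto:
  fixes f :: "'a::euclidean_space \<Rightarrow> complex"
  assumes f[measurable]: "f \<in> borel_measurable borel" and \<alpha>: "0 \<le> \<alpha>"
    and i: "integrable lborel (\<lambda>x. cmod (f x) powr (\<alpha> + 2))" and z: "z \<longlonglongrightarrow> 0"
  shows "(\<lambda>n. LINT x|lborel. cnj (f (x + z n)) * nonlinearity \<alpha> f x)
    \<longlonglongrightarrow> complex_of_real (LINT x|lborel. cmod (f x) powr (\<alpha> + 2))"
proof -
  define I where "I = (LINT x|lborel. cmod (f x) powr (\<alpha> + 2))"
  have I: "0 \<le> I" unfolding I_def by (intro integral_nonneg_AE AE_I2) simp
  define c where "c n = (LINT x|lborel. cnj (f (x + z n)) * nonlinearity \<alpha> f x)" for n
  have bound: "cmod (c n - complex_of_real I)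
     \<le> d * I + d powr (- (\<alpha> + 1)) * (LINT x|lborel. cmod (f (x + z n) - f x) powr (\<alpha> + 2))" if d: "0 < d" for n d
  proof -
    have i1: "integrable lborel (\<lambda>x. cnj (f (x + z n)) * nonlinearity \<alpha> f x)"
      using integral_translate_mult_bound(1)[OF f _ \<alpha> i, of "nonlinearity \<alpha> f" "z n" 0] by (simp add: norm_nonlinearity \<alpha>)
    have i2: "integrable lborel (\<lambda>x. cmod (f (x + z n) - f x) powr (\<alpha> + 2))"
      by (rule integrable_powr_diff_shift) (use \<alpha> i in auto)
    have "complex_of_real I = (LINT x|lborel. complex_of_real (cmod (f x) powr (\<alpha> + 2)))"
      by (simp add: I_def)
    then have "c n - complex_of_real I = (LINT x|lborel. cnj (f (x + z n)) * nonlinearity \<alpha> f x - complex_of_real (cmod (f x) powr (\<alpha> + 2)))"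
      unfolding c_def using i1 i by (subst Bochner_Integration.integral_diff) auto
    also have "\<dots> = (LINT x|lborel. (cnj (f (x + z n)) - cnj (f x)) * nonlinearity \<alpha> f x)"
      by (simp only: cnj_mult_nonlinearity[OF \<alpha>, symmetric] left_diff_distrib)
    also have "cmod \<dots> \<le> (LINT x|lborel. d * cmod (f x) powr (\<alpha> + 2) + d powr (- (\<alpha> + 1)) * cmod (f (x + z n) - f x) powr (\<alpha> + 2))"
    proof (rule Bochner_Integration.integral_norm_bound_integral)
      show "integrable lborel (\<lambda>x. (cnj (f (x + z n)) - cnj (f x)) * nonlinearity \<alpha> f x)"
        using i1 i by (simp only: left_diff_distrib cnj_mult_nonlinearity[OF \<alpha>]) simp
      show "integrable lborel (\<lambda>x. d * cmod (f x) powr (\<alpha> + 2) + d powr (- (\<alpha> + 1)) * cmod (f (x + z n) - f x) powr (\<alpha> + 2))"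
        using i i2 by simp
      fix x
      have "cmod ((cnj (f (x + z n)) - cnj (f x)) * nonlinearity \<alpha> f x) = cmod (f (x + z n) - f x) * cmod (f x) powr (\<alpha> + 1)"
        unfolding norm_mult norm_nonlinearity[OF \<alpha>] complex_cnj_diff[symmetric] complex_mod_cnj ..
      also have "\<dots> \<le> d * cmod (f x) powr (\<alpha> + 2) + d powr (- (\<alpha> + 1)) * cmod (f (x + z n) - f x) powr (\<alpha> + 2)"
        by (rule weighted_young) (use d \<alpha> in auto)
      finally show "cmod ((cnj (f (x + z n)) - cnj (f x)) * nonlinearity \<alpha> f x) \<le> d * cmod (f x) powr (\<alpha> + 2) + d powr (- (\<alpha> + 1)) * cmod (f (x + z n) - f x) powr (\<alpha> + 2)" .
    qed
    also have "\<dots> = d * I + d powr (- (\<alpha> + 1)) * (LINT x|lborel. cmod (f (x + z n) - f x) powr (\<alpha> + 2))"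
      using i i2 by (simp add: I_def)
    finally show ?thesis .
  qed
  have "(\<lambda>n. cmod (c n - complex_of_real I)) \<longlonglongrightarrow> 0"
  proof (rule tendsto_zero_squeeze_eps)
    fix e :: real assume e: "0 < e"
    \<comment> \<open>Makes \<open>d * I\<close> at most \<open>e\<close>, also when
      \<open>I = 0\<close>.\<close>
    define d where "d = e / (I + 1)"
    have d: "0 < d" using e I by (simp add: d_def)
    have "d * I = e * (I / (I + 1))" by (simp add: d_def)
    also have "\<dots> \<le> e * 1" using e I by (intro mult_left_mono) auto
    finally have dI: "d * I \<le> e" by simp
    let ?b = "\<lambda>n. d powr (- (\<alpha> + 1)) * (LINT x|lborel. cmod (f (x + z n) - f x) powr (\<alpha> + 2))"
    have "?b \<longlonglongrightarrow> d powr (- (\<alpha> + 1)) * 0"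
      by (intro tendsto_mult_left Lp_translation_continuous f i z) (use \<alpha> in simp)
    then have "?b \<longlonglongrightarrow> 0" by simp
    moreover have "cmod (c n - complex_of_real I) \<le> ?b n + e" for n
      using bound[OF d, of n] dI by linarith
    ultimately show "\<exists>b. b \<longlonglongrightarrow> 0 \<and> (\<forall>n. cmod (c n - complex_of_real I) \<le> b n + e)"
      by (intro exI[of _ ?b] conjI allI)
  qed simp
  then have "(\<lambda>n. c n - complex_of_real I) \<longlonglongrightarrow> 0" by (rule tendsto_norm_zero_cancel)
  then have "c \<longlonglongrightarrow> complex_of_real I" by (rule LIM_zero_cancel)
  then show ?thesis by (simp add: c_def[abs_def] I_def)
qed

section \<open>Mollification\<close>

lemma borel_fst_snd_measurable[measurable]:
  "(fst :: 'a::second_countable_topology \<times> 'b::second_countable_topology \<Rightarrow> 'a) \<in> borel \<rightarrow>\<^sub>M borel"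
  "(snd :: 'a \<times> 'b \<Rightarrow> 'b) \<in> borel \<rightarrow>\<^sub>M borel"
  by (intro borel_measurable_continuous_onI continuous_intros)+

lemma lborel_product_integral:
  fixes f :: "'a::euclidean_space \<Rightarrow> complex" and g :: "'b::euclidean_space \<Rightarrow> complex"
  assumes f: "integrable lborel f" and g: "integrable lborel g"
  shows "integrable (lborel \<Otimes>\<^sub>M lborel) (\<lambda>p. f (fst p) * g (snd p))"
    and "(LINT p|(lborel \<Otimes>\<^sub>M lborel). f (fst p) * g (snd p)) = (LINT x|lborel. f x) * (LINT y|lborel. g y)"
proof -
  have [measurable]: "f \<in> borel_measurable borel" "g \<in> borel_measurable borel" using f g by auto
  show i: "integrable (lborel \<Otimes>\<^sub>M lborel) (\<lambda>p. f (fst p) * g (snd p))"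
    by (rule lborel_pair.Fubini_integrable) (use f g in \<open>auto simp: norm_mult\<close>)
  show "(LINT p|(lborel \<Otimes>\<^sub>M lborel). f (fst p) * g (snd p)) = (LINT x|lborel. f x) * (LINT y|lborel. g y)"
    using lborel_pair.integral_fst'[OF i] by simp
qed

text \<open>The functions to be averaged satisfy \<open>|f| \<le> h + 1\<close> with
  \<open>h\<close> integrable. Boundedness of the kernel takes care of \<open>h\<close>, its
  integrability of the constant 1.\<close>

definition averaging_kernel :: "('a::euclidean_space \<Rightarrow> real) \<Rightarrow> bool" where
  "averaging_kernel v \<longleftrightarrow> integrable lborel v \<and> (\<exists>B. \<forall>x. \<bar>v x\<bar> \<le> B)"

text \<open>A correlation rather than a convolution: by \<open>mollify_eq\<close> this is the
  pairing of \<open>f\<close> with the kernel centred at \<open>x\<close>, the form in which a test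
  function enters the equation. The kernel is not normalised; the square of its mass appears as a
  factor in the limits and is cancelled at the end.\<close>

definition mollify :: "('a::euclidean_space \<Rightarrow> real) \<Rightarrow> ('a \<Rightarrow> complex) \<Rightarrow> 'a \<Rightarrow> complex" where
  "mollify v f x = (LINT a|lborel. f (x + a) * complex_of_real (v a))"

lemma integrable_mollify_integrand:
  fixes g :: "'a::euclidean_space \<Rightarrow> complex"
  assumes [measurable]: "g \<in> borel_measurable borel" and h: "integrable lborel h"
    and gh: "\<And>x. cmod (g x) \<le> h x + 1" and v: "averaging_kernel v"
  shows "integrable lborel (\<lambda>a. g (x + a) * complex_of_real (v a))"
proof -
  obtain B where B: "\<And>x. \<bar>v x\<bar> \<le> B" and vi: "integrable lborel v"
    using v by (auto simp: averaging_kernel_def)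
  have [measurable]: "v \<in> borel_measurable borel" using vi by auto
  have B0: "0 \<le> B" using B[of 0] by linarith
  show ?thesis
  proof (rule Bochner_Integration.integrable_bound)
    show "integrable lborel (\<lambda>a. B * \<bar>h (a + x)\<bar> + \<bar>v a\<bar>)"
      using integrable_shift[OF h, of x] vi by simp
    show "AE a in lborel. norm (g (x + a) * complex_of_real (v a)) \<le> norm (B * \<bar>h (a + x)\<bar> + \<bar>v a\<bar>)"
    proof (rule AE_I2)
      fix a
      have "norm (g (x + a) * complex_of_real (v a)) = cmod (g (a + x)) * \<bar>v a\<bar>"
        by (simp add: norm_mult add.commute)
      also have "\<dots> \<le> (\<bar>h (a + x)\<bar> + 1) * \<bar>v a\<bar>"
        using gh[of "a + x"] by (intro mult_right_mono) auto
      also have "\<dots> \<le> B * \<bar>h (a + x)\<bar> + \<bar>v a\<bar>"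
        using B[of a] mult_right_mono[of "\<bar>v a\<bar>" B "\<bar>h (a + x)\<bar>"] by (simp add: algebra_simps)
      finally show "norm (g (x + a) * complex_of_real (v a)) \<le> norm (B * \<bar>h (a + x)\<bar> + \<bar>v a\<bar>)"
        using B0 by simp
    qed
  qed simp
qed

lemma powr_less_succ: "0 \<le> (t::real) \<Longrightarrow> 0 \<le> p \<Longrightarrow> p \<le> q \<Longrightarrow> t powr p \<le> t powr q + 1"
proof (cases "t \<le> 1")
  case True
  assume "0 \<le> t" "0 \<le> p"
  with True have "t powr p \<le> 1" by (simp add: powr_le1)
  then show ?thesis by (simp add: add_increasing)
next
  case False
  assume "p \<le> q"
  with False have "t powr p \<le> t powr q" by (intro powr_mono) auto
  then show ?thesis by simp
qed

text \<open>Expanding both averages gives a triple integral. Integrated in \<open>x\<close> first,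
  it is bounded by the kernel masses times twice the integral of \<open>|f|^(\<alpha> + 2)\<close>,
  so Fubini applies and the pairing becomes an average of correlations of \<open>f\<close> and
  \<open>g\<close>. Reality and limits are read off from that form.\<close>

lemma mollify_pairing:
  fixes f g :: "'a::euclidean_space \<Rightarrow> complex"
  assumes f[measurable]: "f \<in> borel_measurable borel" and g[measurable]: "g \<in> borel_measurable borel"
    and \<alpha>: "0 \<le> \<alpha>" and i: "integrable lborel (\<lambda>x. cmod (f x) powr (\<alpha> + 2))"
    and gf: "\<And>x. cmod (g x) \<le> cmod (f x) powr (\<alpha> + 1)"
    and v: "averaging_kernel v" and w: "averaging_kernel w"
  shows mollify_pairing_integrable: "integrable lborel (\<lambda>x. cnj (mollify v f x) * mollify w g x)"
    and mollify_pairing_eq: "(LINT x|lborel. cnj (mollify v f x) * mollify w g x)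
      = (LINT p|(lborel \<Otimes>\<^sub>M lborel). complex_of_real (v (fst p) * w (snd p)) * (LINT x|lborel. cnj (f (x + fst p)) * g (x + snd p)))"
    and mollify_pairing_bound: "(\<integral>\<^sup>+x. ennreal (cmod (mollify v f x) * cmod (mollify w g x)) \<partial>lborel)
      \<le> 2 * (\<integral>\<^sup>+a. ennreal \<bar>v a\<bar> \<partial>lborel) * (\<integral>\<^sup>+a. ennreal \<bar>w a\<bar> \<partial>lborel) * (\<integral>\<^sup>+x. ennreal (cmod (f x) powr (\<alpha> + 2)) \<partial>lborel)"
proof -
  have vi[measurable]: "v \<in> borel_measurable borel" "w \<in> borel_measurable borel"
    using v w by (auto simp: averaging_kernel_def)
  define H where "H x p = cnj (f (x + fst p) * complex_of_real (v (fst p))) * (g (x + snd p) * complex_of_real (w (snd p)))"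
    for x :: 'a and p :: "'a \<times> 'a"
  define I where "I = (\<integral>\<^sup>+x. ennreal (cmod (f x) powr (\<alpha> + 2)) \<partial>lborel)"
  have I: "I < \<infinity>" using i by (auto simp: I_def integrable_iff_bounded)
  have [measurable]: "case_prod H \<in> borel_measurable (lborel \<Otimes>\<^sub>M (lborel \<Otimes>\<^sub>M lborel))"
    unfolding H_def case_prod_beta by measurable
  have fi: "integrable lborel (\<lambda>a. f (x + a) * complex_of_real (v a))" for x
    by (rule integrable_mollify_integrand[OF f i _ v])
      (use powr_less_succ[of "cmod (f _)" 1 "\<alpha> + 2"] \<alpha> in simp)
  have gi: "integrable lborel (\<lambda>a. g (x + a) * complex_of_real (w a))" for x
    by (rule integrable_mollify_integrand[OF g i _ w])
      (use order_trans[OF gf powr_less_succ[of _ "\<alpha> + 1" "\<alpha> + 2"]] \<alpha> in simp)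
  have Hx: "integrable (lborel \<Otimes>\<^sub>M lborel) (H x)"
    "(LINT p|(lborel \<Otimes>\<^sub>M lborel). H x p) = cnj (mollify v f x) * mollify w g x" for x
    using lborel_product_integral[OF integrable_cnj[OF fi[of x]] gi[of x]]
    unfolding H_def[abs_def] mollify_def Bochner_Integration.integral_cnj .
  have nx: "(\<integral>\<^sup>+x. ennreal (norm (H x p)) \<partial>lborel) \<le> ennreal \<bar>v (fst p)\<bar> * ennreal \<bar>w (snd p)\<bar> * (2 * I)" for p
  proof -
    have "(\<integral>\<^sup>+x. ennreal (norm (H x p)) \<partial>lborel)
      = (\<integral>\<^sup>+x. (ennreal \<bar>v (fst p)\<bar> * ennreal \<bar>w (snd p)\<bar>) * ennreal (cmod (cnj (f (x + fst p)) * g (x + snd p))) \<partial>lborel)"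
      by (intro nn_integral_cong) (simp add: H_def norm_mult flip: ennreal_mult' ; simp add: mult_ac)
    also have "\<dots> = ennreal \<bar>v (fst p)\<bar> * ennreal \<bar>w (snd p)\<bar> * (\<integral>\<^sup>+x. ennreal (cmod (cnj (f (x + fst p)) * g (x + snd p))) \<partial>lborel)"
      by (rule nn_integral_cmult) simp
    also have "\<dots> \<le> ennreal \<bar>v (fst p)\<bar> * ennreal \<bar>w (snd p)\<bar> * (2 * I)"
      unfolding I_def by (intro mult_left_mono integral_translate_mult_bound(2)[OF f g \<alpha> i gf]) simp
    finally show ?thesis .
  qed
  have tot: "(\<integral>\<^sup>+x. (\<integral>\<^sup>+p. ennreal (norm (H x p)) \<partial>(lborel \<Otimes>\<^sub>M lborel)) \<partial>lborel)
     \<le> 2 * (\<integral>\<^sup>+a. ennreal \<bar>v a\<bar> \<partial>lborel) * (\<integral>\<^sup>+a. ennreal \<bar>w a\<bar> \<partial>lborel) * I"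
  proof -
    interpret P: pair_sigma_finite "lborel :: 'a measure" "lborel \<Otimes>\<^sub>M lborel :: ('a \<times> 'a) measure"
      unfolding lborel_prod ..
    have "(\<integral>\<^sup>+x. (\<integral>\<^sup>+p. ennreal (norm (H x p)) \<partial>(lborel \<Otimes>\<^sub>M lborel)) \<partial>lborel)
      = (\<integral>\<^sup>+p. (\<integral>\<^sup>+x. ennreal (norm (H x p)) \<partial>lborel) \<partial>(lborel \<Otimes>\<^sub>M lborel))"
      by (rule P.Fubini'[symmetric]) measurable
    also have "\<dots> \<le> (\<integral>\<^sup>+p. ennreal \<bar>v (fst p)\<bar> * ennreal \<bar>w (snd p)\<bar> * (2 * I) \<partial>(lborel \<Otimes>\<^sub>M lborel))"
      by (intro nn_integral_mono nx)
    also have "\<dots> = (\<integral>\<^sup>+a. (\<integral>\<^sup>+b. ennreal \<bar>v a\<bar> * ennreal \<bar>w b\<bar> * (2 * I) \<partial>lborel) \<partial>lborel)"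
      by (subst lborel.nn_integral_fst[symmetric]) simp_all
    also have "\<dots> = 2 * (\<integral>\<^sup>+a. ennreal \<bar>v a\<bar> \<partial>lborel) * (\<integral>\<^sup>+a. ennreal \<bar>w a\<bar> \<partial>lborel) * I"
      by (simp add: nn_integral_cmult nn_integral_multc mult_ac)
    finally show ?thesis .
  qed
  interpret P: pair_sigma_finite "lborel :: 'a measure" "lborel \<Otimes>\<^sub>M lborel :: ('a \<times> 'a) measure"
    unfolding lborel_prod ..
  have fin: "2 * (\<integral>\<^sup>+a. ennreal \<bar>v a\<bar> \<partial>lborel) * (\<integral>\<^sup>+a. ennreal \<bar>w a\<bar> \<partial>lborel) * I < \<infinity>"
    using v w I by (auto simp: averaging_kernel_def integrable_iff_bounded ennreal_mult_less_top)
  have S: "sigma_finite_measure (lborel \<Otimes>\<^sub>M lborel :: ('a \<times> 'a) measure)"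
    unfolding lborel_prod by (rule sigma_finite_lborel)
  have Hi: "integrable (lborel \<Otimes>\<^sub>M (lborel \<Otimes>\<^sub>M lborel)) (case_prod H)"
  proof (rule integrableI_bounded)
    have "(\<integral>\<^sup>+x. ennreal (norm (case_prod H x)) \<partial>(lborel \<Otimes>\<^sub>M (lborel \<Otimes>\<^sub>M lborel)))
      = (\<integral>\<^sup>+x. (\<integral>\<^sup>+p. ennreal (norm (H x p)) \<partial>(lborel \<Otimes>\<^sub>M lborel)) \<partial>lborel)"
      by (subst sigma_finite_measure.nn_integral_fst[OF S, symmetric]) simp_all
    also have "\<dots> < \<infinity>" using tot fin by (rule le_less_trans)
    finally show "(\<integral>\<^sup>+x. ennreal (norm (case_prod H x)) \<partial>(lborel \<Otimes>\<^sub>M (lborel \<Otimes>\<^sub>M lborel))) < \<infinity>" .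
  qed simp
  show "integrable lborel (\<lambda>x. cnj (mollify v f x) * mollify w g x)"
    using P.integrable_fst[OF Hi] by (simp only: Hx)
  have "(LINT x|lborel. cnj (mollify v f x) * mollify w g x) = (LINT p|(lborel \<Otimes>\<^sub>M lborel). LINT x|lborel. H x p)"
    using P.Fubini_integral[OF Hi] by (simp only: Hx)
  also have "(\<lambda>p. LINT x|lborel. H x p) = (\<lambda>p. complex_of_real (v (fst p) * w (snd p)) * (LINT x|lborel. cnj (f (x + fst p)) * g (x + snd p)))"
  proof
    fix p
    have "(LINT x|lborel. H x p) = (LINT x|lborel. complex_of_real (v (fst p) * w (snd p)) * (cnj (f (x + fst p)) * g (x + snd p)))"
      by (intro Bochner_Integration.integral_cong refl) (simp add: H_def)
    then show "(LINT x|lborel. H x p) = complex_of_real (v (fst p) * w (snd p)) * (LINT x|lborel. cnj (f (x + fst p)) * g (x + snd p))"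
      by (simp only: Bochner_Integration.integral_mult_right_zero)
  qed
  finally show "(LINT x|lborel. cnj (mollify v f x) * mollify w g x)
      = (LINT p|(lborel \<Otimes>\<^sub>M lborel). complex_of_real (v (fst p) * w (snd p)) * (LINT x|lborel. cnj (f (x + fst p)) * g (x + snd p)))" .
  have "(\<integral>\<^sup>+x. ennreal (cmod (mollify v f x) * cmod (mollify w g x)) \<partial>lborel)
      \<le> (\<integral>\<^sup>+x. (\<integral>\<^sup>+p. ennreal (norm (H x p)) \<partial>(lborel \<Otimes>\<^sub>M lborel)) \<partial>lborel)"
  proof (rule nn_integral_mono)
    fix x
    have "ennreal (cmod (mollify v f x) * cmod (mollify w g x)) = ennreal (norm (LINT p|(lborel \<Otimes>\<^sub>M lborel). H x p))"
      unfolding Hx by (simp add: norm_mult)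
    also have "\<dots> \<le> ennreal (LINT p|(lborel \<Otimes>\<^sub>M lborel). norm (H x p))"
      by (intro ennreal_leI integral_norm_bound)
    also have "\<dots> = (\<integral>\<^sup>+p. ennreal (norm (H x p)) \<partial>(lborel \<Otimes>\<^sub>M lborel))"
      by (rule nn_integral_eq_integral[symmetric]) (use Hx in auto)
    finally show "ennreal (cmod (mollify v f x) * cmod (mollify w g x)) \<le> (\<integral>\<^sup>+p. ennreal (norm (H x p)) \<partial>(lborel \<Otimes>\<^sub>M lborel))" .
  qed
  also note tot
  finally show "(\<integral>\<^sup>+x. ennreal (cmod (mollify v f x) * cmod (mollify w g x)) \<partial>lborel)
      \<le> 2 * (\<integral>\<^sup>+a. ennreal \<bar>v a\<bar> \<partial>lborel) * (\<integral>\<^sup>+a. ennreal \<bar>w a\<bar> \<partial>lborel) * (\<integral>\<^sup>+x. ennreal (cmod (f x) powr (\<alpha> + 2)) \<partial>lborel)"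
    unfolding I_def .
qed

lemma integral_shift_pair:
  fixes f g :: "'a::euclidean_space \<Rightarrow> complex"
  shows "(LINT x|lborel. cnj (f (x + a)) * g (x + b)) = (LINT x|lborel. cnj (f (x + (a - b))) * g x)"
  using integral_shift[of "\<lambda>x. cnj (f (x + (a - b))) * g x" b] by (simp add: algebra_simps)

text \<open>The pairing is real because the reflection of both kernels exchanges the two factors.\<close>

lemma mollify_pairing_real:
  fixes f :: "'a::euclidean_space \<Rightarrow> complex"
  assumes f[measurable]: "f \<in> borel_measurable borel"
    and i: "integrable lborel (\<lambda>x. (cmod (f x))\<^sup>2)"
    and v: "averaging_kernel v" and w: "averaging_kernel w"
    and ev: "\<And>x. v (- x) = v x" "\<And>x. w (- x) = w x"
  shows "Im (LINT x|lborel. cnj (mollify v f x) * mollify w f x) = 0"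
proof -
  have i': "integrable lborel (\<lambda>x. cmod (f x) powr (0 + 2))"
    using i by (simp add: powr_numeral)
  define c where "c z = (LINT x|lborel. cnj (f (x + z)) * f x)" for z
  \<comment> \<open>A translation of the integration variable moves the displacement to the other
    factor, so conjugation reverses the sign of \<open>z\<close>.\<close>
  have cc: "cnj (c z) = c (- z)" for z
  proof -
    have "cnj (c z) = (LINT x|lborel. cnj (f (x + 0)) * f (x + z))"
      unfolding c_def by (subst Bochner_Integration.integral_cnj[symmetric]) (simp add: mult.commute)
    also have "\<dots> = c (- z)" unfolding integral_shift_pair c_def by simp
    finally show ?thesis .
  qed
  let ?J = "LINT x|lborel. cnj (mollify v f x) * mollify w f x"
  have J: "?J = (LINT p|lborel. complex_of_real (v (fst p) * w (snd p)) * c (fst p - snd p))"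
    unfolding mollify_pairing_eq[OF f f order_refl i' _ v w, simplified] c_def lborel_prod
    by (subst integral_shift_pair) simp
  have "cnj ?J = (LINT p|lborel. complex_of_real (v (fst p) * w (snd p)) * c (snd p - fst p))"
    unfolding J by (subst Bochner_Integration.integral_cnj[symmetric]) (simp add: cc)
  also have "\<dots> = (LINT p|lborel. complex_of_real (v (fst (-p)) * w (snd (-p))) * c (snd (-p) - fst (-p)))"
    by (rule integral_reflect[symmetric])
  also have "\<dots> = ?J" unfolding J by (simp add: ev)
  finally show ?thesis by (simp add: complex_eq_iff)
qed

text \<open>Rescaling the argument of the kernel by \<open>r\<close> divides its mass by
  \<open>r ^ DIM('a)\<close>; two kernels explain the power \<open>2 * DIM('a)\<close>. After a
  change of variables the correlation is evaluated at displacements of order \<open>1 / r\<close>,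
  where it tends to its value at 0, and it is bounded by \<open>2 * I\<close> throughout.\<close>

lemma mollify_limit:
  fixes f :: "'a::euclidean_space \<Rightarrow> complex"
  assumes f[measurable]: "f \<in> borel_measurable borel" and \<alpha>: "0 \<le> \<alpha>"
    and i: "integrable lborel (\<lambda>x. cmod (f x) powr (\<alpha> + 2))"
    and v: "averaging_kernel v"
  shows "(\<lambda>n. complex_of_real (real (Suc n) ^ (2 * DIM('a))) * (LINT x|lborel. cnj (mollify (\<lambda>a. v (real (Suc n) *\<^sub>R a)) f x) * mollify (\<lambda>a. v (real (Suc n) *\<^sub>R a)) (nonlinearity \<alpha> f) x))
     \<longlonglongrightarrow> complex_of_real ((LINT a|lborel. v a)\<^sup>2 * (LINT x|lborel. cmod (f x) powr (\<alpha> + 2)))"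
proof -
  have vi: "integrable lborel v" using v by (simp add: averaging_kernel_def)
  then have [measurable]: "v \<in> borel_measurable borel" by auto
  define g where "g = nonlinearity \<alpha> f"
  have g[measurable]: "g \<in> borel_measurable borel" by (simp add: g_def)
  have gf: "cmod (g x) \<le> cmod (f x) powr (\<alpha> + 1)" for x by (simp add: g_def norm_nonlinearity \<alpha>)
  define c where "c z = (LINT x|lborel. cnj (f (x + z)) * g x)" for z
  define I where "I = (LINT x|lborel. cmod (f x) powr (\<alpha> + 2))"
  have I0: "0 \<le> I" unfolding I_def by (intro integral_nonneg_AE AE_I2) simp
  have cb: "cmod (c z) \<le> 2 * I" for z
  proof -
    have "ennreal (cmod (c z)) \<le> (\<integral>\<^sup>+x. ennreal (cmod (cnj (f (x + z)) * g x)) \<partial>lborel)"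
      unfolding c_def using integral_translate_mult_bound(1)[OF f g \<alpha> i gf, of z 0]
      by (intro integral_norm_bound_ennreal) simp
    also have "\<dots> \<le> 2 * (\<integral>\<^sup>+x. ennreal (cmod (f x) powr (\<alpha> + 2)) \<partial>lborel)"
      using integral_translate_mult_bound(2)[OF f g \<alpha> i gf, of z 0] by simp
    also have "(\<integral>\<^sup>+x. ennreal (cmod (f x) powr (\<alpha> + 2)) \<partial>lborel) = ennreal I"
      unfolding I_def by (intro nn_integral_eq_integral i AE_I2) simp
    also have "2 * ennreal I = ennreal (2 * I)" using I0 by (simp add: ennreal_mult)
    finally show ?thesis using I0 by simp
  qed
  have cm[measurable]: "c \<in> borel_measurable borel"
    unfolding c_def by measurable
  have eq: "complex_of_real (r ^ (2 * DIM('a))) * (LINT x|lborel. cnj (mollify (\<lambda>a. v (r *\<^sub>R a)) f x) * mollify (\<lambda>a. v (r *\<^sub>R a)) g x)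
    = (LINT p|lborel. complex_of_real (v (fst p) * v (snd p)) * c ((1 / r) *\<^sub>R (fst p - snd p)))" if r: "0 < r" for r
  proof -
    have k: "averaging_kernel (\<lambda>a. v (r *\<^sub>R a))"
      using lborel_affine_change(1)[OF vi, of r 0] r v by (auto simp: averaging_kernel_def)
    let ?F = "\<lambda>p. complex_of_real (v (fst p) * v (snd p)) * c ((1 / r) *\<^sub>R (fst p - snd p))"
    have iF: "integrable lborel ?F"
    proof (rule Bochner_Integration.integrable_bound)
      have "integrable (lborel \<Otimes>\<^sub>M lborel) (\<lambda>p. complex_of_real \<bar>v (fst p)\<bar> * complex_of_real \<bar>v (snd p)\<bar>)"
        by (rule lborel_product_integral) (use vi in auto)
      then show "integrable lborel (\<lambda>p. complex_of_real \<bar>v (fst p)\<bar> * complex_of_real \<bar>v (snd p)\<bar> * complex_of_real (2 * I))"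
        unfolding lborel_prod by (rule integrable_mult_left)
      show "AE p in lborel. norm (?F p) \<le> norm (complex_of_real \<bar>v (fst p)\<bar> * complex_of_real \<bar>v (snd p)\<bar> * complex_of_real (2 * I))"
        using cb I0 by (intro AE_I2) (simp add: norm_mult abs_mult mult_left_mono)
    qed simp
    have "(LINT x|lborel. cnj (mollify (\<lambda>a. v (r *\<^sub>R a)) f x) * mollify (\<lambda>a. v (r *\<^sub>R a)) g x)
      = (LINT p|lborel. complex_of_real (v (r *\<^sub>R fst p) * v (r *\<^sub>R snd p)) * c (fst p - snd p))"
      unfolding mollify_pairing_eq[OF f g \<alpha> i gf k k] c_def lborel_prod
      by (subst integral_shift_pair) simp
    \<comment> \<open>One substitution in the product space scales both variables at once, with
      Jacobian \<open>r ^ (2 * DIM('a))\<close>.\<close>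
    also have "\<dots> = (LINT p|lborel. ?F (r *\<^sub>R p))"
      using r by (intro Bochner_Integration.integral_cong refl) (simp flip: scaleR_diff_right)
    finally show ?thesis
      using lborel_affine_change(2)[OF iF, of r 0] r
      by (simp add: scaleR_conv_of_real mult_2)
  qed
  have "(\<lambda>n. LINT p|lborel. complex_of_real (v (fst p) * v (snd p)) * c ((1 / real (Suc n)) *\<^sub>R (fst p - snd p)))
    \<longlonglongrightarrow> (LINT p|lborel. complex_of_real (v (fst p) * v (snd p)) * complex_of_real I)"
  proof (rule integral_dominated_convergence)
    have "integrable (lborel \<Otimes>\<^sub>M lborel) (\<lambda>p. complex_of_real \<bar>v (fst p)\<bar> * complex_of_real \<bar>v (snd p)\<bar>)"
      by (rule lborel_product_integral) (use vi in auto)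
    then have "integrable lborel (\<lambda>p. norm (complex_of_real \<bar>v (fst p)\<bar> * complex_of_real \<bar>v (snd p)\<bar>))"
      unfolding lborel_prod by (rule integrable_norm)
    then show "integrable lborel (\<lambda>p. \<bar>v (fst p)\<bar> * \<bar>v (snd p)\<bar> * (2 * I))"
      by (simp add: norm_mult)
    show "AE p in lborel. norm (complex_of_real (v (fst p) * v (snd p)) * c ((1 / real (Suc n)) *\<^sub>R (fst p - snd p))) \<le> \<bar>v (fst p)\<bar> * \<bar>v (snd p)\<bar> * (2 * I)" for n
      using cb I0 by (intro AE_I2) (simp add: norm_mult abs_mult mult_left_mono)
    show "AE p in lborel. (\<lambda>n. complex_of_real (v (fst p) * v (snd p)) * c ((1 / real (Suc n)) *\<^sub>R (fst p - snd p)))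
       \<longlonglongrightarrow> complex_of_real (v (fst p) * v (snd p)) * complex_of_real I"
    proof (rule AE_I2, rule tendsto_mult_left)
      fix p :: "'a \<times> 'a"
      have "(\<lambda>n. (1 / real (Suc n)) *\<^sub>R (fst p - snd p)) \<longlonglongrightarrow> 0 *\<^sub>R (fst p - snd p)"
        using LIMSEQ_inverse_real_of_nat by (intro tendsto_scaleR tendsto_const) (simp add: inverse_eq_divide)
      then have z: "(\<lambda>n. (1 / real (Suc n)) *\<^sub>R (fst p - snd p)) \<longlonglongrightarrow> 0" by simp
      show "(\<lambda>n. c ((1 / real (Suc n)) *\<^sub>R (fst p - snd p))) \<longlonglongrightarrow> complex_of_real I"
        unfolding c_def I_def g_def by (rule correlation_tendsto[OF f \<alpha> i z])
    qed
  qed simp_all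
  also have "(LINT p|lborel. complex_of_real (v (fst p) * v (snd p)) * complex_of_real I) = complex_of_real ((LINT a|lborel. v a)\<^sup>2 * I)"
    using lborel_product_integral(2)[of "\<lambda>a. complex_of_real (v a)" "\<lambda>a. complex_of_real (v a)"] vi
    unfolding lborel_prod by (simp add: power2_eq_square)
  finally show ?thesis
    unfolding I_def g_def[symmetric] by (subst eq) simp_all
qed

section \<open>Plancherel for integrable functions\<close>

lemma integral_lborel_affine:
  fixes f :: "'a::euclidean_space \<Rightarrow> 'b::{banach, second_countable_topology}"
  assumes c: "c \<noteq> 0"
  shows "(LINT x|lborel. f (t + c *\<^sub>R x)) = (1 / \<bar>c\<bar> ^ DIM('a)) *\<^sub>R (LINT x|lborel. f x)"
proof (cases "integrable lborel f")
  case True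
  then show ?thesis using lborel_affine_change(2)[OF True c, of t] c by simp
next
  case False
  have "\<not> integrable lborel (\<lambda>x. f (t + c *\<^sub>R x))"
  proof
    assume "integrable lborel (\<lambda>x. f (t + c *\<^sub>R x))"
    from lborel_affine_change(1)[OF this, of "1/c" "- (1/c) *\<^sub>R t"]
    have "integrable lborel f" using c by (simp add: algebra_simps)
    with False show False by simp
  qed
  with False show ?thesis by (simp add: not_integrable_integral_eq)
qed

lemma integral_lborel_prod:
  fixes f :: "'a::euclidean_space \<Rightarrow> real \<Rightarrow> complex"
  assumes i: "\<And>b. b \<in> Basis \<Longrightarrow> integrable lborel (f b)"
  shows "integrable lborel (\<lambda>x::'a. \<Prod>b\<in>Basis. f b (x \<bullet> b))"
    and "(LINT x|lborel. (\<Prod>b\<in>Basis. f b (x \<bullet> b))) = (\<Prod>b\<in>Basis. (LINT x|lborel. f b x))"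
proof -
  interpret P: product_sigma_finite "\<lambda>_::'a. lborel :: real measure" ..
  have [measurable]: "f b \<in> borel_measurable borel" if "b \<in> Basis" for b using i[OF that] by auto
  have eq: "(\<Prod>b\<in>Basis. f b ((\<Sum>c\<in>Basis. x c *\<^sub>R c) \<bullet> b)) = (\<Prod>b\<in>Basis. f b (x b))" for x :: "'a \<Rightarrow> real"
    by (intro prod.cong refl) (simp add: inner_sum_left_Basis)
  have "integrable (\<Pi>\<^sub>M b\<in>Basis. lborel) (\<lambda>x. \<Prod>b\<in>(Basis::'a set). f b (x b))"
    by (rule P.product_integrable_prod) (use i in auto)
  then show "integrable lborel (\<lambda>x::'a. \<Prod>b\<in>Basis. f b (x \<bullet> b))"
    by (subst lborel_eq, subst integrable_distr_eq) (simp_all add: eq)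
  have "(LINT x|lborel. (\<Prod>b\<in>Basis. f b (x \<bullet> b))) = (LINT x|(\<Pi>\<^sub>M b\<in>Basis. lborel). (\<Prod>b\<in>(Basis::'a set). f b (x b)))"
    by (subst lborel_eq, subst integral_distr) (simp_all add: eq)
  also have "\<dots> = (\<Prod>b\<in>Basis. (LINT x|lborel. f b x))"
    by (rule P.product_integral_prod) (use i in auto)
  finally show "(LINT x|lborel. (\<Prod>b\<in>Basis. f b (x \<bullet> b))) = (\<Prod>b\<in>Basis. (LINT x|lborel. f b x))" .
qed

text \<open>The standard normal density on the whole space. By \<open>gaussian_prod\<close> its
  transform factors into characteristic functions of the one-dimensional normal
  distribution.\<close>

definition gaussian :: "'a::euclidean_space \<Rightarrow> real" where
  "gaussian x = (2 * pi) powr (- real DIM('a) / 2) * exp (- (norm x)\<^sup>2 / 2)"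

lemma gaussian_nonneg: "0 \<le> gaussian x" by (simp add: gaussian_def)

lemma gaussian_measurable[measurable]: "gaussian \<in> borel_measurable borel"
  unfolding gaussian_def[abs_def] by measurable

lemma gaussian_prod: "gaussian (x::'a::euclidean_space) = (\<Prod>b\<in>Basis. std_normal_density (x \<bullet> b))"
proof -
  have "(\<Prod>b\<in>(Basis::'a set). std_normal_density (x \<bullet> b)) = (1 / sqrt (2 * pi)) ^ DIM('a) * exp (- (\<Sum>b\<in>Basis. (x \<bullet> b)\<^sup>2) / 2)"
    by (simp add: std_normal_density_def prod_dividef power_one_over exp_sum[symmetric] sum_divide_distrib sum_negf)
  also have "(\<Sum>b\<in>Basis. (x \<bullet> b)\<^sup>2) = (norm x)\<^sup>2"
    unfolding power2_norm_eq_inner euclidean_inner[of x x] by (simp add: power2_eq_square)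
  also have "(1 / sqrt (2 * pi)) ^ DIM('a) = (2 * pi) powr (- real DIM('a) / 2)"
    by (simp add: powr_half_sqrt[symmetric] powr_minus_divide[symmetric] powr_realpow[symmetric] powr_powr)
  finally show ?thesis by (simp add: gaussian_def)
qed

lemma cis_measurable[measurable]: "cis \<in> borel_measurable borel"
  by (intro borel_measurable_continuous_onI continuous_intros)

lemma std_normal_fourier:
  "integrable lborel (\<lambda>x. complex_of_real (std_normal_density x) * cis (t * x))"
  "(LINT x|lborel. complex_of_real (std_normal_density x) * cis (t * x)) = complex_of_real (exp (- t\<^sup>2 / 2))"
proof -
  have "integrable lborel std_normal_density" by (rule integrable_normal_density) simp
  then show "integrable lborel (\<lambda>x. complex_of_real (std_normal_density x) * cis (t * x))"
    by (rule Bochner_Integration.integrable_bound) (auto simp: norm_mult cis_measurable)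
  have "char std_normal_distribution t = (LINT x|lborel. std_normal_density x *\<^sub>R iexp (t * x))"
    unfolding char_def by (subst integral_density) auto
  also have "\<dots> = (LINT x|lborel. complex_of_real (std_normal_density x) * cis (t * x))"
    by (simp add: scaleR_conv_of_real cis_conv_exp)
  finally show "(LINT x|lborel. complex_of_real (std_normal_density x) * cis (t * x)) = complex_of_real (exp (- t\<^sup>2 / 2))"
    by (simp add: char_std_normal_distribution)
qed

lemma gaussian_fourier:
  fixes \<xi> :: "'a::euclidean_space"
  shows "integrable lborel (\<lambda>x. complex_of_real (gaussian x) * cis (\<xi> \<bullet> x))"
    and "(LINT x|lborel. complex_of_real (gaussian x) * cis (\<xi> \<bullet> x)) = complex_of_real (exp (- (norm \<xi>)\<^sup>2 / 2))"
proof -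
  have eq: "complex_of_real (gaussian x) * cis (\<xi> \<bullet> x) = (\<Prod>b\<in>Basis. complex_of_real (std_normal_density (x \<bullet> b)) * cis ((\<xi> \<bullet> b) * (x \<bullet> b)))" for x
    by (simp add: gaussian_prod prod.distrib cis_conv_exp sum_distrib_left exp_sum euclidean_inner[of \<xi> x])
  show "integrable lborel (\<lambda>x. complex_of_real (gaussian x) * cis (\<xi> \<bullet> x))"
    unfolding eq by (rule integral_lborel_prod(1)) (rule std_normal_fourier)
  have "(LINT x|lborel. complex_of_real (gaussian x) * cis (\<xi> \<bullet> x)) = (\<Prod>b\<in>Basis. complex_of_real (exp (- (\<xi> \<bullet> b)\<^sup>2 / 2)))"
    unfolding eq by (subst integral_lborel_prod(2)) (simp_all add: std_normal_fourier)
  also have "\<dots> = complex_of_real (exp (- (\<Sum>b\<in>Basis. (\<xi> \<bullet> b)\<^sup>2) / 2))"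
    by (simp add: exp_sum[symmetric] sum_divide_distrib sum_negf flip: of_real_prod)
  also have "(\<Sum>b\<in>Basis. (\<xi> \<bullet> b)\<^sup>2) = (norm \<xi>)\<^sup>2"
    unfolding power2_norm_eq_inner euclidean_inner[of \<xi> \<xi>] by (simp add: power2_eq_square)
  finally show "(LINT x|lborel. complex_of_real (gaussian x) * cis (\<xi> \<bullet> x)) = complex_of_real (exp (- (norm \<xi>)\<^sup>2 / 2))" .
qed

lemma gaussian_integral:
  "integrable lborel (gaussian :: 'a::euclidean_space \<Rightarrow> real)" "(LINT x::'a|lborel. gaussian x) = 1"
proof -
  have "integrable lborel (\<lambda>x::'a. complex_of_real (gaussian x))" "(LINT x::'a|lborel. complex_of_real (gaussian x)) = 1"
    using gaussian_fourier[of "0::'a"] by simp_all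
  then show "integrable lborel (gaussian :: 'a \<Rightarrow> real)" "(LINT x::'a|lborel. gaussian x) = 1"
    by (simp_all add: complex_of_real_integrable_eq)
qed

definition fourier_integral :: "('a::euclidean_space \<Rightarrow> complex) \<Rightarrow> 'a \<Rightarrow> complex" where
  "fourier_integral f \<xi> = complex_of_real ((2 * pi) powr (- real DIM('a) / 2)) * (LINT x|lborel. cis (- (x \<bullet> \<xi>)) * f x)"

lemma fourier_integral_measurable[measurable (raw)]:
  assumes [measurable]: "f \<in> borel_measurable borel"
  shows "fourier_integral f \<in> borel_measurable borel"
  unfolding fourier_integral_def[abs_def] by measurable

text \<open>Gaussian regularisation: multiplying \<open>|F f|\<^sup>2\<close> by \<open>exp (- |\<xi>|\<^sup>2 / (2 r\<^sup>2))\<close> makes Fubini applicable and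
  turns the integral into a Gaussian average of the autocorrelation of \<open>f\<close> at scale \<open>1/r\<close>.\<close>

lemma fourier_integral_regularised:
  fixes f :: "'a::euclidean_space \<Rightarrow> complex"
  assumes f1: "integrable lborel f" and f2: "integrable lborel (\<lambda>x. (cmod (f x))\<^sup>2)" and r: "0 < r"
  shows "integrable lborel (\<lambda>\<xi>. (cmod (fourier_integral f \<xi>))\<^sup>2 * exp (- (norm ((1 / r) *\<^sub>R \<xi>))\<^sup>2 / 2))"
    and "complex_of_real (LINT \<xi>|lborel. (cmod (fourier_integral f \<xi>))\<^sup>2 * exp (- (norm ((1 / r) *\<^sub>R \<xi>))\<^sup>2 / 2))
      = (LINT z|lborel. complex_of_real (gaussian z) * (LINT x|lborel. cnj (f (x + (1 / r) *\<^sub>R z)) * f x))"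
proof -
  have f[measurable]: "f \<in> borel_measurable borel" using f1 by auto
  have f2': "integrable lborel (\<lambda>x. cmod (f x) powr (0 + 2))" using f2 by (simp add: powr_numeral)
  define N where "N = real DIM('a)"
  define c where "c = (2 * pi) powr (- N / 2)"
  have cpos: "0 < c" by (simp add: c_def)
  have cc: "exp (- (norm x)\<^sup>2 / 2) = gaussian x / c" for x :: 'a
    using cpos by (simp add: gaussian_def c_def N_def)
  define G where "G \<xi> = exp (- (norm ((1 / r) *\<^sub>R \<xi>))\<^sup>2 / 2)" for \<xi> :: 'a
  have Gm[measurable]: "G \<in> borel_measurable borel" unfolding G_def[abs_def] by measurable
  have Gg: "G \<xi> = gaussian ((1 / r) *\<^sub>R \<xi>) / c" for \<xi> unfolding G_def by (rule cc)
  have Gi: "integrable lborel G"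
    using lborel_affine_change(1)[OF gaussian_integral(1), of "1 / r" "0::'a"] r by (simp add: Gg[abs_def])
  \<comment> \<open>The Gaussian reproduces itself. One factor \<open>1 / c\<close> comes from
    \<open>Gg\<close>, one from writing the exponential as \<open>gaussian\<close> again; they match
    the two factors \<open>c\<close> contained in \<open>|F|\<^sup>2\<close>.\<close>
  have Gf: "(LINT \<xi>|lborel. complex_of_real (G \<xi>) * cis (- (w \<bullet> \<xi>))) = complex_of_real (r ^ DIM('a) * gaussian (r *\<^sub>R w) / c\<^sup>2)" for w
  proof -
    have "(LINT \<xi>|lborel. complex_of_real (G \<xi>) * cis (- (w \<bullet> \<xi>)))
      = (LINT \<xi>|lborel. (\<lambda>\<eta>. complex_of_real (gaussian \<eta>) * cis ((- (r *\<^sub>R w)) \<bullet> \<eta>) / complex_of_real c) (0 + (1 / r) *\<^sub>R \<xi>))"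
      using r by (intro Bochner_Integration.integral_cong refl) (simp add: Gg)
    also have "\<dots> = (r ^ DIM('a)) *\<^sub>R (LINT \<eta>|lborel. complex_of_real (gaussian \<eta>) * cis ((- (r *\<^sub>R w)) \<bullet> \<eta>) / complex_of_real c)"
      using r by (subst integral_lborel_affine) (simp_all add: power_one_over)
    also have "(LINT \<eta>|lborel. complex_of_real (gaussian \<eta>) * cis ((- (r *\<^sub>R w)) \<bullet> \<eta>) / complex_of_real c) = complex_of_real (exp (- (norm (r *\<^sub>R w))\<^sup>2 / 2)) / complex_of_real c"
      unfolding Bochner_Integration.integral_divide_zero gaussian_fourier(2) by (simp only: norm_minus_cancel)
    also have "\<dots> = complex_of_real (gaussian (r *\<^sub>R w) / c\<^sup>2)"
      unfolding cc by (simp add: power2_eq_square)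
    finally show ?thesis by (simp add: scaleR_conv_of_real)
  qed
  define F where "F = fourier_integral f"
  \<comment> \<open>The phase depends only on the difference of the two points. Integrating over the
    points first produces \<open>|F|\<^sup>2\<close>, integrating over the frequency first produces
    the kernel \<open>K\<close>.\<close>
  define H where "H \<xi> p = complex_of_real (G \<xi>) * cis (- ((fst p - snd p) \<bullet> \<xi>)) * (f (fst p) * cnj (f (snd p)))" for \<xi> and p :: "'a \<times> 'a"
  have ffi: "integrable lborel (\<lambda>p. f (fst p) * cnj (f (snd p)))"
    using lborel_product_integral(1)[OF f1 integrable_cnj[OF f1]] by (simp add: lborel_prod)
  have Hi: "integrable (lborel \<Otimes>\<^sub>M lborel) (case_prod H)"
  proof (rule Bochner_Integration.integrable_bound)
    show "integrable (lborel \<Otimes>\<^sub>M lborel) (\<lambda>q. complex_of_real (G (fst q)) * (\<lambda>p. f (fst p) * cnj (f (snd p))) (snd q))"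
      by (rule lborel_product_integral) (use Gi ffi in simp_all)
    show "AE q in lborel \<Otimes>\<^sub>M lborel. norm (case_prod H q) \<le> norm (complex_of_real (G (fst q)) * (\<lambda>p. f (fst p) * cnj (f (snd p))) (snd q))"
      by (intro AE_I2) (simp add: H_def case_prod_beta norm_mult)
    show "case_prod H \<in> borel_measurable (lborel \<Otimes>\<^sub>M lborel)"
      unfolding H_def case_prod_beta by measurable
  qed
  have H1: "(LINT p|lborel. H \<xi> p) = complex_of_real ((cmod (F \<xi>))\<^sup>2 * G \<xi> / c\<^sup>2)" for \<xi>
  proof -
    have i1: "integrable lborel (\<lambda>x. cis (- (x \<bullet> \<xi>)) * f x)"
      by (rule Bochner_Integration.integrable_bound[OF f1]) (auto simp: norm_mult)
    have "(LINT p|lborel. H \<xi> p) = (LINT p|lborel. complex_of_real (G \<xi>) * ((cis (- (fst p \<bullet> \<xi>)) * f (fst p)) * cnj (cis (- (snd p \<bullet> \<xi>)) * f (snd p))))"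
    proof (intro Bochner_Integration.integral_cong refl)
      fix p :: "'a \<times> 'a"
      have e: "cis (- ((fst p - snd p) \<bullet> \<xi>)) = cis (- (fst p \<bullet> \<xi>)) * cis (snd p \<bullet> \<xi>)"
        by (simp add: cis_mult inner_diff_left)
      show "H \<xi> p = complex_of_real (G \<xi>) * ((cis (- (fst p \<bullet> \<xi>)) * f (fst p)) * cnj (cis (- (snd p \<bullet> \<xi>)) * f (snd p)))"
        unfolding H_def e complex_cnj_mult cis_cnj minus_minus by (simp only: mult_ac)
    qed
    also have "\<dots> = complex_of_real (G \<xi>) * ((LINT x|lborel. cis (- (x \<bullet> \<xi>)) * f x) * cnj (LINT x|lborel. cis (- (x \<bullet> \<xi>)) * f x))"
      using lborel_product_integral(2)[OF i1 integrable_cnj[OF i1]]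
      by (simp only: lborel_prod Bochner_Integration.integral_mult_right_zero Bochner_Integration.integral_cnj)
    also have "(LINT x|lborel. cis (- (x \<bullet> \<xi>)) * f x) = F \<xi> / complex_of_real c"
      using cpos by (simp add: F_def fourier_integral_def c_def N_def)
    also have "complex_of_real (G \<xi>) * ((F \<xi> / complex_of_real c) * cnj (F \<xi> / complex_of_real c)) = complex_of_real ((cmod (F \<xi>))\<^sup>2 * G \<xi> / c\<^sup>2)"
      unfolding complex_norm_square[symmetric] by (simp add: norm_divide power_divide cpos)
    finally show ?thesis .
  qed
  have iF: "integrable lborel (\<lambda>\<xi>. (cmod (F \<xi>))\<^sup>2 * G \<xi>)"
    using integrable_mult_right[of "c\<^sup>2", OF lborel_pair.integrable_fst[OF Hi, unfolded H1 complex_of_real_integrable_eq]] cpos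
    by simp
  then show "integrable lborel (\<lambda>\<xi>. (cmod (fourier_integral f \<xi>))\<^sup>2 * exp (- (norm ((1 / r) *\<^sub>R \<xi>))\<^sup>2 / 2))"
    by (simp add: F_def G_def)
  define K where "K x y = complex_of_real (r ^ DIM('a) * gaussian (r *\<^sub>R (x - y))) * (f x * cnj (f y))" for x y
  have H2: "(LINT \<xi>|lborel. H \<xi> p) = K (fst p) (snd p) / complex_of_real (c\<^sup>2)" for p
    unfolding H_def Bochner_Integration.integral_mult_left_zero Gf by (simp add: K_def)
  have Ki: "integrable lborel (\<lambda>p. K (fst p) (snd p))"
    using integrable_mult_right[of "complex_of_real (c\<^sup>2)", OF lborel_pair.integrable_snd[OF Hi, unfolded H2]] cpos
    by simp
  have "complex_of_real (LINT \<xi>|lborel. (cmod (F \<xi>))\<^sup>2 * G \<xi>) = complex_of_real (c\<^sup>2) * (LINT \<xi>|lborel. LINT p|lborel. H \<xi> p)"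
    unfolding H1 integral_complex_of_real Bochner_Integration.integral_divide_zero using cpos by simp
  also have "(LINT \<xi>|lborel. LINT p|lborel. H \<xi> p) = (LINT p|lborel. LINT \<xi>|lborel. H \<xi> p)"
    by (rule lborel_pair.Fubini_integral[OF Hi, symmetric])
  also have "complex_of_real (c\<^sup>2) * (LINT p|lborel. LINT \<xi>|lborel. H \<xi> p) = (LINT p|lborel. K (fst p) (snd p))"
    unfolding H2 using cpos by simp
  also have "\<dots> = (LINT x|lborel. LINT y|lborel. K x y)"
    using lborel_pair.integral_fst'[of "\<lambda>p. K (fst p) (snd p)"] Ki by (simp add: lborel_prod)
  also have "\<dots> = (LINT x|lborel. LINT z|lborel. complex_of_real (gaussian z) * (cnj (f (x + (1 / r) *\<^sub>R z)) * f x))"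
  proof (rule Bochner_Integration.integral_cong[OF refl])
    fix x
    \<comment> \<open>The substitution \<open>y = x + (1 / r) *\<^sub>R z\<close> turns the narrow
      Gaussian of \<open>K\<close> into the fixed one and absorbs
      \<open>r ^ DIM('a)\<close>.\<close>
    have "(LINT z|lborel. complex_of_real (gaussian z) * (cnj (f (x + (1 / r) *\<^sub>R z)) * f x))
      = (LINT z|lborel. (1 / r) ^ DIM('a) *\<^sub>R K x (x + (1 / r) *\<^sub>R z))"
    proof (intro Bochner_Integration.integral_cong refl)
      fix z
      have "gaussian (r *\<^sub>R (x - (x + (1 / r) *\<^sub>R z))) = gaussian z" using r by (simp add: gaussian_def)
      then show "complex_of_real (gaussian z) * (cnj (f (x + (1 / r) *\<^sub>R z)) * f x) = (1 / r) ^ DIM('a) *\<^sub>R K x (x + (1 / r) *\<^sub>R z)"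
        using r by (simp add: K_def scaleR_conv_of_real power_one_over)
    qed
    also have "\<dots> = (1 / r) ^ DIM('a) *\<^sub>R (LINT z|lborel. K x (x + (1 / r) *\<^sub>R z))" by simp
    also have "\<dots> = (LINT y|lborel. K x y)"
      using r by (subst integral_lborel_affine) (simp_all add: power_one_over)
    finally show "(LINT y|lborel. K x y) = (LINT z|lborel. complex_of_real (gaussian z) * (cnj (f (x + (1 / r) *\<^sub>R z)) * f x))" by (rule sym)
  qed
  also have "\<dots> = (LINT z|lborel. LINT x|lborel. complex_of_real (gaussian z) * (cnj (f (x + (1 / r) *\<^sub>R z)) * f x))"
  proof (rule lborel_pair.Fubini_integral)
    show "integrable (lborel \<Otimes>\<^sub>M lborel) (\<lambda>(z, x). complex_of_real (gaussian z) * (cnj (f (x + (1 / r) *\<^sub>R z)) * f x))"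
    proof (rule integrableI_bounded)
      define I where "I = (\<integral>\<^sup>+x. ennreal (cmod (f x) powr (0 + 2)) \<partial>lborel)"
      have I: "I < \<infinity>" using f2' by (auto simp: I_def integrable_iff_bounded)
      have "(\<integral>\<^sup>+q. ennreal (norm (case q of (z, x) \<Rightarrow> complex_of_real (gaussian z) * (cnj (f (x + (1 / r) *\<^sub>R z)) * f x))) \<partial>(lborel \<Otimes>\<^sub>M lborel))
        = (\<integral>\<^sup>+z. \<integral>\<^sup>+x. ennreal (gaussian z) * ennreal (cmod (cnj (f (x + (1 / r) *\<^sub>R z)) * f (x + 0))) \<partial>lborel \<partial>lborel)"
        by (subst lborel.nn_integral_fst[symmetric]) (simp_all add: norm_mult gaussian_nonneg ennreal_mult)
      also have "\<dots> \<le> (\<integral>\<^sup>+z. ennreal (gaussian (z::'a)) * (2 * I) \<partial>lborel)"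
      proof (rule nn_integral_mono)
        fix z :: 'a
        have "(\<integral>\<^sup>+x. ennreal (gaussian z) * ennreal (cmod (cnj (f (x + (1 / r) *\<^sub>R z)) * f (x + 0))) \<partial>lborel)
          = ennreal (gaussian z) * (\<integral>\<^sup>+x. ennreal (cmod (cnj (f (x + (1 / r) *\<^sub>R z)) * f (x + 0))) \<partial>lborel)"
          by (rule nn_integral_cmult) simp
        also have "\<dots> \<le> ennreal (gaussian z) * (2 * I)"
          unfolding I_def by (intro mult_left_mono integral_translate_mult_bound(2)[OF f f order_refl f2']) simp_all
        finally show "(\<integral>\<^sup>+x. ennreal (gaussian z) * ennreal (cmod (cnj (f (x + (1 / r) *\<^sub>R z)) * f (x + 0))) \<partial>lborel) \<le> ennreal (gaussian z) * (2 * I)" .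
      qed
      also have "\<dots> = (\<integral>\<^sup>+z. ennreal (gaussian (z::'a)) \<partial>lborel) * (2 * I)"
        by (rule nn_integral_multc) simp
      also have "(\<integral>\<^sup>+z. ennreal (gaussian (z::'a)) \<partial>lborel) = 1"
        using nn_integral_eq_integral[OF gaussian_integral(1)] by (simp add: gaussian_nonneg gaussian_integral(2))
      finally show "(\<integral>\<^sup>+q. ennreal (norm (case q of (z, x) \<Rightarrow> complex_of_real (gaussian z) * (cnj (f (x + (1 / r) *\<^sub>R z)) * f x))) \<partial>(lborel \<Otimes>\<^sub>M lborel)) < \<infinity>"
        using I by (auto simp: ennreal_mult_less_top intro: le_less_trans)
    qed measurable
  qed
  finally show "complex_of_real (LINT \<xi>|lborel. (cmod (fourier_integral f \<xi>))\<^sup>2 * exp (- (norm ((1 / r) *\<^sub>R \<xi>))\<^sup>2 / 2))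
      = (LINT z|lborel. complex_of_real (gaussian z) * (LINT x|lborel. cnj (f (x + (1 / r) *\<^sub>R z)) * f x))"
    by (simp add: F_def G_def)
qed

lemma nonlinearity_zero: "nonlinearity 0 f = f"
  by (rule ext) (simp add: nonlinearity_def)

text \<open>Both sides are limits of the regularised identity as the Gaussian cut-off widens: the
  frequency side increases to the full integral by monotone convergence, whether or not that
  integral is finite, and the averaged autocorrelations tend to the squared norm by dominated
  convergence.\<close>

lemma plancherel_fourier_integral:
  fixes f :: "'a::euclidean_space \<Rightarrow> complex"
  assumes f1: "integrable lborel f" and f2: "integrable lborel (\<lambda>x. (cmod (f x))\<^sup>2)"
  shows "(\<integral>\<^sup>+\<xi>. ennreal ((cmod (fourier_integral f \<xi>))\<^sup>2) \<partial>lborel) = ennreal (LINT x|lborel. (cmod (f x))\<^sup>2)"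
proof -
  have f[measurable]: "f \<in> borel_measurable borel" using f1 by auto
  have f2': "integrable lborel (\<lambda>x. cmod (f x) powr (0 + 2))" using f2 by (simp add: powr_numeral)
  define I where "I = (LINT x|lborel. (cmod (f x))\<^sup>2)"
  have I0: "0 \<le> I" unfolding I_def by (intro integral_nonneg_AE AE_I2) simp
  define c where "c z = (LINT x|lborel. cnj (f (x + z)) * f x)" for z
  have cm[measurable]: "c \<in> borel_measurable borel" unfolding c_def[abs_def] by measurable
  have cb: "cmod (c z) \<le> 2 * I" for z
  proof -
    have "ennreal (cmod (c z)) \<le> (\<integral>\<^sup>+x. ennreal (cmod (cnj (f (x + z)) * f x)) \<partial>lborel)"
      unfolding c_def using integral_translate_mult_bound(1)[OF f f order_refl f2', of z 0]
      by (intro integral_norm_bound_ennreal) (simp add: powr_one)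
    also have "\<dots> \<le> 2 * (\<integral>\<^sup>+x. ennreal (cmod (f x) powr (0 + 2)) \<partial>lborel)"
      using integral_translate_mult_bound(2)[OF f f order_refl f2', of z 0] by simp
    also have "(\<integral>\<^sup>+x. ennreal (cmod (f x) powr (0 + 2)) \<partial>lborel) = ennreal I"
      unfolding I_def using nn_integral_eq_integral[OF f2] by (simp add: powr_numeral)
    also have "2 * ennreal I = ennreal (2 * I)" using I0 by (simp add: ennreal_mult)
    finally show ?thesis using I0 by simp
  qed
  define E where "E n \<xi> = exp (- (norm ((1 / real (Suc n)) *\<^sub>R \<xi>))\<^sup>2 / 2)" for n and \<xi> :: 'a
  have inv: "(\<lambda>n. 1 / real (Suc n)) \<longlonglongrightarrow> 0"
    using LIMSEQ_inverse_real_of_nat by (simp add: inverse_eq_divide)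
  have zlim: "(\<lambda>n. (1 / real (Suc n)) *\<^sub>R z) \<longlonglongrightarrow> 0" for z :: 'a
    using tendsto_scaleR[OF inv tendsto_const[of z]] by simp
  have "(\<lambda>n. LINT z|lborel. complex_of_real (gaussian z) * c ((1 / real (Suc n)) *\<^sub>R z))
     \<longlonglongrightarrow> (LINT z::'a|lborel. complex_of_real (gaussian z) * complex_of_real I)"
  proof (rule integral_dominated_convergence)
    show "integrable lborel (\<lambda>z::'a. gaussian z * (2 * I))" using gaussian_integral(1)[where ?'a='a] by simp
    show "AE z in lborel. norm (complex_of_real (gaussian z) * c ((1 / real (Suc n)) *\<^sub>R z)) \<le> gaussian z * (2 * I)" for n
      using cb by (intro AE_I2) (simp add: norm_mult gaussian_nonneg mult_left_mono)
    show "AE z in lborel. (\<lambda>n. complex_of_real (gaussian z) * c ((1 / real (Suc n)) *\<^sub>R z)) \<longlonglongrightarrow> complex_of_real (gaussian z) * complex_of_real I"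
    proof (rule AE_I2, rule tendsto_mult_left)
      fix z :: 'a
      show "(\<lambda>n. c ((1 / real (Suc n)) *\<^sub>R z)) \<longlonglongrightarrow> complex_of_real I"
        using correlation_tendsto[OF f order_refl f2' zlim[of z]] unfolding c_def I_def nonlinearity_zero
        by (simp add: powr_numeral)
    qed
  qed simp_all
  then have "(\<lambda>n. complex_of_real (LINT \<xi>|lborel. (cmod (fourier_integral f \<xi>))\<^sup>2 * E n \<xi>)) \<longlonglongrightarrow> complex_of_real I"
    unfolding E_def c_def by (subst fourier_integral_regularised(2)[OF f1 f2]) (simp_all add: gaussian_integral)
  then have "(\<lambda>n. LINT \<xi>|lborel. (cmod (fourier_integral f \<xi>))\<^sup>2 * E n \<xi>) \<longlonglongrightarrow> I"
    by (simp only: tendsto_of_real_iff)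
  then have l1: "(\<lambda>n. ennreal (LINT \<xi>|lborel. (cmod (fourier_integral f \<xi>))\<^sup>2 * E n \<xi>)) \<longlonglongrightarrow> ennreal I"
    by (intro tendsto_ennrealI)
  have eqn: "ennreal (LINT \<xi>|lborel. (cmod (fourier_integral f \<xi>))\<^sup>2 * E n \<xi>) = (\<integral>\<^sup>+\<xi>. ennreal ((cmod (fourier_integral f \<xi>))\<^sup>2 * E n \<xi>) \<partial>lborel)" for n
    unfolding E_def by (rule nn_integral_eq_integral[symmetric], rule fourier_integral_regularised(1)[OF f1 f2]) simp_all
  have "(\<lambda>n. \<integral>\<^sup>+\<xi>. ennreal ((cmod (fourier_integral f \<xi>))\<^sup>2 * E n \<xi>) \<partial>lborel) \<longlonglongrightarrow> (\<integral>\<^sup>+\<xi>. ennreal ((cmod (fourier_integral f \<xi>))\<^sup>2) \<partial>lborel)"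
  proof (rule nn_integral_LIMSEQ)
    show "incseq (\<lambda>n \<xi>. ennreal ((cmod (fourier_integral f \<xi>))\<^sup>2 * E n \<xi>))"
    proof (intro incseq_SucI le_funI ennreal_leI mult_left_mono)
      fix n and \<xi> :: 'a
      have "1 / real (Suc (Suc n)) \<le> 1 / real (Suc n)" by (simp add: field_simps)
      then have "norm ((1 / real (Suc (Suc n))) *\<^sub>R \<xi>) \<le> norm ((1 / real (Suc n)) *\<^sub>R \<xi>)"
        unfolding norm_scaleR by (intro mult_right_mono) auto
      then have "(norm ((1 / real (Suc (Suc n))) *\<^sub>R \<xi>))\<^sup>2 \<le> (norm ((1 / real (Suc n)) *\<^sub>R \<xi>))\<^sup>2"
        by (intro power_mono) auto
      then show "E n \<xi> \<le> E (Suc n) \<xi>" unfolding E_def by simp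
    qed simp
    show "(\<lambda>\<xi>. ennreal ((cmod (fourier_integral f \<xi>))\<^sup>2 * E n \<xi>)) \<in> borel_measurable lborel" for n
      unfolding E_def by measurable
    fix \<xi> :: 'a
    have "(\<lambda>n. (cmod (fourier_integral f \<xi>))\<^sup>2 * E n \<xi>) \<longlonglongrightarrow> (cmod (fourier_integral f \<xi>))\<^sup>2 * exp (- (norm (0::'a))\<^sup>2 / 2)"
      unfolding E_def by (intro tendsto_intros zlim) simp
    then show "(\<lambda>n. ennreal ((cmod (fourier_integral f \<xi>))\<^sup>2 * E n \<xi>)) \<longlonglongrightarrow> ennreal ((cmod (fourier_integral f \<xi>))\<^sup>2)"
      by (intro tendsto_ennrealI) simp
  qed
  with l1 show ?thesis unfolding eqn I_def by (rule LIMSEQ_unique[symmetric])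
qed

section \<open>The space of square integrable functions\<close>

text \<open>Real valued, so that estimates combine by linear arithmetic. If the square is not
  integrable the Bochner integral makes it 0, hence the membership hypotheses in the
  estimates.\<close>

definition l2norm :: "('a::euclidean_space \<Rightarrow> complex) \<Rightarrow> real" where
  "l2norm f = sqrt (LINT x|lborel. (cmod (f x))\<^sup>2)"

lemma l2norm_nonneg [simp]: "0 \<le> l2norm f"
  by (simp add: l2norm_def integral_nonneg_AE)

lemma l2norm_sq: "(l2norm f)\<^sup>2 = (LINT x|lborel. (cmod (f x))\<^sup>2)"
  by (simp add: l2norm_def integral_nonneg_AE)

lemma nn_integral_sq_finite:
  "f \<in> borel_measurable lborel \<Longrightarrow>
    (\<integral>\<^sup>+x. ennreal ((cmod (f x))\<^sup>2) \<partial>lborel) < \<infinity> \<longleftrightarrow> integrable lborel (\<lambda>x. (cmod (f x))\<^sup>2)"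
  by (simp add: integrable_iff_bounded)

lemma nn_integral_sq:
  "integrable lborel (\<lambda>x. (cmod (f x))\<^sup>2) \<Longrightarrow>
    (\<integral>\<^sup>+x. ennreal ((cmod (f x))\<^sup>2) \<partial>lborel) = ennreal ((l2norm f)\<^sup>2)"
  unfolding l2norm_sq by (rule nn_integral_eq_integral) auto

lemma Lp_norm_2_measurable:
  assumes "f \<in> borel_measurable lborel"
  shows "Lp_norm 2 f = (if integrable lborel (\<lambda>x. (cmod (f x))\<^sup>2) then ennreal (l2norm f) else \<infinity>)"
proof -
  have eq: "Lp_norm 2 f = ennreal_powr (\<integral>\<^sup>+x. ennreal ((cmod (f x))\<^sup>2) \<partial>lborel) (1 / 2)"
    using assms by (simp add: Lp_norm_def powr_numeral)
  show ?thesis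
  proof (cases "integrable lborel (\<lambda>x. (cmod (f x))\<^sup>2)")
    case True
    show ?thesis unfolding eq nn_integral_sq[OF True] by (simp add: ennreal_powr_def powr_half_sqrt True)
  next
    case False
    then have "(\<integral>\<^sup>+x. ennreal ((cmod (f x))\<^sup>2) \<partial>lborel) = \<infinity>"
      using nn_integral_sq_finite[OF assms] by (simp add: less_top[symmetric])
    then show ?thesis unfolding eq by (simp add: ennreal_powr_def False)
  qed
qed

lemma L2_iff: "f \<in> L2 \<longleftrightarrow> f \<in> borel_measurable lborel \<and> integrable lborel (\<lambda>x. (cmod (f x))\<^sup>2)"
  by (auto simp: L2_def Lp_norm_2_measurable split: if_splits)

lemma L2_measurable: "f \<in> L2 \<Longrightarrow> f \<in> borel_measurable borel"
  by (simp add: L2_iff)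

lemma L2_integrable: "f \<in> L2 \<Longrightarrow> integrable lborel (\<lambda>x. (cmod (f x))\<^sup>2)"
  by (simp add: L2_iff)

lemma Lp_norm_2_L2: "f \<in> L2 \<Longrightarrow> Lp_norm 2 f = ennreal (l2norm f)"
  by (simp add: L2_iff Lp_norm_2_measurable)

lemma L2_dominated:
  assumes "f \<in> borel_measurable borel" "g \<in> L2" "\<And>x. cmod (f x) \<le> cmod (g x)"
  shows "f \<in> L2" "l2norm f \<le> l2norm g"
proof -
  have [measurable]: "f \<in> borel_measurable borel" by fact
  have sq: "(cmod (f x))\<^sup>2 \<le> (cmod (g x))\<^sup>2" for x using assms(3) by (intro power_mono) auto
  have i: "integrable lborel (\<lambda>x. (cmod (f x))\<^sup>2)"
    by (rule Bochner_Integration.integrable_bound[OF L2_integrable[OF assms(2)]]) (use sq in auto)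
  then show "f \<in> L2" by (simp add: L2_iff)
  show "l2norm f \<le> l2norm g" unfolding l2norm_def
    by (intro real_sqrt_le_mono integral_mono i L2_integrable assms sq)
qed

lemma L2_add:
  assumes "f \<in> L2" "g \<in> L2"
  shows "(\<lambda>x. f x + g x) \<in> L2"
proof -
  have [measurable]: "f \<in> borel_measurable borel" "g \<in> borel_measurable borel"
    using assms by (auto dest: L2_measurable)
  have "integrable lborel (\<lambda>x. (cmod (f x + g x))\<^sup>2)"
  proof (rule Bochner_Integration.integrable_bound)
    show "integrable lborel (\<lambda>x. 2 * (cmod (f x))\<^sup>2 + 2 * (cmod (g x))\<^sup>2)"
      using assms by (simp add: L2_integrable)
    show "AE x in lborel. norm ((cmod (f x + g x))\<^sup>2) \<le> norm (2 * (cmod (f x))\<^sup>2 + 2 * (cmod (g x))\<^sup>2)"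
    proof (rule AE_I2)
      fix x
      have "(cmod (f x + g x))\<^sup>2 \<le> (cmod (f x) + cmod (g x))\<^sup>2"
        by (intro power_mono norm_triangle_ineq) auto
      also have "\<dots> \<le> 2 * (cmod (f x))\<^sup>2 + 2 * (cmod (g x))\<^sup>2"
        using zero_le_power2[of "cmod (f x) - cmod (g x)"] by (simp add: power2_eq_square algebra_simps)
      finally show "norm ((cmod (f x + g x))\<^sup>2) \<le> norm (2 * (cmod (f x))\<^sup>2 + 2 * (cmod (g x))\<^sup>2)" by simp
    qed
  qed simp
  then show ?thesis by (simp add: L2_iff)
qed

lemma L2_cmult: assumes "f \<in> L2" shows "(\<lambda>x. c * f x) \<in> L2" "l2norm (\<lambda>x. c * f x) = cmod c * l2norm f"
proof -
  have [measurable]: "f \<in> borel_measurable borel" using assms by (rule L2_measurable)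
  show "(\<lambda>x. c * f x) \<in> L2" using L2_integrable[OF assms] by (simp add: L2_iff norm_mult power_mult_distrib)
  show "l2norm (\<lambda>x. c * f x) = cmod c * l2norm f"
    by (simp add: l2norm_def norm_mult power_mult_distrib real_sqrt_mult)
qed

lemma L2_diff:
  assumes "f \<in> L2" "g \<in> L2" shows "(\<lambda>x. f x - g x) \<in> L2"
  using L2_add[OF assms(1) L2_cmult(1)[OF assms(2), of "-1"]] by simp

lemma L2_zero: "(\<lambda>x. 0) \<in> L2" by (simp add: L2_iff)

lemma L2_unimodular:
  assumes "f \<in> L2" "m \<in> borel_measurable borel" "\<And>x. cmod (m x) = 1"
  shows "(\<lambda>x. m x * f x) \<in> L2" "l2norm (\<lambda>x. m x * f x) = l2norm f"
proof -
  have [measurable]: "f \<in> borel_measurable borel" "m \<in> borel_measurable borel" using assms by (auto dest: L2_measurable)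
  show "(\<lambda>x. m x * f x) \<in> L2" using assms by (simp add: L2_iff norm_mult)
  show "l2norm (\<lambda>x. m x * f x) = l2norm f" using assms by (simp add: l2norm_def norm_mult)
qed

lemma L2_shift:
  assumes "f \<in> L2" shows "(\<lambda>x. f (x + a)) \<in> L2" "l2norm (\<lambda>x. f (x + a)) = l2norm f"
proof -
  have [measurable]: "f \<in> borel_measurable borel" using assms by (rule L2_measurable)
  show "(\<lambda>x. f (x + a)) \<in> L2" using integrable_shift[OF L2_integrable[OF assms], of a] by (simp add: L2_iff)
  show "l2norm (\<lambda>x. f (x + a)) = l2norm f"
    unfolding l2norm_def using integral_shift[of "\<lambda>x. (cmod (f x))\<^sup>2" a] by simp
qed

lemma L2_reflect:
  assumes "f \<in> L2" shows "(\<lambda>x. f (- x)) \<in> L2" "l2norm (\<lambda>x. f (- x)) = l2norm f"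
proof -
  have [measurable]: "f \<in> borel_measurable borel" using assms by (rule L2_measurable)
  show "(\<lambda>x. f (- x)) \<in> L2"
    using lborel_affine_change(1)[OF L2_integrable[OF assms], of "-1" 0] by (simp add: L2_iff)
  show "l2norm (\<lambda>x. f (- x)) = l2norm f"
    unfolding l2norm_def using integral_reflect[of "\<lambda>x. (cmod (f x))\<^sup>2"] by simp
qed

lemma L2_Cauchy_Schwarz:
  assumes "f \<in> L2" "g \<in> L2"
  shows "integrable lborel (\<lambda>x. cmod (f x) * cmod (g x))"
    and "(LINT x|lborel. cmod (f x) * cmod (g x)) \<le> l2norm f * l2norm g"
proof -
  have [measurable]: "f \<in> borel_measurable borel" "g \<in> borel_measurable borel"
    using assms by (auto dest: L2_measurable)
  show i: "integrable lborel (\<lambda>x. cmod (f x) * cmod (g x))"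
  proof (rule Bochner_Integration.integrable_bound)
    show "integrable lborel (\<lambda>x. (cmod (f x))\<^sup>2 + (cmod (g x))\<^sup>2)"
      using assms by (simp add: L2_integrable)
    show "AE x in lborel. norm (cmod (f x) * cmod (g x)) \<le> norm ((cmod (f x))\<^sup>2 + (cmod (g x))\<^sup>2)"
    proof (rule AE_I2)
      fix x
      have "2 * (cmod (f x) * cmod (g x)) \<le> (cmod (f x))\<^sup>2 + (cmod (g x))\<^sup>2"
        using zero_le_power2[of "cmod (f x) - cmod (g x)"] by (simp add: power2_eq_square algebra_simps)
      moreover have "0 \<le> cmod (f x) * cmod (g x)" by simp
      ultimately have "cmod (f x) * cmod (g x) \<le> (cmod (f x))\<^sup>2 + (cmod (g x))\<^sup>2" by linarith
      then show "norm (cmod (f x) * cmod (g x)) \<le> norm ((cmod (f x))\<^sup>2 + (cmod (g x))\<^sup>2)" by simp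
    qed
  qed simp
  let ?I = "LINT x|lborel. cmod (f x) * cmod (g x)"
  have I0: "0 \<le> ?I" by (intro integral_nonneg_AE AE_I2) simp
  have "ennreal (?I\<^sup>2) = (\<integral>\<^sup>+x. ennreal (cmod (f x)) * ennreal (cmod (g x)) \<partial>lborel)\<^sup>2"
    using nn_integral_eq_integral[OF i] I0 by (simp add: ennreal_mult ennreal_power)
  also have "\<dots> \<le> (\<integral>\<^sup>+x. (ennreal (cmod (f x)))\<^sup>2 \<partial>lborel) * (\<integral>\<^sup>+x. (ennreal (cmod (g x)))\<^sup>2 \<partial>lborel)"
    by (rule Cauchy_Schwarz_nn_integral) auto
  also have "\<dots> = ennreal ((l2norm f)\<^sup>2 * (l2norm g)\<^sup>2)"
    using assms by (simp add: ennreal_power nn_integral_sq L2_integrable ennreal_mult)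
  finally have "?I\<^sup>2 \<le> (l2norm f * l2norm g)\<^sup>2" by (simp add: power_mult_distrib)
  then show "?I \<le> l2norm f * l2norm g" by (rule power2_le_imp_le) simp
qed

lemma l2norm_add_sq:
  assumes "f \<in> L2" "g \<in> L2"
  shows "(l2norm (\<lambda>x. f x + g x))\<^sup>2 = (l2norm f)\<^sup>2 + (l2norm g)\<^sup>2 + 2 * (LINT x|lborel. Re (f x * cnj (g x)))"
    and "integrable lborel (\<lambda>x. f x * cnj (g x))"
proof -
  have [measurable]: "f \<in> borel_measurable borel" "g \<in> borel_measurable borel"
    using assms by (auto dest: L2_measurable)
  show i: "integrable lborel (\<lambda>x. f x * cnj (g x))"
    by (rule Bochner_Integration.integrable_bound[OF L2_Cauchy_Schwarz(1)[OF assms]]) (auto simp: norm_mult)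
  define h where "h x = Re (f x * cnj (g x))" for x
  have hi: "integrable lborel h" unfolding h_def[abs_def] by (rule integrable_Re[OF i])
  have eq: "(cmod (f x + g x))\<^sup>2 = (cmod (f x))\<^sup>2 + (cmod (g x))\<^sup>2 + 2 * h x" for x
    unfolding cmod_power2 h_def by (simp add: power2_eq_square algebra_simps)
  show "(l2norm (\<lambda>x. f x + g x))\<^sup>2 = (l2norm f)\<^sup>2 + (l2norm g)\<^sup>2 + 2 * (LINT x|lborel. Re (f x * cnj (g x)))"
    unfolding l2norm_sq eq h_def[symmetric] using hi assms by (simp add: L2_integrable)
qed

lemma l2norm_triangle:
  assumes "f \<in> L2" "g \<in> L2"
  shows "l2norm (\<lambda>x. f x + g x) \<le> l2norm f + l2norm g"
proof (rule power2_le_imp_le)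
  have "(LINT x|lborel. Re (f x * cnj (g x))) \<le> (LINT x|lborel. cmod (f x) * cmod (g x))"
  proof (rule integral_mono)
    show "Re (f x * cnj (g x)) \<le> cmod (f x) * cmod (g x)" for x
      using complex_Re_le_cmod[of "f x * cnj (g x)"] unfolding norm_mult complex_mod_cnj .
  qed (rule integrable_Re[OF l2norm_add_sq(2)[OF assms]], rule L2_Cauchy_Schwarz(1)[OF assms])
  also have "\<dots> \<le> l2norm f * l2norm g" by (rule L2_Cauchy_Schwarz(2)[OF assms])
  finally show "(l2norm (\<lambda>x. f x + g x))\<^sup>2 \<le> (l2norm f + l2norm g)\<^sup>2"
    unfolding l2norm_add_sq(1)[OF assms] by (simp add: power2_eq_square algebra_simps)
qed simp

lemma l2norm_minus_commute: "l2norm (\<lambda>x. f x - g x) = l2norm (\<lambda>x. g x - f x)"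
  by (simp add: l2norm_def norm_minus_commute)

lemma l2norm_diff_triangle:
  assumes "f \<in> L2" "g \<in> L2" "h \<in> L2"
  shows "l2norm (\<lambda>x. f x - h x) \<le> l2norm (\<lambda>x. f x - g x) + l2norm (\<lambda>x. g x - h x)"
  using l2norm_triangle[OF L2_diff[OF assms(1,2)] L2_diff[OF assms(2,3)]] by simp

lemma l2norm_diff_le:
  assumes "f \<in> L2" "g \<in> L2"
  shows "\<bar>l2norm f - l2norm g\<bar> \<le> l2norm (\<lambda>x. f x - g x)"
  using l2norm_diff_triangle[OF assms L2_zero] l2norm_diff_triangle[OF assms(2,1) L2_zero]
  by (simp add: l2norm_minus_commute[of f g])

lemma l2norm_cong_AE:
  assumes "f \<in> borel_measurable borel" "g \<in> borel_measurable borel" "AE x in lborel. f x = g x"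
  shows "l2norm f = l2norm g"
proof -
  have [measurable]: "f \<in> borel_measurable borel" "g \<in> borel_measurable borel" by fact+
  show ?thesis unfolding l2norm_def
    by (intro arg_cong[where f=sqrt] integral_cong_AE) (use assms(3) in auto)
qed

lemma l2norm_eq_0_AE:
  assumes "f \<in> L2" shows "l2norm f = 0 \<longleftrightarrow> (AE x in lborel. f x = 0)"
  unfolding l2norm_def using L2_integrable[OF assms]
  by (simp add: integral_nonneg_eq_0_iff_AE)

lemma Lp_norm_2_tendsto_0_iff:
  assumes "\<And>n. f n \<in> L2"
  shows "((\<lambda>n. Lp_norm 2 (f n)) \<longlongrightarrow> 0) F \<longleftrightarrow> ((\<lambda>n. l2norm (f n)) \<longlongrightarrow> 0) F"
  using tendsto_ennreal_iff[of "\<lambda>n. l2norm (f n)" F 0] by (simp add: Lp_norm_2_L2 assms)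

text \<open>Riesz and Fischer along a fast subsequence. The increments \<open>d k\<close> have
  squared norm at most \<open>(1 / 4) ^ k\<close>; weighting by \<open>2 ^ k\<close> keeps the sum
  finite and forces, almost everywhere, a geometric bound on \<open>cmod (d k x)\<close>.\<close>

lemma L2_complete:
  fixes f :: "nat \<Rightarrow> 'a::euclidean_space \<Rightarrow> complex"
  assumes f: "\<And>n. f n \<in> L2"
    and C: "\<And>e. 0 < e \<Longrightarrow> \<exists>N. \<forall>m\<ge>N. \<forall>n\<ge>N. l2norm (\<lambda>x. f m x - f n x) < e"
  shows "\<exists>g\<in>L2. (\<lambda>n. l2norm (\<lambda>x. f n x - g x)) \<longlonglongrightarrow> 0"
proof -
  have fm[measurable]: "f n \<in> borel_measurable borel" for n using f by (rule L2_measurable)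
  have "\<exists>r. \<forall>k. (\<forall>m\<ge>r k. \<forall>n\<ge>r k. l2norm (\<lambda>x. f m x - f n x) < (1 / 2) ^ k) \<and> r k < r (Suc k)"
  proof (rule dependent_nat_choice)
    show "\<exists>N. \<forall>m\<ge>N. \<forall>n\<ge>N. l2norm (\<lambda>x. f m x - f n x) < (1 / 2) ^ 0" using C[of 1] by simp
    fix N :: nat and k
    obtain N' where "\<forall>m\<ge>N'. \<forall>n\<ge>N'. l2norm (\<lambda>x. f m x - f n x) < (1 / 2) ^ Suc k"
      using C[of "(1 / 2) ^ Suc k"] by auto
    then show "\<exists>y. (\<forall>m\<ge>y. \<forall>n\<ge>y. l2norm (\<lambda>x. f m x - f n x) < (1 / 2) ^ Suc k) \<and> N < y"
      by (intro exI[of _ "max N' (Suc N)"]) auto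
  qed
  then obtain r where r: "\<And>k m n. m \<ge> r k \<Longrightarrow> n \<ge> r k \<Longrightarrow> l2norm (\<lambda>x. f m x - f n x) < (1 / 2) ^ k"
    and rS: "\<And>k. r k < r (Suc k)" by blast
  have mono: "strict_mono r" using rS by (rule strict_monoI_Suc)
  define d where "d k x = f (r (Suc k)) x - f (r k) x" for k x
  have dL: "d k \<in> L2" for k unfolding d_def[abs_def] by (intro L2_diff f)
  have dm[measurable]: "d k \<in> borel_measurable borel" for k using dL by (rule L2_measurable)
  have dn: "l2norm (d k) \<le> (1 / 2) ^ k" for k
    unfolding d_def[abs_def] using r[of k "r (Suc k)" "r k"] rS[of k] by (simp add: less_imp_le)
  have "(\<integral>\<^sup>+x. (\<Sum>k. ennreal (2 ^ k * (cmod (d k x))\<^sup>2)) \<partial>lborel) = (\<Sum>k. \<integral>\<^sup>+x. ennreal (2 ^ k * (cmod (d k x))\<^sup>2) \<partial>lborel)"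
    by (rule nn_integral_suminf) simp
  also have "\<dots> \<le> (\<Sum>k. ennreal ((1 / 2) ^ k))"
  proof (rule suminf_le)
    fix k
    have "(\<integral>\<^sup>+x. ennreal (2 ^ k * (cmod (d k x))\<^sup>2) \<partial>lborel) = ennreal (2 ^ k) * ennreal ((l2norm (d k))\<^sup>2)"
      by (subst nn_integral_sq[symmetric, OF L2_integrable[OF dL]], subst nn_integral_cmult[symmetric])
        (simp_all add: ennreal_mult)
    also have "\<dots> = ennreal (2 ^ k * (l2norm (d k))\<^sup>2)" by (simp add: ennreal_mult)
    also have "\<dots> \<le> ennreal ((1 / 2) ^ k)"
    proof (rule ennreal_leI)
      have "(l2norm (d k))\<^sup>2 \<le> ((1 / 2) ^ k)\<^sup>2" using dn by (intro power_mono) auto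
      then have "2 ^ k * (l2norm (d k))\<^sup>2 \<le> 2 ^ k * ((1 / 2) ^ k)\<^sup>2" by (intro mult_left_mono) auto
      also have "\<dots> = (1 / 2) ^ k" by (simp add: power2_eq_square power_one_over)
      finally show "2 ^ k * (l2norm (d k))\<^sup>2 \<le> (1 / 2) ^ k" .
    qed
    finally show "(\<integral>\<^sup>+x. ennreal (2 ^ k * (cmod (d k x))\<^sup>2) \<partial>lborel) \<le> ennreal ((1 / 2) ^ k)" .
  qed auto
  also have "\<dots> = ennreal (\<Sum>k. (1 / 2) ^ k)"
    by (rule suminf_ennreal2) (auto intro: summable_geometric)
  also have "\<dots> < \<infinity>" by simp
  finally have fin: "(\<integral>\<^sup>+x. (\<Sum>k. ennreal (2 ^ k * (cmod (d k x))\<^sup>2)) \<partial>lborel) \<noteq> \<infinity>" by simp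
  have ae: "AE x in lborel. (\<Sum>k. ennreal (2 ^ k * (cmod (d k x))\<^sup>2)) \<noteq> \<infinity>"
    by (rule nn_integral_PInf_AE) (use fin in auto)
  have conv: "convergent (\<lambda>k. f (r k) x)" if x: "(\<Sum>k. ennreal (2 ^ k * (cmod (d k x))\<^sup>2)) \<noteq> \<infinity>" for x
  proof -
    obtain B where B: "(\<Sum>k. ennreal (2 ^ k * (cmod (d k x))\<^sup>2)) = ennreal B" "0 \<le> B"
    proof -
      define S where "S = (\<Sum>k. ennreal (2 ^ k * (cmod (d k x))\<^sup>2))"
      have "S \<noteq> \<infinity>" using x by (simp only: S_def not_False_eq_True)
      then obtain B where "S = ennreal B" "0 \<le> B" by (cases S) auto
      then show ?thesis using that by (simp only: S_def)
    qed
    have bd: "cmod (d k x) \<le> sqrt B * (1 / sqrt 2) ^ k" for k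
    proof -
      have "ennreal (2 ^ k * (cmod (d k x))\<^sup>2) \<le> ennreal B"
        using sum_le_suminf[of "\<lambda>k. ennreal (2 ^ k * (cmod (d k x))\<^sup>2)" "{k}"] B by simp
      then have "2 ^ k * (cmod (d k x))\<^sup>2 \<le> B" using B by simp
      then have "(cmod (d k x))\<^sup>2 \<le> B * (1 / 2) ^ k" by (simp add: field_simps power_one_over)
      also have "\<dots> = (sqrt B * (1 / sqrt 2) ^ k)\<^sup>2"
      proof -
        have "((1 / sqrt 2) ^ k)\<^sup>2 = ((1 / sqrt 2)\<^sup>2) ^ k" by (simp only: power_mult[symmetric] mult.commute)
        then show ?thesis using B(2) by (simp add: power_mult_distrib power_divide)
      qed
      finally show ?thesis by (rule power2_le_imp_le) (use B in simp)
    qed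
    have "summable (\<lambda>k. sqrt B * (1 / sqrt 2) ^ k)"
      by (intro summable_mult summable_geometric) (simp add: real_less_lsqrt)
    then have "summable (\<lambda>k. d k x)" by (rule summable_comparison_test'[of _ 0]) (use bd in simp)
    then have "summable (\<lambda>k. f (r (Suc k)) x - f (r k) x)" by (simp add: d_def)
    then have "convergent (\<lambda>n. \<Sum>k<n. f (r (Suc k)) x - f (r k) x)" by (simp add: summable_iff_convergent)
    then have "convergent (\<lambda>n. (f (r n) x - f (r 0) x) + f (r 0) x)"
      unfolding sum_lessThan_telescope[of "\<lambda>k. f (r k) x"] by (intro convergent_add convergent_const)
    then show ?thesis by simp
  qed
  define g where "g x = lim (\<lambda>k. f (r k) x)" for x
  have gm[measurable]: "g \<in> borel_measurable borel"
    unfolding g_def[abs_def] by (rule borel_measurable_lim_metric) simp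
  have lim: "AE x in lborel. (\<lambda>k. f (r k) x) \<longlonglongrightarrow> g x"
    using ae
  proof eventually_elim
    case (elim x)
    show ?case using conv[OF elim] unfolding g_def convergent_LIMSEQ_iff .
  qed
  \<comment> \<open>Fatou's lemma along the subsequence carries the Cauchy estimate over to the
    limit; finiteness of the integral also puts the difference into \<open>L2\<close>.\<close>
  have key: "(\<integral>\<^sup>+x. ennreal ((cmod (f n x - g x))\<^sup>2) \<partial>lborel) \<le> ennreal (e\<^sup>2)"
    if e: "0 < e" and N: "\<forall>m\<ge>N. \<forall>n\<ge>N. l2norm (\<lambda>x. f m x - f n x) < e" and n: "n \<ge> N" for e N n
  proof -
    have "(\<integral>\<^sup>+x. ennreal ((cmod (f n x - g x))\<^sup>2) \<partial>lborel) = (\<integral>\<^sup>+x. liminf (\<lambda>k. ennreal ((cmod (f n x - f (r k) x))\<^sup>2)) \<partial>lborel)"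
    proof (rule nn_integral_cong_AE)
      show "AE x in lborel. ennreal ((cmod (f n x - g x))\<^sup>2) = liminf (\<lambda>k. ennreal ((cmod (f n x - f (r k) x))\<^sup>2))"
        using lim
      proof eventually_elim
        case (elim x)
        then have "(\<lambda>k. ennreal ((cmod (f n x - f (r k) x))\<^sup>2)) \<longlonglongrightarrow> ennreal ((cmod (f n x - g x))\<^sup>2)"
          by (intro tendsto_ennrealI tendsto_intros)
        then show ?case by (rule lim_imp_Liminf[OF sequentially_bot, symmetric])
      qed
    qed
    also have "\<dots> \<le> liminf (\<lambda>k. \<integral>\<^sup>+x. ennreal ((cmod (f n x - f (r k) x))\<^sup>2) \<partial>lborel)"
      by (rule nn_integral_liminf) simp
    also have "\<dots> \<le> ennreal (e\<^sup>2)"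
    proof (rule Liminf_le)
      show "\<forall>\<^sub>F k in sequentially. (\<integral>\<^sup>+x. ennreal ((cmod (f n x - f (r k) x))\<^sup>2) \<partial>lborel) \<le> ennreal (e\<^sup>2)"
        unfolding eventually_sequentially
      proof (intro exI[of _ N] allI impI)
        fix k assume "k \<ge> N"
        then have "r k \<ge> N" using seq_suble[OF mono, of k] by linarith
        then have "l2norm (\<lambda>x. f n x - f (r k) x) \<le> e" using N n by (simp add: less_imp_le)
        then show "(\<integral>\<^sup>+x. ennreal ((cmod (f n x - f (r k) x))\<^sup>2) \<partial>lborel) \<le> ennreal (e\<^sup>2)"
          by (subst nn_integral_sq) (auto intro!: L2_integrable L2_diff f ennreal_leI power_mono)
      qed
    qed simp
    finally show ?thesis .
  qed
  have fg: "(\<lambda>x. f n x - g x) \<in> L2 \<and> l2norm (\<lambda>x. f n x - g x) \<le> e"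
    if e: "0 < e" and N: "\<forall>m\<ge>N. \<forall>n\<ge>N. l2norm (\<lambda>x. f m x - f n x) < e" and n: "n \<ge> N" for e N n
  proof
    have "(\<integral>\<^sup>+x. ennreal ((cmod (f n x - g x))\<^sup>2) \<partial>lborel) < \<infinity>"
      using key[OF that] by (rule le_less_trans) simp
    then show L: "(\<lambda>x. f n x - g x) \<in> L2" by (subst (asm) nn_integral_sq_finite) (simp_all add: L2_iff)
    show "l2norm (\<lambda>x. f n x - g x) \<le> e"
      using key[OF that] unfolding nn_integral_sq[OF L2_integrable[OF L]] ennreal_le_iff[OF zero_le_power2]
      by (rule power2_le_imp_le) (use e in simp)
  qed
  obtain N1 where N1: "\<forall>m\<ge>N1. \<forall>n\<ge>N1. l2norm (\<lambda>x. f m x - f n x) < 1" using C[of 1] by auto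
  \<comment> \<open>A member of the sequence minus its difference from \<open>g\<close> is
    \<open>g\<close> again.\<close>
  have "(\<lambda>x. f N1 x - (f N1 x - g x)) \<in> L2" by (rule L2_diff[OF f conjunct1[OF fg[OF zero_less_one N1 order_refl]]])
  then have gL: "g \<in> L2" by simp
  have "(\<lambda>n. l2norm (\<lambda>x. f n x - g x)) \<longlonglongrightarrow> 0"
  proof (rule LIMSEQ_I)
    fix e :: real assume e: "0 < e"
    obtain N where N: "\<forall>m\<ge>N. \<forall>n\<ge>N. l2norm (\<lambda>x. f m x - f n x) < e / 2" using C[of "e / 2"] e by auto
    have "l2norm (\<lambda>x. f n x - g x) < e" if "n \<ge> N" for n
    proof -
      have "l2norm (\<lambda>x. f n x - g x) \<le> e / 2" using conjunct2[OF fg[OF half_gt_zero[OF e] N that]] .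
      then show ?thesis using e by linarith
    qed
    then show "\<exists>no. \<forall>n\<ge>no. norm (l2norm (\<lambda>x. f n x - g x) - 0) < e" by (intro exI[of _ N]) simp
  qed
  with gL show ?thesis by (intro bexI)
qed

section \<open>The Fourier transform of square integrable functions\<close>

text \<open>Turns the truncation inside \<open>truncated_fourier\<close> into a function that is
  both integrable and square integrable, to which Plancherel applies.\<close>

definition ball_cut :: "real \<Rightarrow> ('a::euclidean_space \<Rightarrow> complex) \<Rightarrow> 'a \<Rightarrow> complex" where
  "ball_cut R f x = indicator (cball 0 R) x * f x"

lemma ball_cut_L2:
  assumes "f \<in> L2" shows "ball_cut R f \<in> L2" "integrable lborel (ball_cut R f)"
proof -
  have [measurable]: "f \<in> borel_measurable borel" using assms by (rule L2_measurable)
  have [measurable]: "ball_cut R f \<in> borel_measurable borel" 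
    unfolding ball_cut_def[abs_def] by (intro borel_measurable_times borel_measurable_indicator) simp_all
  show "ball_cut R f \<in> L2"
    by (rule L2_dominated(1)[OF _ assms]) (auto simp: ball_cut_def indicator_def)
  \<comment> \<open>Cauchy-Schwarz against the indicator of the ball yields integrability of the
    truncation.\<close>
  have I: "(\<lambda>x::'a. indicator (cball 0 R) x :: complex) \<in> L2"
  proof -
    have "(cmod (indicator (cball 0 R) x))\<^sup>2 = indicat_real (cball 0 R) x" for x :: 'a
      by (simp add: indicator_def)
    then show ?thesis using emeasure_lborel_cball_finite[of "0::'a" R] by (simp add: L2_iff borel_measurable_indicator)
  qed
  show "integrable lborel (ball_cut R f)"
    by (rule Bochner_Integration.integrable_bound[OF L2_Cauchy_Schwarz(1)[OF I assms]]) (auto simp: ball_cut_def norm_mult)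
qed

lemma truncated_fourier_eq: "truncated_fourier R f = fourier_integral (ball_cut R f)"
  by (rule ext)
    (auto simp: truncated_fourier_def fourier_integral_def set_lebesgue_integral_def ball_cut_def scaleR_conv_of_real indicator_def
      intro!: arg_cong[where f="\<lambda>z. complex_of_real _ * z"] Bochner_Integration.integral_cong)

lemma fourier_integral_L2:
  assumes "integrable lborel f" "f \<in> L2"
  shows "fourier_integral f \<in> L2" "l2norm (fourier_integral f) = l2norm f"
proof -
  have m[measurable]: "fourier_integral f \<in> borel_measurable borel"
    by (rule fourier_integral_measurable) (use assms in auto)
  note P = plancherel_fourier_integral[OF assms(1) L2_integrable[OF assms(2)]]
  have "(\<integral>\<^sup>+\<xi>. ennreal ((cmod (fourier_integral f \<xi>))\<^sup>2) \<partial>lborel) < \<infinity>" unfolding P by simp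
  then show L: "fourier_integral f \<in> L2" using m by (subst (asm) nn_integral_sq_finite) (simp_all add: L2_iff)
  have "(l2norm (fourier_integral f))\<^sup>2 = (l2norm f)\<^sup>2"
    using P unfolding nn_integral_sq[OF L2_integrable[OF L]] l2norm_sq[of f, symmetric] by simp
  then show "l2norm (fourier_integral f) = l2norm f" by (rule power2_eq_imp_eq) simp_all
qed

lemma fourier_integral_diff:
  assumes "integrable lborel f" "integrable lborel g"
  shows "fourier_integral (\<lambda>x. f x - g x) \<xi> = fourier_integral f \<xi> - fourier_integral g \<xi>"
proof -
  have i: "integrable lborel (\<lambda>x. cis (- (x \<bullet> \<xi>)) * h x)" if "integrable lborel h" for h :: "'a \<Rightarrow> complex"
    by (rule Bochner_Integration.integrable_bound[OF that]) (use that in \<open>auto simp: norm_mult\<close>)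
  show ?thesis
    using i[OF assms(1)] i[OF assms(2)] by (simp add: fourier_integral_def right_diff_distrib)
qed

lemma fourier_integral_modulate:
  "fourier_integral (\<lambda>x. cis (x \<bullet> a) * f x) \<xi> = fourier_integral f (\<xi> - a)"
  unfolding fourier_integral_def mult.assoc[symmetric] cis_mult by (simp add: inner_diff_right)

lemma l2norm_fourier_integral_diff:
  assumes "integrable lborel f" "f \<in> L2" "integrable lborel g" "g \<in> L2"
  shows "l2norm (\<lambda>\<xi>. fourier_integral f \<xi> - fourier_integral g \<xi>) = l2norm (\<lambda>x. f x - g x)"
proof -
  have "fourier_integral (\<lambda>x. f x - g x) = (\<lambda>\<xi>. fourier_integral f \<xi> - fourier_integral g \<xi>)"
    by (rule ext) (rule fourier_integral_diff[OF assms(1,3)])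
  then show ?thesis
    using fourier_integral_L2(2)[of "\<lambda>x. f x - g x"] assms by (simp add: L2_diff)
qed

text \<open>Dominated convergence works along integer radii; the other radii follow because the
  error decreases in \<open>R\<close>.\<close>

lemma ball_cut_tendsto:
  assumes f: "f \<in> L2"
  shows "((\<lambda>R. l2norm (\<lambda>x. ball_cut R f x - f x)) \<longlongrightarrow> 0) at_top"
proof -
  have [measurable]: "f \<in> borel_measurable borel" using f by (rule L2_measurable)
  have "(\<lambda>n. LINT x|lborel. (cmod (ball_cut (real n) f x - f x))\<^sup>2) \<longlonglongrightarrow> (LINT x::'a|lborel. 0)"
  proof (rule integral_dominated_convergence[where w="\<lambda>x. (cmod (f x))\<^sup>2"])
    show "AE x in lborel. (\<lambda>n. (cmod (ball_cut (real n) f x - f x))\<^sup>2) \<longlonglongrightarrow> 0"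
    proof (rule AE_I2, rule tendsto_eventually)
      fix x :: 'a
      obtain N :: nat where "norm x \<le> real N" using real_arch_simple by blast
      then have "(cmod (ball_cut (real n) f x - f x))\<^sup>2 = 0" if "n \<ge> N" for n
        using that by (simp add: ball_cut_def indicator_def)
      then show "\<forall>\<^sub>F n in sequentially. (cmod (ball_cut (real n) f x - f x))\<^sup>2 = 0"
        unfolding eventually_sequentially by blast
    qed
    show "AE x in lborel. norm ((cmod (ball_cut (real n) f x - f x))\<^sup>2) \<le> (cmod (f x))\<^sup>2" for n
      by (rule AE_I2) (simp add: ball_cut_def indicator_def)
    show "(\<lambda>x. (cmod (ball_cut (real n) f x - f x))\<^sup>2) \<in> borel_measurable lborel" for n
    proof -
      have [measurable]: "(\<lambda>x. ball_cut (real n) f x - f x) \<in> borel_measurable borel"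
        by (intro L2_measurable L2_diff ball_cut_L2 f)
      show ?thesis by measurable
    qed
  qed (use L2_integrable[OF f] in simp_all)
  then have "(\<lambda>n. sqrt (LINT x|lborel. (cmod (ball_cut (real n) f x - f x))\<^sup>2)) \<longlonglongrightarrow> sqrt 0"
    by (intro tendsto_real_sqrt) simp
  then have lim: "(\<lambda>n. l2norm (\<lambda>x. ball_cut (real n) f x - f x)) \<longlonglongrightarrow> 0" by (simp add: l2norm_def)
  show ?thesis
  proof (rule tendstoI)
    fix e :: real assume e: "0 < e"
    then obtain n where n: "l2norm (\<lambda>x. ball_cut (real n) f x - f x) < e"
      using LIMSEQ_D[OF lim e] by auto
    have "l2norm (\<lambda>x. ball_cut R f x - f x) < e" if R: "R \<ge> real n" for R
    proof -
      have "l2norm (\<lambda>x. ball_cut R f x - f x) \<le> l2norm (\<lambda>x. ball_cut (real n) f x - f x)"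
        using R by (intro L2_dominated(2) L2_diff ball_cut_L2 f L2_measurable) (auto simp: ball_cut_def indicator_def)
      then show ?thesis using n by linarith
    qed
    then show "\<forall>\<^sub>F R in at_top. dist (l2norm (\<lambda>x. ball_cut R f x - f x)) 0 < e"
      unfolding eventually_at_top_linorder by (intro exI[of _ "real n"]) simp
  qed
qed

text \<open>Justifies the choice in \<open>fourier_L2\<close>. Plancherel makes the transforms of
  the truncations Cauchy, completeness gives a limit along the integers, and comparison with a large
  integer radius extends it to all real radii.\<close>

lemma fourier_L2_spec:
  assumes f: "f \<in> L2"
  shows "fourier_L2 f \<in> L2"
    and "((\<lambda>R. l2norm (\<lambda>\<xi>. fourier_integral (ball_cut R f) \<xi> - fourier_L2 f \<xi>)) \<longlongrightarrow> 0) at_top"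
proof -
  define T where "T R = fourier_integral (ball_cut R f)" for R
  have TL: "T R \<in> L2" for R unfolding T_def by (intro fourier_integral_L2 ball_cut_L2 f)
  have TT: "l2norm (\<lambda>\<xi>. T R \<xi> - T S \<xi>) \<le> l2norm (\<lambda>x. ball_cut R f x - f x) + l2norm (\<lambda>x. ball_cut S f x - f x)" for R S
    unfolding T_def using l2norm_diff_triangle[OF ball_cut_L2(1)[OF f, of R] f ball_cut_L2(1)[OF f, of S]]
    by (simp add: l2norm_fourier_integral_diff ball_cut_L2 f l2norm_minus_commute[of f])
  have "\<exists>g\<in>L2. (\<lambda>n. l2norm (\<lambda>\<xi>. T (real n) \<xi> - g \<xi>)) \<longlonglongrightarrow> 0"
  proof (rule L2_complete)
    fix e :: real assume "0 < e"
    then obtain B where B: "\<And>R. R \<ge> B \<Longrightarrow> l2norm (\<lambda>x. ball_cut R f x - f x) < e / 2"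
      using order_tendstoD(2)[OF ball_cut_tendsto[OF f], of "e / 2"] unfolding eventually_at_top_linorder by auto
    obtain N :: nat where "B \<le> real N" using real_arch_simple by blast
    have "\<forall>m\<ge>N. \<forall>n\<ge>N. l2norm (\<lambda>x. T (real m) x - T (real n) x) < e"
    proof (intro allI impI)
      fix m n assume "N \<le> m" "N \<le> n"
      then have "B \<le> real m" "B \<le> real n" using \<open>B \<le> real N\<close> by linarith+
      from B[OF this(1)] B[OF this(2)] TT[of "real m" "real n"]
      show "l2norm (\<lambda>x. T (real m) x - T (real n) x) < e" by linarith
    qed
    then show "\<exists>N. \<forall>m\<ge>N. \<forall>n\<ge>N. l2norm (\<lambda>x. T (real m) x - T (real n) x) < e" ..
  qed (rule TL)
  then obtain g where g: "g \<in> L2" and lim: "(\<lambda>n. l2norm (\<lambda>\<xi>. T (real n) \<xi> - g \<xi>)) \<longlonglongrightarrow> 0" by blast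
  have "((\<lambda>R. l2norm (\<lambda>\<xi>. T R \<xi> - g \<xi>)) \<longlongrightarrow> 0) at_top"
  proof (rule tendstoI)
    fix e :: real assume e: "0 < e"
    then obtain B where B: "\<And>R. R \<ge> B \<Longrightarrow> l2norm (\<lambda>x. ball_cut R f x - f x) < e / 3"
      using order_tendstoD(2)[OF ball_cut_tendsto[OF f], of "e / 3"] unfolding eventually_at_top_linorder by auto
    obtain N where N: "\<And>n. n \<ge> N \<Longrightarrow> l2norm (\<lambda>\<xi>. T (real n) \<xi> - g \<xi>) < e / 3"
      using order_tendstoD(2)[OF lim, of "e / 3"] e unfolding eventually_sequentially by auto
    obtain M :: nat where "B \<le> real M" using real_arch_simple by blast
    \<comment> \<open>An integer radius large enough for the truncation error and for the
      convergence along integers; together with the error at \<open>R\<close> this makes three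
      thirds of \<open>e\<close>.\<close>
    define n where "n = max M N"
    have n: "B \<le> real n" "N \<le> n" using \<open>B \<le> real M\<close> by (auto simp: n_def)
    have "l2norm (\<lambda>\<xi>. T R \<xi> - g \<xi>) < e" if "R \<ge> B" for R
      using l2norm_diff_triangle[OF TL[of R] TL[of "real n"] g] TT[of R "real n"] B[OF that] B[OF n(1)] N[OF n(2)]
      by linarith
    then show "\<forall>\<^sub>F R in at_top. dist (l2norm (\<lambda>\<xi>. T R \<xi> - g \<xi>)) 0 < e"
      unfolding eventually_at_top_linorder by (intro exI[of _ B]) simp
  qed
  then have "g \<in> L2 \<and> ((\<lambda>R. Lp_norm 2 (\<lambda>\<xi>. truncated_fourier R f \<xi> - g \<xi>)) \<longlongrightarrow> 0) at_top"
    unfolding truncated_fourier_eq T_def using g by (subst Lp_norm_2_tendsto_0_iff) (auto intro!: L2_diff fourier_integral_L2 ball_cut_L2 f)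
  then have S: "fourier_L2 f \<in> L2 \<and> ((\<lambda>R. Lp_norm 2 (\<lambda>\<xi>. truncated_fourier R f \<xi> - fourier_L2 f \<xi>)) \<longlongrightarrow> 0) at_top"
    unfolding fourier_L2_def
    by (rule someI[where P="\<lambda>g. g \<in> L2 \<and> ((\<lambda>R. Lp_norm 2 (\<lambda>\<xi>. truncated_fourier R f \<xi> - g \<xi>)) \<longlongrightarrow> 0) at_top"])
  then show "fourier_L2 f \<in> L2" ..
  with S show "((\<lambda>R. l2norm (\<lambda>\<xi>. fourier_integral (ball_cut R f) \<xi> - fourier_L2 f \<xi>)) \<longlongrightarrow> 0) at_top"
    unfolding truncated_fourier_eq by (subst (asm) Lp_norm_2_tendsto_0_iff) (auto intro!: L2_diff fourier_integral_L2 ball_cut_L2 f)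
qed

text \<open>The defining limit fixes the transform only up to null sets, so identities for it hold
  almost everywhere and are obtained by identifying the limit of the truncated transforms.\<close>

lemma fourier_L2_unique:
  assumes f: "f \<in> L2" and g: "g \<in> L2"
    and lim: "((\<lambda>R. l2norm (\<lambda>\<xi>. fourier_integral (ball_cut R f) \<xi> - g \<xi>)) \<longlongrightarrow> 0) at_top"
  shows "AE \<xi> in lborel. fourier_L2 f \<xi> = g \<xi>"
proof -
  note S = fourier_L2_spec[OF f]
  have "l2norm (\<lambda>\<xi>. fourier_L2 f \<xi> - g \<xi>) \<le> 0"
  proof (rule tendsto_lowerbound)
    show "((\<lambda>R. l2norm (\<lambda>\<xi>. fourier_integral (ball_cut R f) \<xi> - fourier_L2 f \<xi>) + l2norm (\<lambda>\<xi>. fourier_integral (ball_cut R f) \<xi> - g \<xi>)) \<longlongrightarrow> 0) at_top"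
      using tendsto_add[OF S(2) lim] by simp
    show "\<forall>\<^sub>F R in at_top. l2norm (\<lambda>\<xi>. fourier_L2 f \<xi> - g \<xi>) \<le> l2norm (\<lambda>\<xi>. fourier_integral (ball_cut R f) \<xi> - fourier_L2 f \<xi>) + l2norm (\<lambda>\<xi>. fourier_integral (ball_cut R f) \<xi> - g \<xi>)"
    proof (rule always_eventually, rule allI)
      fix R
      have "fourier_integral (ball_cut R f) \<in> L2" by (intro fourier_integral_L2 ball_cut_L2 f)
      from l2norm_diff_triangle[OF S(1) this g]
      show "l2norm (\<lambda>\<xi>. fourier_L2 f \<xi> - g \<xi>) \<le> l2norm (\<lambda>\<xi>. fourier_integral (ball_cut R f) \<xi> - fourier_L2 f \<xi>) + l2norm (\<lambda>\<xi>. fourier_integral (ball_cut R f) \<xi> - g \<xi>)"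
        by (simp add: l2norm_minus_commute[of "fourier_L2 f"])
    qed
  qed simp
  then have "l2norm (\<lambda>\<xi>. fourier_L2 f \<xi> - g \<xi>) = 0" using l2norm_nonneg by (rule antisym)
  then show ?thesis using l2norm_eq_0_AE[OF L2_diff[OF S(1) g]] by simp
qed

lemma l2norm_fourier_L2:
  assumes f: "f \<in> L2" shows "l2norm (fourier_L2 f) = l2norm f"
proof -
  note S = fourier_L2_spec[OF f]
  have TL: "fourier_integral (ball_cut R f) \<in> L2" "l2norm (fourier_integral (ball_cut R f)) = l2norm (ball_cut R f)" for R
    by (intro fourier_integral_L2 ball_cut_L2 f)+
  have "\<bar>l2norm (fourier_L2 f) - l2norm f\<bar> \<le> 0"
  proof (rule tendsto_lowerbound)
    show "((\<lambda>R. l2norm (\<lambda>\<xi>. fourier_integral (ball_cut R f) \<xi> - fourier_L2 f \<xi>) + l2norm (\<lambda>x. ball_cut R f x - f x)) \<longlongrightarrow> 0) at_top"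
      using tendsto_add[OF S(2) ball_cut_tendsto[OF f]] by simp
    show "\<forall>\<^sub>F R in at_top. \<bar>l2norm (fourier_L2 f) - l2norm f\<bar> \<le> l2norm (\<lambda>\<xi>. fourier_integral (ball_cut R f) \<xi> - fourier_L2 f \<xi>) + l2norm (\<lambda>x. ball_cut R f x - f x)"
    proof (rule always_eventually, rule allI)
      fix R
      show "\<bar>l2norm (fourier_L2 f) - l2norm f\<bar> \<le> l2norm (\<lambda>\<xi>. fourier_integral (ball_cut R f) \<xi> - fourier_L2 f \<xi>) + l2norm (\<lambda>x. ball_cut R f x - f x)"
        using l2norm_diff_le[OF TL(1)[of R] S(1)] l2norm_diff_le[OF ball_cut_L2(1)[OF f, of R] f] TL(2)[of R] by linarith
    qed
  qed simp
  then show ?thesis by simp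
qed

lemma fourier_L2_diff:
  assumes f: "f \<in> L2" and g: "g \<in> L2"
  shows "AE \<xi> in lborel. fourier_L2 (\<lambda>x. f x - g x) \<xi> = fourier_L2 f \<xi> - fourier_L2 g \<xi>"
proof (rule fourier_L2_unique)
  show "(\<lambda>x. f x - g x) \<in> L2" "(\<lambda>\<xi>. fourier_L2 f \<xi> - fourier_L2 g \<xi>) \<in> L2"
    by (intro L2_diff fourier_L2_spec f g)+
  note Sf = fourier_L2_spec[OF f] and Sg = fourier_L2_spec[OF g]
  let ?T = "\<lambda>f R. fourier_integral (ball_cut R f)"
  have TL: "?T f R \<in> L2" "?T g R \<in> L2" for R
    by (intro fourier_integral_L2 ball_cut_L2 f g)+
  have eq: "?T (\<lambda>x. f x - g x) R \<xi> = ?T f R \<xi> - ?T g R \<xi>" for R \<xi>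
  proof -
    have "ball_cut R (\<lambda>x. f x - g x) = (\<lambda>x. ball_cut R f x - ball_cut R g x)"
      by (rule ext) (simp add: ball_cut_def right_diff_distrib)
    then show ?thesis by (simp only: fourier_integral_diff[OF ball_cut_L2(2)[OF f] ball_cut_L2(2)[OF g]])
  qed
  show "((\<lambda>R. l2norm (\<lambda>\<xi>. ?T (\<lambda>x. f x - g x) R \<xi> - (fourier_L2 f \<xi> - fourier_L2 g \<xi>))) \<longlongrightarrow> 0) at_top"
  proof (rule tendsto_sandwich[of "\<lambda>_. 0" _ _ "\<lambda>R. l2norm (\<lambda>\<xi>. ?T f R \<xi> - fourier_L2 f \<xi>) + l2norm (\<lambda>\<xi>. ?T g R \<xi> - fourier_L2 g \<xi>)"])
    show "((\<lambda>R. l2norm (\<lambda>\<xi>. ?T f R \<xi> - fourier_L2 f \<xi>) + l2norm (\<lambda>\<xi>. ?T g R \<xi> - fourier_L2 g \<xi>)) \<longlongrightarrow> 0) at_top"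
      using tendsto_add[OF Sf(2) Sg(2)] by simp
    show "\<forall>\<^sub>F R in at_top. l2norm (\<lambda>\<xi>. ?T (\<lambda>x. f x - g x) R \<xi> - (fourier_L2 f \<xi> - fourier_L2 g \<xi>)) \<le> l2norm (\<lambda>\<xi>. ?T f R \<xi> - fourier_L2 f \<xi>) + l2norm (\<lambda>\<xi>. ?T g R \<xi> - fourier_L2 g \<xi>)"
    proof (rule always_eventually, rule allI)
      fix R
      have "(\<lambda>\<xi>. ?T (\<lambda>x. f x - g x) R \<xi> - (fourier_L2 f \<xi> - fourier_L2 g \<xi>)) = (\<lambda>\<xi>. (?T f R \<xi> - fourier_L2 f \<xi>) - (?T g R \<xi> - fourier_L2 g \<xi>))"
        unfolding eq by (rule ext) simp
      then show "l2norm (\<lambda>\<xi>. ?T (\<lambda>x. f x - g x) R \<xi> - (fourier_L2 f \<xi> - fourier_L2 g \<xi>)) \<le> l2norm (\<lambda>\<xi>. ?T f R \<xi> - fourier_L2 f \<xi>) + l2norm (\<lambda>\<xi>. ?T g R \<xi> - fourier_L2 g \<xi>)"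
        using l2norm_diff_triangle[OF L2_diff[OF TL(1)[of R] Sf(1)] L2_zero L2_diff[OF TL(2)[of R] Sg(1)]]
        by (simp add: l2norm_minus_commute[of "fourier_L2 g"])
    qed
  qed simp_all
qed

lemma l2norm_fourier_L2_diff:
  assumes f: "f \<in> L2" and g: "g \<in> L2"
  shows "l2norm (\<lambda>\<xi>. fourier_L2 f \<xi> - fourier_L2 g \<xi>) = l2norm (\<lambda>x. f x - g x)"
proof -
  have "l2norm (\<lambda>\<xi>. fourier_L2 f \<xi> - fourier_L2 g \<xi>) = l2norm (fourier_L2 (\<lambda>x. f x - g x))"
    using fourier_L2_diff[OF f g]
    by (intro l2norm_cong_AE L2_measurable L2_diff fourier_L2_spec f g) (auto elim: eventually_mono)
  then show ?thesis by (simp add: l2norm_fourier_L2 L2_diff f g)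
qed

text \<open>Modulation commutes with truncation to balls, so the exact shift rule for integrable
  functions passes to the limit, norms being invariant under the shift.\<close>

lemma fourier_L2_modulate:
  assumes f: "f \<in> L2"
  shows "AE \<xi> in lborel. fourier_L2 (\<lambda>x. cis (x \<bullet> a) * f x) \<xi> = fourier_L2 f (\<xi> - a)"
proof (rule fourier_L2_unique)
  show "(\<lambda>x. cis (x \<bullet> a) * f x) \<in> L2" by (rule L2_unimodular(1)[OF f]) simp_all
  show "(\<lambda>\<xi>. fourier_L2 f (\<xi> - a)) \<in> L2" using L2_shift(1)[OF fourier_L2_spec(1)[OF f], of "- a"] by simp
  have eq: "ball_cut R (\<lambda>x. cis (x \<bullet> a) * f x) = (\<lambda>x. cis (x \<bullet> a) * ball_cut R f x)" for R
    by (rule ext) (simp add: ball_cut_def)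
  have "l2norm (\<lambda>\<xi>. fourier_integral (ball_cut R f) (\<xi> - a) - fourier_L2 f (\<xi> - a)) = l2norm (\<lambda>\<xi>. fourier_integral (ball_cut R f) \<xi> - fourier_L2 f \<xi>)" for R
    using L2_shift(2)[OF L2_diff[OF fourier_integral_L2(1)[OF ball_cut_L2(2)[OF f] ball_cut_L2(1)[OF f]] fourier_L2_spec(1)[OF f]], of R "- a"] by simp
  then show "((\<lambda>R. l2norm (\<lambda>\<xi>. fourier_integral (ball_cut R (\<lambda>x. cis (x \<bullet> a) * f x)) \<xi> - fourier_L2 f (\<xi> - a))) \<longlongrightarrow> 0) at_top"
    unfolding eq fourier_integral_modulate using fourier_L2_spec(2)[OF f] by simp
qed

lemma fourier_L2_integrable:
  assumes f: "f \<in> L2" "integrable lborel f"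
  shows "AE \<xi> in lborel. fourier_L2 f \<xi> = fourier_integral f \<xi>"
  by (rule fourier_L2_unique)
    (use ball_cut_tendsto[OF f(1)] f in \<open>simp_all add: l2norm_fourier_integral_diff ball_cut_L2 fourier_integral_L2\<close>)

text \<open>Polarisation: the isometry applied to \<open>f\<close>, \<open>g\<close> and their
  difference determines the real part of the inner product.\<close>

lemma parseval:
  assumes f: "f \<in> L2" and g: "g \<in> L2"
  shows "(LINT x|lborel. Re (f x * cnj (g x))) = (LINT \<xi>|lborel. Re (fourier_L2 f \<xi> * cnj (fourier_L2 g \<xi>)))"
proof -
  have neg: "l2norm (\<lambda>x. f x - g x) = l2norm (\<lambda>x. f x + (- 1) * g x)" for f g :: "'a \<Rightarrow> complex" by simp
  have *: "(l2norm (\<lambda>x. f x - g x))\<^sup>2 = (l2norm f)\<^sup>2 + (l2norm g)\<^sup>2 - 2 * (LINT x|lborel. Re (f x * cnj (g x)))"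
    if "f \<in> L2" "g \<in> L2" for f g :: "'a \<Rightarrow> complex"
  proof -
    have "(LINT x|lborel. Re (f x * cnj (- 1 * g x))) = - (LINT x|lborel. Re (f x * cnj (g x)))"
      unfolding Bochner_Integration.integral_minus[symmetric]
      by (intro Bochner_Integration.integral_cong refl) simp
    then show ?thesis
      unfolding neg l2norm_add_sq(1)[OF that(1) L2_cmult(1)[OF that(2)]] L2_cmult(2)[OF that(2)] by simp
  qed
  show ?thesis
    using *[OF f g] *[OF fourier_L2_spec(1)[OF f] fourier_L2_spec(1)[OF g]]
    by (simp add: l2norm_fourier_L2_diff l2norm_fourier_L2 f g)
qed

text \<open>The inverse transform is by definition the reflected forward transform, so both
  transforms are isometries by Plancherel, with a unimodular multiplier in between.\<close>

lemma schroedinger_group_L2: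
  assumes f: "f \<in> L2"
  shows "schroedinger_group t f \<in> L2" "l2norm (schroedinger_group t f) = l2norm f"
proof -
  have m: "(\<lambda>\<xi>::'a. cis (- t * (norm \<xi>)\<^sup>2)) \<in> borel_measurable borel" by measurable
  note M = L2_unimodular[OF fourier_L2_spec(1)[OF f] m norm_cis]
  show "schroedinger_group t f \<in> L2" "l2norm (schroedinger_group t f) = l2norm f"
    unfolding schroedinger_group_def inverse_fourier_L2_def
    by (rule L2_reflect(1)[OF fourier_L2_spec(1)[OF M(1)]])
      (simp only: L2_reflect(2)[OF fourier_L2_spec(1)[OF M(1)]] l2norm_fourier_L2[OF M(1)] M(2) l2norm_fourier_L2[OF f])
qed

text \<open>Two different times are allowed: this brings the distance between profiles at different
  times to the frequency side.\<close>

lemma schroedinger_group_diff: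
  assumes f: "f \<in> L2" and g: "g \<in> L2"
  shows "l2norm (\<lambda>x. schroedinger_group s f x - schroedinger_group t g x)
    = l2norm (\<lambda>\<xi>. cis (- s * (norm \<xi>)\<^sup>2) * fourier_L2 f \<xi> - cis (- t * (norm \<xi>)\<^sup>2) * fourier_L2 g \<xi>)"
proof -
  have m: "(\<lambda>\<xi>::'a. cis (- t * (norm \<xi>)\<^sup>2)) \<in> borel_measurable borel" for t by measurable
  note M = L2_unimodular(1)[OF fourier_L2_spec(1)[OF f] m norm_cis, of s] L2_unimodular(1)[OF fourier_L2_spec(1)[OF g] m norm_cis, of t]
  show ?thesis
    unfolding schroedinger_group_def inverse_fourier_L2_def
    unfolding L2_reflect(2)[OF L2_diff[OF fourier_L2_spec(1)[OF M(1)] fourier_L2_spec(1)[OF M(2)]]]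
    by (rule l2norm_fourier_L2_diff[OF M])
qed

section \<open>A smooth bump function\<close>

lemma Ck_SucD:
  assumes "Ck (Suc k) f"
  shows "(f has_derivative frechet_derivative f (at x)) (at x)" "Ck k (\<lambda>x. frechet_derivative f (at x) v)"
  using assms by (auto simp: frechet_derivative_works)

lemma Ck_SucI:
  assumes "\<And>x. (f has_derivative D x) (at x)" "\<And>v. Ck k (\<lambda>x. D x v)"
  shows "Ck (Suc k) f"
  using assms frechet_derivative_at[OF assms(1)] by (auto simp: differentiable_def)

lemma Ck_Suc_imp: "Ck (Suc k) f \<Longrightarrow> Ck k f"
proof (induction k arbitrary: f)
  case 0
  then show ?case using differentiable_imp_continuous_within by (auto simp: continuous_on_eq_continuous_at)
next
  case (Suc k)
  then show ?case by (metis Ck.simps(2))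
qed

lemma Ck_const: "Ck k (\<lambda>x. c)"
proof (induction k arbitrary: c)
  case (Suc k)
  show ?case by (rule Ck_SucI[where D="\<lambda>x v. 0"]) (use Suc in auto)
qed simp

lemma Ck_bounded_linear:
  assumes "bounded_linear L" "Ck k f"
  shows "Ck k (\<lambda>x. L (f x))"
  using assms(2)
proof (induction k arbitrary: f)
  case 0
  then show ?case using bounded_linear.continuous_on[OF assms(1)] by auto
next
  case (Suc k)
  show ?case
  proof (rule Ck_SucI)
    show "((\<lambda>x. L (f x)) has_derivative (\<lambda>v. L (frechet_derivative f (at x) v))) (at x)" for x
      by (rule bounded_linear.has_derivative[OF assms(1) Ck_SucD(1)[OF Suc.prems]])
    show "Ck k (\<lambda>x. L (frechet_derivative f (at x) v))" for v
      by (rule Suc.IH[OF Ck_SucD(2)[OF Suc.prems]])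
  qed
qed

lemma Ck_id_linear:
  assumes "bounded_linear L" shows "Ck k L"
proof (cases k)
  case 0
  then show ?thesis using linear_continuous_on[OF assms] by simp
next
  case (Suc j)
  show ?thesis unfolding Suc
    by (rule Ck_SucI[where D="\<lambda>x. L"]) (auto intro: bounded_linear_imp_has_derivative assms Ck_const)
qed

lemma Ck_add:
  assumes "Ck k f" "Ck k g" shows "Ck k (\<lambda>x. f x + g x)"
  using assms
proof (induction k arbitrary: f g)
  case 0
  then show ?case by (auto intro: continuous_on_add)
next
  case (Suc k)
  show ?case
    by (rule Ck_SucI[OF has_derivative_add[OF Ck_SucD(1)[OF Suc.prems(1)] Ck_SucD(1)[OF Suc.prems(2)]]])
      (rule Suc.IH[OF Ck_SucD(2)[OF Suc.prems(1)] Ck_SucD(2)[OF Suc.prems(2)]])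
qed

lemma Ck_mult:
  fixes f g :: "'a::real_normed_vector \<Rightarrow> real"
  assumes "Ck k f" "Ck k g" shows "Ck k (\<lambda>x. f x * g x)"
  using assms
proof (induction k arbitrary: f g)
  case 0
  then show ?case by (auto intro: continuous_on_mult)
next
  case (Suc k)
  show ?case
    by (rule Ck_SucI[OF has_derivative_mult[OF Ck_SucD(1)[OF Suc.prems(1)] Ck_SucD(1)[OF Suc.prems(2)]]])
      (rule Ck_add[OF Suc.IH[OF Ck_Suc_imp[OF Suc.prems(1)] Ck_SucD(2)[OF Suc.prems(2)]]
                      Suc.IH[OF Ck_SucD(2)[OF Suc.prems(1)] Ck_Suc_imp[OF Suc.prems(2)]]])
qed

lemma has_derivative_affine_comp:
  fixes f :: "'a::real_normed_vector \<Rightarrow> 'b::real_normed_vector"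
  assumes "(f has_derivative D) (at (a + c *\<^sub>R x))"
  shows "((\<lambda>x. f (a + c *\<^sub>R x)) has_derivative (\<lambda>v. c *\<^sub>R D v)) (at x)"
proof -
  have "((\<lambda>x. a + c *\<^sub>R x) has_derivative (\<lambda>v. c *\<^sub>R v)) (at x)"
    by (auto intro!: derivative_eq_intros)
  from has_derivative_compose[OF this assms] show ?thesis
    using has_derivative_linear[OF assms] by (simp add: linear_scale)
qed

lemma frechet_derivative_affine_comp:
  fixes f :: "'a::real_normed_vector \<Rightarrow> 'b::real_normed_vector"
  assumes "\<And>x. f differentiable (at x)"
  shows "frechet_derivative (\<lambda>x. f (a + c *\<^sub>R x)) (at x) v = c *\<^sub>R frechet_derivative f (at (a + c *\<^sub>R x)) v"
  using frechet_derivative_at[OF has_derivative_affine_comp[OF iffD1[OF frechet_derivative_works assms]]]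
  by metis

lemma Ck_affine_comp:
  fixes f :: "'a::real_normed_vector \<Rightarrow> 'b::real_normed_vector"
  assumes "Ck k f" shows "Ck k (\<lambda>x. f (a + c *\<^sub>R x))"
  using assms
proof (induction k arbitrary: f)
  case 0
  then show ?case by (auto intro!: continuous_on_compose2[of UNIV f] continuous_intros)
next
  case (Suc k)
  show ?case
    by (rule Ck_SucI[OF has_derivative_affine_comp[OF Ck_SucD(1)[OF Suc.prems]]])
      (rule Ck_bounded_linear[OF bounded_linear_scaleR_right Suc.IH[OF Ck_SucD(2)[OF Suc.prems]]])
qed

lemma laplacian_affine_comp:
  fixes w :: "'a::euclidean_space \<Rightarrow> complex"
  assumes "Ck 2 w"
  shows "laplacian (\<lambda>x. w (a + c *\<^sub>R x)) x = c\<^sup>2 *\<^sub>R laplacian w (a + c *\<^sub>R x)"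
proof -
  have d1: "w differentiable (at x)" and d2: "(\<lambda>y. frechet_derivative w (at y) b) differentiable (at x)" for x b
    using assms by (auto simp: numeral_2_eq_2)
  have "frechet_derivative (\<lambda>y. frechet_derivative (\<lambda>x. w (a + c *\<^sub>R x)) (at y) b) (at x) b
    = c\<^sup>2 *\<^sub>R frechet_derivative (\<lambda>y. frechet_derivative w (at y) b) (at (a + c *\<^sub>R x)) b" for b
  proof -
    have "((\<lambda>y. c *\<^sub>R frechet_derivative w (at (a + c *\<^sub>R y)) b) has_derivative
      (\<lambda>v. c *\<^sub>R (c *\<^sub>R frechet_derivative (\<lambda>y. frechet_derivative w (at y) b) (at (a + c *\<^sub>R x)) v))) (at x)"
      by (rule has_derivative_scaleR_right[OF has_derivative_affine_comp[OF iffD1[OF frechet_derivative_works d2]]])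
    from fun_cong[OF frechet_derivative_at[OF this], of b]
    show ?thesis unfolding frechet_derivative_affine_comp[OF d1] by (simp add: power2_eq_square)
  qed
  then show ?thesis by (simp add: laplacian_def scaleR_sum_right)
qed

lemma laplacian_eq_0_open:
  assumes "open S" "\<And>x. x \<in> S \<Longrightarrow> w x = 0" "x \<in> S"
  shows "laplacian w x = 0"
proof -
  have z: "frechet_derivative f (at y) b = 0" if "\<And>x. x \<in> S \<Longrightarrow> f x = 0" "y \<in> S" for f :: "'a \<Rightarrow> complex" and y b
  proof -
    have "(f has_derivative (\<lambda>_. 0)) (at y)"
      by (rule has_derivative_transform_within_open[OF _ assms(1) that(2)]) (auto simp: that(1))
    from frechet_derivative_at[OF this] show ?thesis by metis
  qed
  show ?thesis unfolding laplacian_def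
    by (intro sum.neutral ballI z[OF z[OF assms(2)]] assms(3))
qed

text \<open>The family is closed under differentiation: the derivative of a member is a combination
  of members with larger index. This makes smoothness of the classical flat function, the case
  \<open>n = 0\<close>, provable by induction.\<close>

definition exp_flat :: "nat \<Rightarrow> real \<Rightarrow> real" where
  "exp_flat n t = (if 0 < t then exp (- 1 / t) / t ^ n else 0)"

lemma power_le_fact_exp:
  assumes "0 \<le> (x::real)" shows "x ^ n \<le> fact n * exp x"
proof -
  have s: "summable (\<lambda>n. x ^ n /\<^sub>R fact n)" by (rule summable_exp_generic)
  have "x ^ n /\<^sub>R fact n \<le> exp x"
    unfolding exp_def using sum_le_suminf[OF s, of "{n}"] assms by simp
  then show ?thesis by (simp add: field_simps)
qed

text \<open>The term of order \<open>Suc n\<close> of the exponential series, one more than the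
  power to be beaten, leaves a factor \<open>t\<close>. The resulting decay at 0 settles the
  difference quotients there.\<close>

lemma exp_flat_bound: "\<bar>exp_flat n t\<bar> \<le> fact (Suc n) * \<bar>t\<bar>"
proof (cases "0 < t")
  case True
  have "(1 / t) ^ Suc n \<le> fact (Suc n) * exp (1 / t)"
    by (rule power_le_fact_exp) (use True in simp)
  then have "(1 / t) ^ n \<le> fact (Suc n) * t * exp (1 / t)"
    using True by (simp add: field_simps del: fact_Suc)
  then have "(1 / t) ^ n / exp (1 / t) \<le> fact (Suc n) * t"
    by (simp add: pos_divide_le_eq del: fact_Suc)
  moreover have "exp_flat n t = (1 / t) ^ n / exp (1 / t)"
    using True by (simp add: exp_flat_def exp_minus power_one_over field_simps)
  moreover have "0 \<le> exp_flat n t" using True by (simp add: exp_flat_def)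
  ultimately show ?thesis using True by (simp del: fact_Suc)
next
  case False
  have "0 \<le> fact (Suc n) * \<bar>t\<bar>" by (intro mult_nonneg_nonneg) auto
  with False show ?thesis by (simp add: exp_flat_def del: fact_Suc)
qed

lemma exp_flat_deriv:
  "(exp_flat n has_real_derivative exp_flat (n + 2) t - real n * exp_flat (n + 1) t) (at t)"
proof (cases t "0::real" rule: linorder_cases)
  case less
  have "((\<lambda>t. 0) has_real_derivative 0) (at t)" by simp
  then have "(exp_flat n has_real_derivative 0) (at t)"
    by (rule has_field_derivative_transform_within_open[of _ _ _ "{..<0}"]) (use less in \<open>auto simp: exp_flat_def\<close>)
  then show ?thesis using less by (simp add: exp_flat_def)
next
  case equal
  have "((\<lambda>h. exp_flat n h / h) \<longlongrightarrow> 0) (at 0)"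
  proof (rule tendsto_rabs_zero_cancel, rule tendsto_sandwich[of "\<lambda>_. 0" _ _ "\<lambda>h. fact (Suc (Suc n)) * \<bar>h\<bar>"])
    show "((\<lambda>h::real. fact (Suc (Suc n)) * \<bar>h\<bar>) \<longlongrightarrow> 0) (at 0)"
      by (rule tendsto_eq_intros | simp)+
    have "\<bar>exp_flat n h / h\<bar> \<le> fact (Suc (Suc n)) * \<bar>h\<bar>" for h
    proof -
      \<comment> \<open>Dividing by \<open>h\<close> moves one step up in the family, also for
        \<open>h \<le> 0\<close>, where both sides vanish.\<close>
      have "exp_flat n h / h = exp_flat (Suc n) h" by (simp add: exp_flat_def)
      then show ?thesis using exp_flat_bound[of "Suc n" h] by (simp only:)
    qed
    then show "\<forall>\<^sub>F h in at 0. \<bar>exp_flat n h / h\<bar> \<le> fact (Suc (Suc n)) * \<bar>h\<bar>"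
      by (intro always_eventually allI)
  qed simp_all
  then show ?thesis using equal by (simp add: DERIV_def exp_flat_def)
next
  case greater
  have "((\<lambda>t. exp (- 1 / t) / t ^ n) has_real_derivative exp (- 1 / t) / t ^ (n + 2) - real n * (exp (- 1 / t) / t ^ (n + 1))) (at t)"
  proof (cases n)
    case 0
    with greater show ?thesis
      by (auto intro!: derivative_eq_intros simp: field_simps power2_eq_square)
  next
    case (Suc m)
    have d1: "((\<lambda>t. exp (- 1 / t)) has_real_derivative exp (- 1 / t) / t\<^sup>2) (at t)"
      using greater by (auto intro!: derivative_eq_intros simp: field_simps power2_eq_square)
    show ?thesis
      by (rule DERIV_cong[OF DERIV_divide[OF d1 DERIV_pow]]) (use greater Suc in \<open>simp_all add: field_simps power2_eq_square\<close>)
  qed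
  then have "(exp_flat n has_real_derivative exp (- 1 / t) / t ^ (n + 2) - real n * (exp (- 1 / t) / t ^ (n + 1))) (at t)"
    by (rule has_field_derivative_transform_within_open[of _ _ _ "{0<..}"]) (use greater in \<open>auto simp: exp_flat_def\<close>)
  then show ?thesis using greater by (simp add: exp_flat_def)
qed

text \<open>Induction with \<open>n\<close> arbitrary, since differentiation changes it. The
  polynomial \<open>1 - x \<bullet> x\<close> avoids the norm, which is not smooth at the
  origin.\<close>

lemma Ck_exp_flat_comp:
  "Ck k (\<lambda>x::'a::euclidean_space. exp_flat n (1 - x \<bullet> x))"
proof (induction k arbitrary: n)
  case 0
  have "continuous_on UNIV (exp_flat n)"
    using exp_flat_deriv[of n] by (auto intro!: DERIV_continuous_on)
  then show ?case by (auto intro!: continuous_on_compose2[of UNIV "exp_flat n"] continuous_intros)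
next
  case (Suc k)
  show ?case
  proof (rule Ck_SucI)
    fix x :: 'a
    have "((\<lambda>x::'a. 1 - x \<bullet> x) has_derivative (\<lambda>v. - (2 * (x \<bullet> v)))) (at x)"
      by (auto intro!: derivative_eq_intros simp: inner_commute)
    from has_derivative_compose[OF this has_field_derivative_imp_has_derivative[OF exp_flat_deriv]]
    show "((\<lambda>x::'a. exp_flat n (1 - x \<bullet> x)) has_derivative
       (\<lambda>v. (exp_flat (n + 2) (1 - x \<bullet> x) + (- real n) * exp_flat (n + 1) (1 - x \<bullet> x)) * (- 2 * (x \<bullet> v)))) (at x)"
      by simp
  next
    fix v :: 'a
    show "Ck k (\<lambda>x. (exp_flat (n + 2) (1 - x \<bullet> x) + (- real n) * exp_flat (n + 1) (1 - x \<bullet> x)) * (- 2 * (x \<bullet> v)))"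
      by (intro Ck_mult Ck_add Ck_const Suc.IH Ck_id_linear bounded_linear_inner_left)
  qed
qed

definition bump :: "'a::euclidean_space \<Rightarrow> real" where
  "bump x = exp_flat 0 (1 - x \<bullet> x)"

text \<open>Averaging kernels are real while \<open>laplacian\<close> is defined for complex
  functions; by \<open>laplacian_bump_real\<close> taking the real part loses nothing.\<close>

definition bump_laplacian :: "'a::euclidean_space \<Rightarrow> real" where
  "bump_laplacian x = Re (laplacian (\<lambda>x. complex_of_real (bump x)) x)"

section \<open>The bump and its Laplacian as test function and averaging kernels\<close>

lemma Ck_bump: "Ck k (bump :: 'a::euclidean_space \<Rightarrow> real)" "Ck k (\<lambda>x::'a. complex_of_real (bump x))"
  unfolding bump_def[abs_def] by (intro Ck_exp_flat_comp Ck_bounded_linear[OF bounded_linear_of_real])+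

lemma bump_outside: "1 < norm x \<Longrightarrow> bump x = 0"
  by (simp add: bump_def exp_flat_def dot_square_norm power_le_one_iff not_less abs_square_le_1) 

lemma test_function_bump:
  fixes x :: "'a::euclidean_space"
  assumes "0 < r"
  shows "test_function (\<lambda>y. complex_of_real (bump (r *\<^sub>R (y - x))))"
proof -
  have eq: "r *\<^sub>R (y - x) = - (r *\<^sub>R x) + r *\<^sub>R y" for y by (simp add: algebra_simps)
  have "Ck k (\<lambda>y. complex_of_real (bump (r *\<^sub>R (y - x))))" for k
    unfolding eq by (rule Ck_affine_comp[OF Ck_bump(2)])
  moreover have "bounded {y. complex_of_real (bump (r *\<^sub>R (y - x))) \<noteq> 0}"
  proof (rule bounded_subset[OF bounded_cball])
    show "{y. complex_of_real (bump (r *\<^sub>R (y - x))) \<noteq> 0} \<subseteq> cball x (1 / r)"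
    proof
      fix y assume "y \<in> {y. complex_of_real (bump (r *\<^sub>R (y - x))) \<noteq> 0}"
      then have "norm (r *\<^sub>R (y - x)) \<le> 1" using bump_outside[of "r *\<^sub>R (y - x)"] by (force simp: not_less[symmetric])
      then have "r * norm (y - x) \<le> 1" by (simp only: norm_scaleR abs_of_pos[OF assms])
      then show "y \<in> cball x (1 / r)" using assms by (simp add: dist_norm norm_minus_commute[of x] pos_le_divide_eq mult.commute)
    qed
  qed
  ultimately show ?thesis by (simp add: test_function_def compact_closure)
qed

lemma laplacian_bump_real:
  "laplacian (\<lambda>x. complex_of_real (bump x)) x = complex_of_real (bump_laplacian (x::'a::euclidean_space))"
proof -
  have fd: "frechet_derivative (\<lambda>x. complex_of_real (f x)) (at y) b = complex_of_real (frechet_derivative f (at y) b)"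
    if "\<And>x. f differentiable (at x)" for f :: "'a \<Rightarrow> real" and y b
    using frechet_derivative_at[OF bounded_linear.has_derivative[OF bounded_linear_of_real iffD1[OF frechet_derivative_works that]]]
    by metis
  have "bump differentiable (at x)" "(\<lambda>y. frechet_derivative bump (at y) b) differentiable (at x)" for x b :: 'a
    using Ck_bump(1)[of 2, where ?'a='a] by (auto simp: numeral_2_eq_2)
  then show ?thesis by (simp add: bump_laplacian_def laplacian_def fd)
qed

lemma laplacian_bump:
  "laplacian (\<lambda>y. complex_of_real (bump (r *\<^sub>R (y - x)))) y = complex_of_real (r\<^sup>2 * bump_laplacian (r *\<^sub>R (y - x)))"
proof -
  have eq: "r *\<^sub>R (y - x) = - (r *\<^sub>R x) + r *\<^sub>R y" for y by (simp add: algebra_simps)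
  show ?thesis unfolding eq laplacian_affine_comp[OF Ck_bump(2)] laplacian_bump_real
    by (simp add: scaleR_conv_of_real)
qed

text \<open>The symmetry that \<open>mollify_pairing_real\<close> requires of both kernels.\<close>

lemma bump_even: "bump (- x) = bump x" "bump_laplacian (- x) = bump_laplacian x"
proof -
  show e: "bump (- x) = bump x" for x :: 'a by (simp add: bump_def)
  show "bump_laplacian (- x) = bump_laplacian x"
    using laplacian_affine_comp[OF Ck_bump(2), of 0 "-1" x] by (simp add: e bump_laplacian_def)
qed

lemma averaging_kernel_compact_support:
  assumes c: "continuous_on UNIV v" and z: "\<And>x. 1 < norm x \<Longrightarrow> v x = 0"
  shows "averaging_kernel v"
proof -
  have m: "v \<in> borel_measurable borel" by (rule borel_measurable_continuous_onI[OF c])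
  have "compact (v ` cball 0 1)" by (intro compact_continuous_image continuous_on_subset[OF c]) auto
  then obtain B where B: "\<And>x. norm x \<le> 1 \<Longrightarrow> \<bar>v x\<bar> \<le> B"
    using compact_imp_bounded[THEN iffD1[OF bounded_iff]] by force
  have B0: "0 \<le> B" using B[of 0] by simp
  then have B': "\<bar>v x\<bar> \<le> B" for x using B[of x] z[of x] by (cases "norm x \<le> 1") auto
  have "integrable lborel v"
  proof (rule Bochner_Integration.integrable_bound)
    show "integrable lborel (\<lambda>x::'a. B * indicat_real (cball 0 1) x)"
      using emeasure_lborel_cball_finite[of "0::'a" 1] by simp
    show "AE x in lborel. norm (v x) \<le> norm (B * indicat_real (cball 0 1) x)"
      using B' z B0 by (intro AE_I2) (auto simp: indicator_def)
  qed (use m in simp)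
  with B' show ?thesis by (auto simp: averaging_kernel_def)
qed

lemma bump_laplacian_continuous: "continuous_on UNIV (bump_laplacian :: 'a::euclidean_space \<Rightarrow> real)"
proof -
  have "Ck 0 (\<lambda>x. frechet_derivative (\<lambda>y. frechet_derivative (\<lambda>x::'a. complex_of_real (bump x)) (at y) b) (at x) b)" for b
    using Ck_bump(2)[of 2, where ?'a='a] by (simp add: numeral_2_eq_2)
  then show ?thesis unfolding bump_laplacian_def[abs_def] laplacian_def
    by (auto intro!: continuous_intros)
qed

lemma bump_laplacian_outside: "1 < norm (x::'a::euclidean_space) \<Longrightarrow> bump_laplacian x = 0"
proof -
  assume x: "1 < norm x"
  have "open {x::'a. 1 < norm x}" by (intro open_Collect_less continuous_intros)
  from laplacian_eq_0_open[OF this, of "\<lambda>x. complex_of_real (bump x)" x] x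
  show "bump_laplacian x = 0" by (simp add: bump_laplacian_def bump_outside)
qed

lemma averaging_kernel_bump:
  "averaging_kernel (bump :: 'a::euclidean_space \<Rightarrow> real)" "averaging_kernel (bump_laplacian :: 'a \<Rightarrow> real)"
proof -
  have "continuous_on UNIV (bump :: 'a \<Rightarrow> real)" using Ck_bump(1)[of 0, where ?'a='a] by simp
  then show "averaging_kernel (bump :: 'a \<Rightarrow> real)" by (rule averaging_kernel_compact_support[OF _ bump_outside])
  show "averaging_kernel (bump_laplacian :: 'a \<Rightarrow> real)"
    by (rule averaging_kernel_compact_support[OF bump_laplacian_continuous bump_laplacian_outside])
qed

text \<open>Positivity takes the place of normalisation: the square of this number is a common
  factor of the limiting masses.\<close>

lemma bump_integral_pos: "0 < (LINT x::'a::euclidean_space|lborel. bump x)"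
proof -
  have nn: "0 \<le> bump x" for x :: 'a by (simp add: bump_def exp_flat_def)
  have c: "continuous_on UNIV (bump :: 'a \<Rightarrow> real)" using Ck_bump(1)[of 0, where ?'a='a] by simp
  have i: "integrable lborel (bump :: 'a \<Rightarrow> real)" using averaging_kernel_bump(1) by (auto simp: averaging_kernel_def)
  have "(LINT x::'a|lborel. bump x) \<noteq> 0"
  proof
    assume "(LINT x::'a|lborel. bump x) = 0"
    then have "AE x::'a in lborel. bump x = 0"
      using integral_nonneg_eq_0_iff_AE[OF i] nn by simp
    then have ae: "AE x::'a in lborel. x \<notin> ball 0 1"
    proof eventually_elim
      case (elim x)
      then show ?case by (auto simp: bump_def exp_flat_def dot_square_norm abs_square_less_1 split: if_splits)
    qed
    have "emeasure lborel (ball (0::'a) 1) = 0"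
      using ae AE_iff_null_sets[of "ball (0::'a) 1" lborel] by auto
    then show False using content_ball_pos[of 1 "0::'a"] by (simp add: measure_def)
  qed
  moreover have "0 \<le> (LINT x::'a|lborel. bump x)" using nn by (intro integral_nonneg_AE) simp
  ultimately show ?thesis by simp
qed

lemma averaging_kernel_scale:
  assumes "averaging_kernel v" "r \<noteq> 0" shows "averaging_kernel (\<lambda>a. v (r *\<^sub>R a))"
  using lborel_affine_change(1)[of v r 0] assms by (auto simp: averaging_kernel_def)

lemma averaging_kernel_cmult:
  assumes "averaging_kernel v" shows "averaging_kernel (\<lambda>a. c * v a)"
proof -
  obtain B where "\<And>x. \<bar>v x\<bar> \<le> B" using assms by (auto simp: averaging_kernel_def)
  then have "\<bar>c * v x\<bar> \<le> \<bar>c\<bar> * B" for x by (simp add: abs_mult mult_left_mono)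
  then show ?thesis using assms by (auto simp: averaging_kernel_def)
qed

section \<open>Conservation of mass\<close>

text \<open>The chain rule for the squared modulus of an indefinite integral, by Fubini instead of
  differentiation: the triangle \<open>r < s\<close> and its conjugated mirror image fill the square
  up to the diagonal, so twice the real part of the triangle integral is
  \<open>|\<Phi>|\<^sup>2\<close>.\<close>

lemma energy_identity:
  fixes f :: "real \<Rightarrow> complex"
  assumes g: "integrable lborel g" and f: "\<And>s. f s = a + (LINT r|lborel. indicator {..<s} r * g r)"
    and lim: "f t = a + (LINT r|lborel. g r)"
  shows "(cmod (f t))\<^sup>2 - (cmod a)\<^sup>2 = 2 * Re (LINT s|lborel. cnj (f s) * g s)"
    and "integrable lborel (\<lambda>s. cnj (f s) * g s)"
proof -
  have [measurable]: "g \<in> borel_measurable borel" using g by auto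
  define \<Phi> where "\<Phi> = (LINT r|lborel. g r)"
  define D where "D r s = (if r < s then cnj (g r) * g s else 0)" for r s
  have Pi: "integrable (lborel \<Otimes>\<^sub>M lborel) (\<lambda>p. cnj (g (fst p)) * g (snd p))"
    and Pe: "(LINT p|(lborel \<Otimes>\<^sub>M lborel). cnj (g (fst p)) * g (snd p)) = cnj \<Phi> * \<Phi>"
    using lborel_product_integral[OF integrable_cnj[OF g] g] by (simp_all add: \<Phi>_def)
  have Dm[measurable]: "case_prod D \<in> borel_measurable (lborel \<Otimes>\<^sub>M lborel)"
    unfolding D_def case_prod_beta by measurable
  have Di: "integrable (lborel \<Otimes>\<^sub>M lborel) (case_prod D)"
    by (rule Bochner_Integration.integrable_bound[OF Pi Dm]) (auto simp: D_def indicator_def)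
  define E where "E r s = cnj (D s r)" for r s
  have Ei: "integrable (lborel \<Otimes>\<^sub>M lborel) (case_prod E)"
    using lborel_pair.integrable_product_swap[OF integrable_cnj[OF Di]] unfolding E_def[abs_def] case_prod_beta by simp
  define J where "J = (LINT s|lborel. LINT r|lborel. D r s)"
  have EJ: "(LINT s|lborel. LINT r|lborel. E r s) = cnj J"
  proof -
    have "(LINT s|lborel. LINT r|lborel. E r s) = (LINT r|lborel. LINT s|lborel. E r s)"
      by (rule lborel_pair.Fubini_integral[OF Ei])
    also have "\<dots> = cnj J" unfolding E_def J_def by simp
    finally show ?thesis .
  qed
  have inner: "(LINT r|lborel. D r s) + (LINT r|lborel. E r s) = cnj \<Phi> * g s" if "integrable lborel (\<lambda>r. D r s)" "integrable lborel (\<lambda>r. E r s)" for s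
  proof -
    have "(LINT r|lborel. D r s) + (LINT r|lborel. E r s) = (LINT r|lborel. D r s + E r s)"
      using that by simp
    also have "\<dots> = (LINT r|lborel. cnj (g r) * g s)"
    proof (rule integral_cong_AE)
      show "(\<lambda>r. D r s + E r s) \<in> borel_measurable lborel" using that by auto
      \<comment> \<open>The diagonal \<open>r = s\<close> belongs to neither triangle and is a null
        set.\<close>
      show "AE r in lborel. D r s + E r s = cnj (g r) * g s"
        using AE_lborel_singleton[of s]
        by eventually_elim (auto simp: D_def E_def indicator_def)
    qed simp
    finally show ?thesis by (simp add: \<Phi>_def)
  qed
  have "J + cnj J = (LINT s|lborel. (LINT r|lborel. D r s) + (LINT r|lborel. E r s))"
    unfolding Bochner_Integration.integral_add[OF lborel_pair.integrable_snd[OF Di] lborel_pair.integrable_snd[OF Ei]] EJ J_def ..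
  also have "\<dots> = (LINT s|lborel. cnj \<Phi> * g s)"
  proof (rule integral_cong_AE)
    show "AE s in lborel. (LINT r|lborel. D r s) + (LINT r|lborel. E r s) = cnj \<Phi> * g s"
      using lborel_pair.AE_integrable_snd[OF Di] lborel_pair.AE_integrable_snd[OF Ei]
      by eventually_elim (rule inner)
    show "(\<lambda>s. (LINT r|lborel. D r s) + (LINT r|lborel. E r s)) \<in> borel_measurable lborel"
      using lborel_pair.integrable_snd[OF Di] lborel_pair.integrable_snd[OF Ei] by auto
  qed simp
  also have "\<dots> = cnj \<Phi> * \<Phi>" by (simp add: \<Phi>_def)
  also have "\<dots> = complex_of_real ((cmod \<Phi>)\<^sup>2)" by (simp only: complex_norm_square mult.commute)
  finally have JJ: "J + cnj J = complex_of_real ((cmod \<Phi>)\<^sup>2)" .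
  have ReJ: "2 * Re J = (cmod \<Phi>)\<^sup>2"
    using arg_cong[OF JJ, of Re] by simp
  have fs: "cnj (f s) * g s = cnj a * g s + (LINT r|lborel. D r s)" for s
  proof -
    have "(LINT r|lborel. D r s) = cnj (LINT r|lborel. indicator {..<s} r * g r) * g s"
      unfolding Bochner_Integration.integral_cnj[symmetric] Bochner_Integration.integral_mult_left_zero[symmetric] D_def
      by (intro Bochner_Integration.integral_cong refl) (simp add: indicator_def)
    then show ?thesis by (simp add: f algebra_simps)
  qed
  show i: "integrable lborel (\<lambda>s. cnj (f s) * g s)"
    unfolding fs using lborel_pair.integrable_snd[OF Di] g by simp
  have "(LINT s|lborel. cnj (f s) * g s) = cnj a * \<Phi> + J"
    unfolding fs J_def \<Phi>_def using lborel_pair.integrable_snd[OF Di] g by simp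
  moreover have "(cmod (f t))\<^sup>2 = (cmod a)\<^sup>2 + (cmod \<Phi>)\<^sup>2 + 2 * Re (cnj a * \<Phi>)"
    unfolding lim \<Phi>_def[symmetric] cmod_power2 by (simp add: power2_eq_square algebra_simps)
  ultimately show "(cmod (f t))\<^sup>2 - (cmod a)\<^sup>2 = 2 * Re (LINT s|lborel. cnj (f s) * g s)"
    using ReJ by simp
qed

text \<open>Replacing \<open>x\<close> by simple functions \<open>q i\<close> leaves countably many
  sections, and continuity in \<open>x\<close> gives the limit. For a solution, measurability in
  time comes with each fixed test function only, so joint measurability has to be built this
  way.\<close>

lemma caratheodory_measurable:
  fixes f :: "real \<Rightarrow> 'a::euclidean_space \<Rightarrow> complex"
  assumes m: "\<And>x. (\<lambda>s. f s x) \<in> borel_measurable borel" and c: "\<And>s. continuous_on UNIV (f s)"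
  shows "case_prod f \<in> borel_measurable (lborel \<Otimes>\<^sub>M lborel)"
proof -
  have "(\<lambda>x::'a. x) \<in> borel_measurable lborel" by simp
  from borel_measurable_implies_sequence_metric[OF this, of 0] obtain q where
    q: "\<And>i. simple_function lborel (q i)" "\<And>x. (\<lambda>i. q i x) \<longlonglongrightarrow> (x::'a)"
    by (auto simp: space_lborel)
  show ?thesis
  proof (rule borel_measurable_LIMSEQ_metric)
    fix i
    have "(\<lambda>p. (\<lambda>y p. f (fst p) y) (q i (snd p)) p) \<in> borel_measurable (lborel \<Otimes>\<^sub>M lborel)"
    proof (rule measurable_compose_countable'[where I="range (q i)"])
      show "(\<lambda>p. f (fst p) y) \<in> borel_measurable (lborel \<Otimes>\<^sub>M lborel)" for y
        using m[of y] by simp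
      show "countable (range (q i))"
        using simple_functionD(1)[OF q(1), of i] by (simp add: countable_finite)
      have "q i \<in> lborel \<rightarrow>\<^sub>M count_space (range (q i))"
        using measurable_simple_function[OF q(1)[of i]]
        by (auto simp: measurable_def)
      then show "(\<lambda>p. q i (snd p)) \<in> lborel \<Otimes>\<^sub>M lborel \<rightarrow>\<^sub>M count_space (range (q i))"
        by (rule measurable_compose[OF measurable_snd])
    qed
    then show "(\<lambda>p. f (fst p) (q i (snd p))) \<in> borel_measurable (lborel \<Otimes>\<^sub>M lborel)" by simp
  next
    fix p :: "real \<times> 'a"
    have "isCont (f (fst p)) (snd p)" using c[of "fst p"] by (simp add: continuous_on_eq_continuous_at)
    from isCont_tendsto_compose[OF this q(2)]
    show "(\<lambda>i. f (fst p) (q i (snd p))) \<longlonglongrightarrow> case_prod f p" by (simp add: case_prod_beta)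
  qed
qed

lemma mollify_eq: "mollify v f x = (LINT y|lborel. f y * complex_of_real (v (y - x)))"
  unfolding mollify_def using integral_shift[of "\<lambda>y. f y * complex_of_real (v (y - x))" x]
  by (simp add: add.commute)

text \<open>Along a convergent sequence of centres the supports of the kernels stay in a common
  ball, on which \<open>\<bar>h\<bar> + 1\<close> is integrable.\<close>

lemma mollify_continuous:
  fixes f :: "'a::euclidean_space \<Rightarrow> complex"
  assumes f[measurable]: "f \<in> borel_measurable borel" and h: "integrable lborel h" "\<And>x. cmod (f x) \<le> h x + 1"
    and v: "continuous_on UNIV v" "\<And>x. R < norm x \<Longrightarrow> v x = 0" "\<And>x. \<bar>v x\<bar> \<le> B"
  shows "continuous_on UNIV (mollify v f)"
proof -
  have [measurable]: "v \<in> borel_measurable borel" by (rule borel_measurable_continuous_onI[OF v(1)])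
  have B0: "0 \<le> B" using v(3)[of 0] by linarith
  show ?thesis
    unfolding continuous_on_sequentially comp_def
  proof (intro allI ballI impI)
    fix X :: "nat \<Rightarrow> 'a" and x assume "(\<forall>n. X n \<in> UNIV) \<and> X \<longlonglongrightarrow> x"
    then have X: "X \<longlonglongrightarrow> x" by simp
    then have "Bseq X" by (intro convergent_imp_Bseq convergentI)
    then obtain K where K: "\<And>n. norm (X n) \<le> K" by (auto simp: Bseq_def)
    show "(\<lambda>n. mollify v f (X n)) \<longlonglongrightarrow> mollify v f x"
      unfolding mollify_eq
    proof (rule integral_dominated_convergence)
      show "integrable lborel (\<lambda>y. B * (\<bar>h y\<bar> + indicat_real (cball 0 (R + K)) y))"
        using h(1) emeasure_lborel_cball_finite[of "0::'a" "R + K"] by simp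
      show "AE y in lborel. (\<lambda>n. f y * complex_of_real (v (y - X n))) \<longlonglongrightarrow> f y * complex_of_real (v (y - x))"
      proof (rule AE_I2)
        fix y
        have "isCont v (y - x)" using v(1) by (simp add: continuous_on_eq_continuous_at)
        from isCont_tendsto_compose[OF this tendsto_diff[OF tendsto_const X]]
        show "(\<lambda>n. f y * complex_of_real (v (y - X n))) \<longlonglongrightarrow> f y * complex_of_real (v (y - x))"
          by (intro tendsto_mult_left tendsto_of_real)
      qed
      show "AE y in lborel. norm (f y * complex_of_real (v (y - X n))) \<le> B * (\<bar>h y\<bar> + indicat_real (cball 0 (R + K)) y)" for n
      proof (rule AE_I2)
        fix y
        show "norm (f y * complex_of_real (v (y - X n))) \<le> B * (\<bar>h y\<bar> + indicat_real (cball 0 (R + K)) y)"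
        proof (cases "norm y \<le> R + K")
          case True
          have "norm (f y * complex_of_real (v (y - X n))) = cmod (f y) * \<bar>v (y - X n)\<bar>" by (simp add: norm_mult)
          also have "\<dots> \<le> (\<bar>h y\<bar> + 1) * B"
            using h(2)[of y] v(3)[of "y - X n"] by (intro mult_mono) auto
          finally show ?thesis using True by (simp add: mult.commute)
        next
          case False
          then have "R < norm (y - X n)" using K[of n] norm_triangle_ineq2[of y "X n"] by linarith
          then show ?thesis using v(2) B0 by simp
        qed
      qed
    qed simp_all
  qed
qed

text \<open>What the cases \<open>m = 0\<close> and \<open>m = 1\<close> have in common. The
  majorant \<open>G\<close> carries a measurability in time that is not known for the integral of
  \<open>|u|^(\<alpha> + 2)\<close> itself; it may be infinite on a null set of times.\<close>

locale nls_flow =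
  fixes u :: "real \<Rightarrow> 'a::euclidean_space \<Rightarrow> complex" and lam \<alpha> T :: real and G :: "real \<Rightarrow> ennreal"
  assumes T: "0 < T" and \<alpha>: "0 \<le> \<alpha>" and lam: "lam \<noteq> 0"
    and uL2: "\<And>t. t \<in> {0..T} \<Longrightarrow> u t \<in> L2"
    and ub: "\<exists>B. \<forall>t\<in>{0..T}. l2norm (u t) \<le> B"
    and sat: "satisfies_nls lam \<alpha> {0..T} u"
    and Gm[measurable]: "G \<in> borel_measurable borel" and Gi: "(\<integral>\<^sup>+s\<in>{0..T}. G s \<partial>lborel) < \<infinity>"
    and uG: "\<And>t. t \<in> {0..T} \<Longrightarrow> (\<integral>\<^sup>+x. ennreal (cmod (u t x) powr (\<alpha> + 2)) \<partial>lborel) \<le> G t"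
begin

text \<open>Times at which the nonlinearity can be paired with \<open>u\<close>. The condition is
  put on \<open>G\<close> so that the set is measurable; almost every time in the interval belongs
  to it.\<close>

definition J :: "real set" where "J = {s. 0 < s \<and> s < T \<and> G s < \<infinity>}"

lemma J_measurable[measurable]: "J \<in> sets borel"
  unfolding J_def by measurable

lemma J_AE: "AE s in lborel. s \<in> {0<..<T} \<longrightarrow> s \<in> J"
proof -
  have "AE s in lborel. G s * indicator {0..T} s \<noteq> \<infinity>"
    by (rule nn_integral_PInf_AE) (use Gi in auto)
  then show ?thesis
    by eventually_elim (auto simp: J_def less_top[symmetric])
qed

lemma u_measurable: "t \<in> {0..T} \<Longrightarrow> u t \<in> borel_measurable borel"
  using uL2 by (rule L2_measurable)

lemma J_powr_integrable: "s \<in> J \<Longrightarrow> integrable lborel (\<lambda>x. cmod (u s x) powr (\<alpha> + 2))"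
  using u_measurable[of s] uG[of s] by (auto simp: J_def integrable_iff_bounded intro: le_less_trans)

text \<open>Mollifications at scale \<open>1 / r\<close> of \<open>u\<close>, of its Laplacian and
  of the nonlinearity. The Laplacian has been moved onto the bump, whose rescaling produces
  \<open>r\<^sup>2\<close>.\<close>

abbreviation Ur where "Ur r s \<equiv> mollify (\<lambda>a. bump (r *\<^sub>R a)) (u s)"
abbreviation Vr where "Vr r s \<equiv> mollify (\<lambda>a. r\<^sup>2 * bump_laplacian (r *\<^sub>R a)) (u s)"
abbreviation Wr where "Wr r s \<equiv> mollify (\<lambda>a. bump (r *\<^sub>R a)) (nonlinearity \<alpha> (u s))"

definition Fr :: "real \<Rightarrow> real \<Rightarrow> 'a \<Rightarrow> complex" where
  "Fr r s x = Vr r s x + complex_of_real lam * Wr r s x"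

text \<open>A rescaled bump centred at \<open>x\<close> is an admissible test function, so at each
  \<open>x\<close> the mollified solution is an indefinite time integral of
  \<open>\<i> * Fr r s x\<close>.\<close>

lemma mollified_equation:
  assumes r: "0 < r" and t: "t \<in> {0..T}"
  shows "set_integrable lborel {0<..<t} (\<lambda>s. Fr r s x)"
    and "Ur r t x = Ur r 0 x + \<i> * (LINT s:{0<..<t}|lborel. Fr r s x)"
proof -
  define w where "w y = complex_of_real (bump (r *\<^sub>R (y - x)))" for y
  have w: "test_function w" unfolding w_def by (rule test_function_bump[OF r])
  have F: "(LINT y|lborel. u s y * laplacian w y) + complex_of_real lam * (LINT y|lborel. complex_of_real (cmod (u s y) powr \<alpha>) * u s y * w y) = Fr r s x" for s
    unfolding w_def[abs_def] laplacian_bump Fr_def mollify_eq nonlinearity_def ..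
  have U: "(LINT y|lborel. u s y * w y) = Ur r s x" for s
    unfolding w_def mollify_eq ..
  have "interval_lebesgue_integrable lborel (ereal 0) (ereal t) (\<lambda>s. Fr r s x) \<and> \<i> * (Ur r t x - Ur r 0 x) + (LBINT s=ereal 0..ereal t. Fr r s x) = 0"
    using sat[unfolded satisfies_nls_def Let_def, rule_format, OF w t] unfolding F U .
  moreover have "0 \<le> t" using t by simp
  ultimately have *: "set_integrable lborel {0<..<t} (\<lambda>s. Fr r s x)" "\<i> * (Ur r t x - Ur r 0 x) + (LINT s:{0<..<t}|lborel. Fr r s x) = 0"
    by (simp_all add: interval_lebesgue_integrable_def interval_lebesgue_integral_def)
  show "set_integrable lborel {0<..<t} (\<lambda>s. Fr r s x)" by fact
  have "\<i> * (\<i> * (Ur r t x - Ur r 0 x) + (LINT s:{0<..<t}|lborel. Fr r s x)) = 0" unfolding *(2) by simp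
  then show "Ur r t x = Ur r 0 x + \<i> * (LINT s:{0<..<t}|lborel. Fr r s x)"
    by (simp add: distrib_left mult.assoc[symmetric] diff_eq_eq algebra_simps)
qed

lemma continuous_mollify_bump:
  fixes f :: "'a \<Rightarrow> complex"
  assumes r: "0 < r" and f: "f \<in> borel_measurable borel" "integrable lborel h" "\<And>x. cmod (f x) \<le> h x + 1"
  shows "continuous_on UNIV (mollify (\<lambda>a. bump (r *\<^sub>R a)) f)" "continuous_on UNIV (mollify (\<lambda>a. r\<^sup>2 * bump_laplacian (r *\<^sub>R a)) f)"
proof -
  have out: "1 < norm (r *\<^sub>R x)" if "1 / r < norm x" for x :: 'a
    using that r by (simp add: field_simps)
  have b: "continuous_on UNIV (bump :: 'a \<Rightarrow> real)" using Ck_bump(1)[of 0, where ?'a='a] by simp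
  have av: "averaging_kernel (\<lambda>a::'a. bump (r *\<^sub>R a))" "averaging_kernel (\<lambda>a::'a. r\<^sup>2 * bump_laplacian (r *\<^sub>R a))"
    using r by (intro averaging_kernel_cmult averaging_kernel_scale averaging_kernel_bump; simp)+
  obtain B1 where B1: "\<And>a::'a. \<bar>bump (r *\<^sub>R a)\<bar> \<le> B1" using av(1) by (auto simp: averaging_kernel_def)
  obtain B2 where B2: "\<And>a::'a. \<bar>r\<^sup>2 * bump_laplacian (r *\<^sub>R a)\<bar> \<le> B2" using av(2) unfolding averaging_kernel_def by blast
  show "continuous_on UNIV (mollify (\<lambda>a. bump (r *\<^sub>R a)) f)"
  proof (rule mollify_continuous[OF f _ _ B1])
    show "continuous_on UNIV (\<lambda>a::'a. bump (r *\<^sub>R a))"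
      by (auto intro!: continuous_on_compose2[OF b] continuous_intros)
    show "bump (r *\<^sub>R x) = 0" if "1 / r < norm x" for x :: 'a by (rule bump_outside[OF out[OF that]])
  qed
  show "continuous_on UNIV (mollify (\<lambda>a. r\<^sup>2 * bump_laplacian (r *\<^sub>R a)) f)"
  proof (rule mollify_continuous[OF f _ _ B2])
    show "continuous_on UNIV (\<lambda>a::'a. r\<^sup>2 * bump_laplacian (r *\<^sub>R a))"
      by (auto intro!: continuous_on_compose2[OF bump_laplacian_continuous] continuous_intros)
    show "r\<^sup>2 * bump_laplacian (r *\<^sub>R x) = 0" if "1 / r < norm x" for x :: 'a
      by (simp add: bump_laplacian_outside[OF out[OF that]])
  qed
qed

lemma powr_bounds:
  assumes "0 \<le> (c::real)" shows "c powr (\<alpha> + 1) \<le> c powr (\<alpha> + 2) + 1" "c \<le> c powr (\<alpha> + 2) + 1"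
  using powr_less_succ[OF assms, of "\<alpha> + 1" "\<alpha> + 2"] powr_less_succ[OF assms, of 1 "\<alpha> + 2"] \<alpha> assms by simp_all

lemma averaging_kernels:
  assumes "0 < r"
  shows "averaging_kernel (\<lambda>a::'a. bump (r *\<^sub>R a))" "averaging_kernel (\<lambda>a::'a. r\<^sup>2 * bump_laplacian (r *\<^sub>R a))"
  using assms by (intro averaging_kernel_cmult averaging_kernel_scale averaging_kernel_bump; simp)+

definition K :: "real \<Rightarrow> real \<Rightarrow> 'a \<Rightarrow> complex" where
  "K r s x = indicator J s * (cnj (Ur r s x) * (\<i> * Fr r s x))"

definition pairing :: "real \<Rightarrow> real \<Rightarrow> complex" where
  "pairing r s = (LINT x|lborel. cnj (Ur r s x) * Wr r s x)"

definition mass :: "real \<Rightarrow> real \<Rightarrow> real" where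
  "mass r t = (LINT x|lborel. (cmod (Ur r t x))\<^sup>2)"

text \<open>Recasts the mollified equation over the whole real axis, with \<open>J\<close> in place
  of the interval, in the form that \<open>energy_identity\<close> requires.\<close>

lemma Fr_J_integrable:
  assumes r: "0 < r"
  shows "integrable lborel (\<lambda>s. indicator J s * Fr r s x)"
    and "t \<in> {0..T} \<Longrightarrow> Ur r t x = Ur r 0 x + (LINT q|lborel. indicator {..<t} q * (indicator J q * (\<i> * Fr r q x)))"
proof -
  have TT: "T \<in> {0..T}" using T by simp
  have i: "integrable lborel (\<lambda>s. indicator {0<..<T} s * Fr r s x)"
    using mollified_equation(1)[OF r TT, of x] by (simp add: set_integrable_def scaleR_conv_of_real of_real_indicator)
  have m: "(\<lambda>s. indicator {0<..<T} s * Fr r s x) \<in> borel_measurable borel" using i by auto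
  have eq: "indicator J s * Fr r s x = indicator J s * (indicator {0<..<T} s * Fr r s x)" for s
    by (auto simp: indicator_def J_def)
  have m2: "(\<lambda>s. indicator J s * Fr r s x) \<in> borel_measurable borel"
    unfolding eq by (rule borel_measurable_times[OF borel_measurable_indicator m]) simp
  show "integrable lborel (\<lambda>s. indicator J s * Fr r s x)"
    by (rule Bochner_Integration.integrable_bound[OF i])
      (use m2 in simp, rule AE_I2, auto simp: indicator_def J_def)
  assume t: "t \<in> {0..T}"
  have "(LINT q|lborel. indicator {..<t} q * (indicator J q * (\<i> * Fr r q x))) = (LINT q|lborel. \<i> * (indicator {0<..<t} q * Fr r q x))"
  proof (rule integral_cong_AE)
    show "(\<lambda>q. indicator {..<t} q * (indicator J q * (\<i> * Fr r q x))) \<in> borel_measurable lborel"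
    proof -
      have "(\<lambda>q. \<i> * (indicator {..<t} q * (indicator J q * Fr r q x))) \<in> borel_measurable borel"
        by (rule borel_measurable_times[OF borel_measurable_const borel_measurable_times[OF borel_measurable_indicator m2]]) simp
      then show ?thesis by (simp add: mult.left_commute[of _ \<i>])
    qed
    have "set_integrable lborel {0<..<t} (\<lambda>s. Fr r s x)" by (rule mollified_equation(1)[OF r t])
    then have "integrable lborel (\<lambda>q. \<i> * (indicator {0<..<t} q * Fr r q x))"
      by (intro integrable_mult_right) (simp add: set_integrable_def scaleR_conv_of_real of_real_indicator)
    then show "(\<lambda>q. \<i> * (indicator {0<..<t} q * Fr r q x)) \<in> borel_measurable lborel" by auto
    show "AE q in lborel. indicator {..<t} q * (indicator J q * (\<i> * Fr r q x)) = \<i> * (indicator {0<..<t} q * Fr r q x)"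
      using J_AE by eventually_elim (use t in \<open>auto simp: indicator_def J_def\<close>)
  qed
  also have "\<dots> = \<i> * (LINT s:{0<..<t}|lborel. Fr r s x)"
    by (simp add: set_lebesgue_integral_def scaleR_conv_of_real of_real_indicator)
  finally show "Ur r t x = Ur r 0 x + (LINT q|lborel. indicator {..<t} q * (indicator J q * (\<i> * Fr r q x)))"
    using mollified_equation(2)[OF r t, of x] by simp
qed

lemma mass_pointwise:
  assumes r: "0 < r"
  shows "(cmod (Ur r T x))\<^sup>2 - (cmod (Ur r 0 x))\<^sup>2 = 2 * Re (LINT s|lborel. K r s x)"
    and "(\<lambda>s. K r s x) \<in> borel_measurable borel"
proof -
  define g where "g q = indicator J q * (\<i> * Fr r q x)" for q
  \<comment> \<open>Extends the mollified solution to all real times, because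
    \<open>energy_identity\<close> asks for the integral formula everywhere; on
    \<open>{0..T}\<close> it agrees with \<open>Ur\<close>.\<close>
  define f where "f s = Ur r 0 x + (LINT q|lborel. indicator {..<s} q * g q)" for s
  have gi: "integrable lborel g" unfolding g_def[abs_def]
    using integrable_mult_right[OF Fr_J_integrable(1)[OF r, of x], of \<i>] by (simp add: mult.left_commute)
  have fU: "f s = Ur r s x" if "s \<in> {0..T}" for s
    unfolding f_def g_def using Fr_J_integrable(2)[OF r that, of x] by simp
  have fT: "f T = Ur r 0 x + (LINT q|lborel. g q)"
    unfolding f_def by (intro arg_cong2[where f="(+)"] refl Bochner_Integration.integral_cong) (auto simp: g_def J_def indicator_def)
  note E = energy_identity[OF gi f_def fT]
  have eq: "(\<lambda>s. cnj (f s) * g s) = (\<lambda>s. K r s x)"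
    by (rule ext) (auto simp: g_def K_def indicator_def fU J_def)
  have TT: "T \<in> {0..T}" using T by simp
  show "(cmod (Ur r T x))\<^sup>2 - (cmod (Ur r 0 x))\<^sup>2 = 2 * Re (LINT s|lborel. K r s x)"
    using E(1) unfolding eq fU[OF TT] .
  show "(\<lambda>s. K r s x) \<in> borel_measurable borel"
    using E(2) unfolding eq by auto
qed

section \<open>Integrating the mass identity over space\<close>

lemma K_measurable:
  assumes r: "0 < r"
  shows "case_prod (K r) \<in> borel_measurable (lborel \<Otimes>\<^sub>M lborel)"
proof (rule caratheodory_measurable)
  show "(\<lambda>s. K r s x) \<in> borel_measurable borel" for x by (rule mass_pointwise(2)[OF r])
  fix s
  show "continuous_on UNIV (K r s)"
  proof (cases "s \<in> J")
    case True
    then have s: "s \<in> {0..T}" by (simp add: J_def)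
    note um = u_measurable[OF s]
    have c1: "continuous_on UNIV (Ur r s)" "continuous_on UNIV (Vr r s)"
      by (intro continuous_mollify_bump[OF r um J_powr_integrable[OF True]] powr_bounds norm_ge_zero)+
    have c2: "continuous_on UNIV (Wr r s)"
      by (rule continuous_mollify_bump(1)[OF r nonlinearity_measurable[OF um] J_powr_integrable[OF True]])
        (use powr_bounds(1) in \<open>simp add: norm_nonlinearity \<alpha>\<close>)
    show ?thesis unfolding K_def[abs_def] Fr_def by (intro continuous_intros c1 c2)
  qed (simp add: K_def[abs_def])
qed

lemma integrable_square_powr: "s \<in> {0..T} \<Longrightarrow> integrable lborel (\<lambda>x. cmod (u s x) powr (0 + 2))"
  using L2_integrable[OF uL2[of s]] by (simp add: powr_numeral)

text \<open>The pairing with the Laplacian is real by symmetry of the kernels, so the factor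
  \<open>\<i>\<close> removes it from the real part; only the nonlinear term is left.\<close>

lemma pairing_linear:
  assumes r: "0 < r" and s: "s \<in> J"
  shows "integrable lborel (\<lambda>x. cnj (Ur r s x) * Vr r s x)"
    and "integrable lborel (\<lambda>x. cnj (Ur r s x) * Wr r s x)"
    and "Re (LINT x|lborel. K r s x) = - (lam * Im (pairing r s))"
proof -
  have s': "s \<in> {0..T}" using s by (simp add: J_def)
  note um = u_measurable[OF s'] and av = averaging_kernels[OF r]
  show i1: "integrable lborel (\<lambda>x. cnj (Ur r s x) * Vr r s x)"
    by (rule mollify_pairing_integrable[OF um um order_refl integrable_square_powr[OF s'] _ av]) simp
  show i2: "integrable lborel (\<lambda>x. cnj (Ur r s x) * Wr r s x)"
    by (rule mollify_pairing_integrable[OF um nonlinearity_measurable[OF um] \<alpha> J_powr_integrable[OF s] _ av(1) av(1)])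
      (simp add: norm_nonlinearity \<alpha>)
  have real: "Im (LINT x|lborel. cnj (Ur r s x) * Vr r s x) = 0"
    by (rule mollify_pairing_real[OF um L2_integrable[OF uL2[OF s']] av]) (simp_all add: bump_even)
  have "(LINT x|lborel. K r s x) = (LINT x|lborel. \<i> * (cnj (Ur r s x) * Vr r s x) + \<i> * complex_of_real lam * (cnj (Ur r s x) * Wr r s x))"
    using s by (intro Bochner_Integration.integral_cong refl) (simp add: K_def Fr_def algebra_simps)
  also have "\<dots> = \<i> * (LINT x|lborel. cnj (Ur r s x) * Vr r s x) + \<i> * complex_of_real lam * pairing r s"
    using i1 i2 by (simp add: pairing_def)
  finally show "Re (LINT x|lborel. K r s x) = - (lam * Im (pairing r s))" using real by simp
qed

text \<open>Allows the exchange of the time and space integrals. The constants \<open>c1\<close> and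
  \<open>c2\<close> depend on \<open>r\<close>, which is harmless while \<open>r\<close> is fixed;
  the bound on the L^2 norms handles the Laplacian term and \<open>G\<close> the nonlinear
  one.\<close>

lemma K_integrable:
  assumes r: "0 < r"
  shows "integrable (lborel \<Otimes>\<^sub>M lborel) (case_prod (K r))"
proof (rule integrableI_bounded[OF K_measurable[OF r]])
  obtain B where B: "\<And>t. t \<in> {0..T} \<Longrightarrow> l2norm (u t) \<le> B" using ub by blast
  note av = averaging_kernels[OF r]
  define c1 where "c1 = (\<integral>\<^sup>+a. ennreal \<bar>bump (r *\<^sub>R (a::'a))\<bar> \<partial>lborel)"
  define c2 where "c2 = (\<integral>\<^sup>+a. ennreal \<bar>r\<^sup>2 * bump_laplacian (r *\<^sub>R (a::'a))\<bar> \<partial>lborel)"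
  have c: "c1 < \<infinity>" "c2 < \<infinity>" 
    using av unfolding averaging_kernel_def integrable_iff_bounded c1_def c2_def real_norm_def by blast+
  have *: "(\<integral>\<^sup>+x. ennreal (norm (K r s x)) \<partial>lborel) \<le> (2 * c1 * c2 * ennreal (B\<^sup>2)) * indicator {0..T} s + (ennreal \<bar>lam\<bar> * (2 * c1 * c1)) * (G s * indicator {0..T} s)" for s
  proof (cases "s \<in> J")
    case True
    then have s: "s \<in> {0..T}" by (simp add: J_def)
    note um = u_measurable[OF s]
    have m: "Ur r s \<in> borel_measurable borel" "Vr r s \<in> borel_measurable borel" "Wr r s \<in> borel_measurable borel"
      using continuous_mollify_bump[OF r um J_powr_integrable[OF True]] continuous_mollify_bump(1)[OF r nonlinearity_measurable[OF um] J_powr_integrable[OF True]]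
        powr_bounds by (auto intro!: borel_measurable_continuous_onI simp: norm_nonlinearity \<alpha>)
    note [measurable] = m
    have "(\<integral>\<^sup>+x. ennreal (norm (K r s x)) \<partial>lborel)
      \<le> (\<integral>\<^sup>+x. ennreal (cmod (Ur r s x) * cmod (Vr r s x)) + ennreal \<bar>lam\<bar> * ennreal (cmod (Ur r s x) * cmod (Wr r s x)) \<partial>lborel)"
    proof (rule nn_integral_mono)
      fix x
      have "norm (K r s x) \<le> cmod (Ur r s x) * (cmod (Vr r s x) + \<bar>lam\<bar> * cmod (Wr r s x))"
        using True norm_triangle_ineq[of "Vr r s x" "complex_of_real lam * Wr r s x"]
        by (simp add: K_def Fr_def norm_mult mult_left_mono)
      then have "norm (K r s x) \<le> cmod (Ur r s x) * cmod (Vr r s x) + \<bar>lam\<bar> * (cmod (Ur r s x) * cmod (Wr r s x))"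
        by (simp add: algebra_simps)
      then show "ennreal (norm (K r s x)) \<le> ennreal (cmod (Ur r s x) * cmod (Vr r s x)) + ennreal \<bar>lam\<bar> * ennreal (cmod (Ur r s x) * cmod (Wr r s x))"
        by (simp add: ennreal_leI flip: ennreal_mult ennreal_plus)
    qed
    also have "\<dots> = (\<integral>\<^sup>+x. ennreal (cmod (Ur r s x) * cmod (Vr r s x)) \<partial>lborel) + ennreal \<bar>lam\<bar> * (\<integral>\<^sup>+x. ennreal (cmod (Ur r s x) * cmod (Wr r s x)) \<partial>lborel)"
      by (subst nn_integral_add) (simp_all add: nn_integral_cmult)
    also have "\<dots> \<le> 2 * c1 * c2 * ennreal (B\<^sup>2) + ennreal \<bar>lam\<bar> * (2 * c1 * c1 * G s)"
    proof (intro add_mono mult_left_mono)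
      have "(\<integral>\<^sup>+x. ennreal (cmod (Ur r s x) * cmod (Vr r s x)) \<partial>lborel) \<le> 2 * c1 * c2 * (\<integral>\<^sup>+x. ennreal (cmod (u s x) powr (0 + 2)) \<partial>lborel)"
        unfolding c1_def c2_def by (rule mollify_pairing_bound[OF um um order_refl integrable_square_powr[OF s] _ av]) simp
      also have "(\<integral>\<^sup>+x. ennreal (cmod (u s x) powr (0 + 2)) \<partial>lborel) = ennreal ((l2norm (u s))\<^sup>2)"
        using nn_integral_sq[OF L2_integrable[OF uL2[OF s]]] by (simp add: powr_numeral)
      also have "2 * c1 * c2 * \<dots> \<le> 2 * c1 * c2 * ennreal (B\<^sup>2)"
        using B[OF s] by (intro mult_left_mono ennreal_leI power_mono) auto
      finally show "(\<integral>\<^sup>+x. ennreal (cmod (Ur r s x) * cmod (Vr r s x)) \<partial>lborel) \<le> 2 * c1 * c2 * ennreal (B\<^sup>2)" .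
      have "(\<integral>\<^sup>+x. ennreal (cmod (Ur r s x) * cmod (Wr r s x)) \<partial>lborel) \<le> 2 * c1 * c1 * (\<integral>\<^sup>+x. ennreal (cmod (u s x) powr (\<alpha> + 2)) \<partial>lborel)"
        unfolding c1_def by (rule mollify_pairing_bound[OF um nonlinearity_measurable[OF um] \<alpha> J_powr_integrable[OF True] _ av(1) av(1)])
          (simp add: norm_nonlinearity \<alpha>)
      also have "\<dots> \<le> 2 * c1 * c1 * G s" by (intro mult_left_mono uG s) simp
      finally show "(\<integral>\<^sup>+x. ennreal (cmod (Ur r s x) * cmod (Wr r s x)) \<partial>lborel) \<le> 2 * c1 * c1 * G s" .
    qed simp
    finally show ?thesis using s by (simp add: mult.assoc)
  qed (simp add: K_def)
  have "(\<integral>\<^sup>+p. ennreal (norm (case_prod (K r) p)) \<partial>(lborel \<Otimes>\<^sub>M lborel)) = (\<integral>\<^sup>+s. \<integral>\<^sup>+x. ennreal (norm (K r s x)) \<partial>lborel \<partial>lborel)"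
    using K_measurable[OF r] by (subst lborel.nn_integral_fst[symmetric]) simp_all
  also have "\<dots> \<le> (\<integral>\<^sup>+s. (2 * c1 * c2 * ennreal (B\<^sup>2)) * indicator {0..T} s + (ennreal \<bar>lam\<bar> * (2 * c1 * c1)) * (G s * indicator {0..T} s) \<partial>lborel)"
    by (intro nn_integral_mono *)
  also have "\<dots> = (2 * c1 * c2 * ennreal (B\<^sup>2)) * ennreal T + (ennreal \<bar>lam\<bar> * (2 * c1 * c1)) * (\<integral>\<^sup>+s\<in>{0..T}. G s \<partial>lborel)"
    using T by (subst nn_integral_add) (simp_all add: nn_integral_cmult)
  also have "\<dots> < \<infinity>" using c Gi by (simp add: ennreal_mult_less_top)
  finally show "(\<integral>\<^sup>+p. ennreal (norm (case_prod (K r) p)) \<partial>(lborel \<Otimes>\<^sub>M lborel)) < \<infinity>" .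
qed

text \<open>Writing the second factor as a mollified \<open>nonlinearity 0\<close> puts the mass
  into the form of \<open>mollify_limit\<close>.\<close>

lemma mass_integrable:
  assumes r: "0 < r" and t: "t \<in> {0..T}"
  shows "integrable lborel (\<lambda>x. (cmod (Ur r t x))\<^sup>2)"
    and "complex_of_real (mass r t) = (LINT x|lborel. cnj (Ur r t x) * mollify (\<lambda>a. bump (r *\<^sub>R a)) (nonlinearity 0 (u t)) x)"
proof -
  note um = u_measurable[OF t] and av = averaging_kernels(1)[OF r]
  have i: "integrable lborel (\<lambda>x. cnj (Ur r t x) * Ur r t x)"
    by (rule mollify_pairing_integrable[OF um um order_refl integrable_square_powr[OF t] _ av av]) simp
  have eq: "cnj (Ur r t x) * Ur r t x = complex_of_real ((cmod (Ur r t x))\<^sup>2)" for x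
    by (simp only: complex_norm_square mult.commute)
  show "integrable lborel (\<lambda>x. (cmod (Ur r t x))\<^sup>2)"
    using i unfolding eq complex_of_real_integrable_eq .
  show "complex_of_real (mass r t) = (LINT x|lborel. cnj (Ur r t x) * mollify (\<lambda>a. bump (r *\<^sub>R a)) (nonlinearity 0 (u t)) x)"
    unfolding nonlinearity_zero eq mass_def integral_complex_of_real ..
qed

lemma mass_balance:
  assumes r: "0 < r"
  shows "(\<lambda>s. indicat_real J s * Im (pairing r s)) \<in> borel_measurable borel"
    and "mass r T - mass r 0 = - 2 * lam * (LINT s|lborel. indicat_real J s * Im (pairing r s))"
proof -
  note Ki = K_integrable[OF r]
  have Re: "Re (LINT x|lborel. K r s x) = - lam * (indicat_real J s * Im (pairing r s))" for s
    using pairing_linear(3)[OF r, of s] by (cases "s \<in> J") (simp_all add: K_def)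
  \<comment> \<open>Measurability of the pairing in time is read off from the marginal of an
    integrable function; division by \<open>lam\<close> isolates it.\<close>
  have "(\<lambda>s. (- 1 / lam) * Re (LINT x|lborel. K r s x)) \<in> borel_measurable lborel"
    using lborel_pair.integrable_fst[OF Ki] by (intro borel_measurable_times borel_measurable_const borel_measurable_Re) auto
  then show "(\<lambda>s. indicat_real J s * Im (pairing r s)) \<in> borel_measurable borel"
    unfolding Re using lam by simp
  have TT: "T \<in> {0..T}" "0 \<in> {0..T}" using T by simp_all
  have "mass r T - mass r 0 = (LINT x|lborel. (cmod (Ur r T x))\<^sup>2 - (cmod (Ur r 0 x))\<^sup>2)"
    unfolding mass_def using mass_integrable(1)[OF r TT(1)] mass_integrable(1)[OF r TT(2)] by simp
  also have "\<dots> = 2 * (LINT x|lborel. Re (LINT s|lborel. K r s x))"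
    unfolding mass_pointwise(1)[OF r] by simp
  also have "(LINT x|lborel. Re (LINT s|lborel. K r s x)) = Re (LINT x|lborel. LINT s|lborel. K r s x)"
    by (rule integral_Re[OF lborel_pair.integrable_snd[OF Ki]])
  also have "\<dots> = Re (LINT s|lborel. LINT x|lborel. K r s x)"
    by (subst lborel_pair.Fubini_integral[OF Ki]) simp
  also have "\<dots> = (LINT s|lborel. Re (LINT x|lborel. K r s x))"
    by (rule integral_Re[OF lborel_pair.integrable_fst[OF Ki], symmetric])
  also have "\<dots> = - lam * (LINT s|lborel. indicat_real J s * Im (pairing r s))"
    unfolding Re by simp
  finally show "mass r T - mass r 0 = - 2 * lam * (LINT s|lborel. indicat_real J s * Im (pairing r s))" by simp
qed

section \<open>Removing the mollification\<close>

lemma mass_scaled_tendsto: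
  assumes t: "t \<in> {0..T}"
  shows "(\<lambda>n. real (Suc n) ^ (2 * DIM('a)) * mass (real (Suc n)) t) \<longlonglongrightarrow> (LINT a::'a|lborel. bump a)\<^sup>2 * (l2norm (u t))\<^sup>2"
proof -
  have "(\<lambda>n. complex_of_real (real (Suc n) ^ (2 * DIM('a)) * mass (real (Suc n)) t)) \<longlonglongrightarrow> complex_of_real ((LINT a::'a|lborel. bump a)\<^sup>2 * (LINT x|lborel. cmod (u t x) powr (0 + 2)))"
    using mollify_limit[OF u_measurable[OF t] order_refl integrable_square_powr[OF t] averaging_kernel_bump(1)]
    by (simp only: of_real_mult[of "real (Suc _) ^ _"] mass_integrable(2)[OF of_nat_0_less_iff[THEN iffD2, OF zero_less_Suc] t])
  then show ?thesis unfolding tendsto_of_real_iff l2norm_sq by (simp add: powr_numeral)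
qed

text \<open>The limit of the rescaled pairing is a multiple of the integral of
  \<open>|u|^(\<alpha> + 2)\<close>, a real number.\<close>

lemma pairing_scaled_tendsto:
  assumes s: "s \<in> J"
  shows "(\<lambda>n. real (Suc n) ^ (2 * DIM('a)) * Im (pairing (real (Suc n)) s)) \<longlonglongrightarrow> 0"
proof -
  have "s \<in> {0..T}" using s by (simp add: J_def)
  note tendsto_Im[OF mollify_limit[OF u_measurable[OF this] \<alpha> J_powr_integrable[OF s] averaging_kernel_bump(1)]]
  then show ?thesis unfolding pairing_def[symmetric] Im_complex_of_real
    by (simp only: Re_complex_of_real Im_complex_of_real complex.sel times_complex.sel mult_zero_left add_0_right)
qed

text \<open>The power of \<open>r\<close> cancels against the two kernel masses (\<open>bc\<close>),
  so the bound is uniform in \<open>r\<close>.\<close>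

lemma pairing_scaled_bound:
  assumes s: "s \<in> J" and r: "0 < r"
  shows "r ^ (2 * DIM('a)) * \<bar>Im (pairing r s)\<bar> \<le> enn2real (2 * (\<integral>\<^sup>+a. ennreal \<bar>bump (a::'a)\<bar> \<partial>lborel)\<^sup>2 * G s)"
proof -
  have s': "s \<in> {0..T}" using s by (simp add: J_def)
  note um = u_measurable[OF s'] and av = averaging_kernels(1)[OF r]
  define b where "b = (\<integral>\<^sup>+a. ennreal \<bar>bump (a::'a)\<bar> \<partial>lborel)"
  define c where "c = (\<integral>\<^sup>+a. ennreal \<bar>bump (r *\<^sub>R (a::'a))\<bar> \<partial>lborel)"
  have bm[measurable]: "(bump :: 'a \<Rightarrow> real) \<in> borel_measurable borel" and bf: "b < \<infinity>"
    using averaging_kernel_bump(1)[where ?'a='a] unfolding averaging_kernel_def integrable_iff_bounded b_def real_norm_def by simp_all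
  have bc: "b = ennreal (r ^ DIM('a)) * c"
    unfolding b_def c_def using nn_integral_lborel_affine[of "\<lambda>a::'a. ennreal \<bar>bump a\<bar>" r 0] r by simp
  have "ennreal (cmod (pairing r s)) \<le> (\<integral>\<^sup>+x. ennreal (norm (cnj (Ur r s x) * Wr r s x)) \<partial>lborel)"
    unfolding pairing_def by (rule integral_norm_bound_ennreal[OF pairing_linear(2)[OF r s]])
  also have "\<dots> \<le> 2 * c * c * (\<integral>\<^sup>+x. ennreal (cmod (u s x) powr (\<alpha> + 2)) \<partial>lborel)"
    unfolding c_def norm_mult complex_mod_cnj
    by (rule mollify_pairing_bound[OF um nonlinearity_measurable[OF um] \<alpha> J_powr_integrable[OF s] _ av av])
      (simp add: norm_nonlinearity \<alpha>)
  also have "\<dots> \<le> 2 * c * c * G s" by (intro mult_left_mono uG s') simp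
  finally have "ennreal (r ^ (2 * DIM('a))) * ennreal (cmod (pairing r s)) \<le> ennreal (r ^ (2 * DIM('a))) * (2 * c * c * G s)"
    by (intro mult_left_mono) simp_all
  also have "\<dots> = 2 * b\<^sup>2 * G s"
  proof -
    have rr: "ennreal (r ^ (2 * DIM('a))) = ennreal (r ^ DIM('a)) * ennreal (r ^ DIM('a))"
      using r by (simp add: ennreal_mult[symmetric] power_add[symmetric] mult_2)
    show ?thesis unfolding bc rr by (simp only: power2_eq_square mult_ac)
  qed
  finally have "ennreal (r ^ (2 * DIM('a)) * cmod (pairing r s)) \<le> 2 * b\<^sup>2 * G s"
    using r by (simp add: ennreal_mult)
  moreover have "2 * b\<^sup>2 * G s < \<infinity>" using bf s by (simp add: ennreal_mult_less_top power2_eq_square J_def)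
  ultimately have "r ^ (2 * DIM('a)) * cmod (pairing r s) \<le> enn2real (2 * b\<^sup>2 * G s)"
    using enn2real_mono[of "ennreal (r ^ (2 * DIM('a)) * cmod (pairing r s))" "2 * b\<^sup>2 * G s"] r by simp
  moreover have "r ^ (2 * DIM('a)) * \<bar>Im (pairing r s)\<bar> \<le> r ^ (2 * DIM('a)) * cmod (pairing r s)"
    using r by (intro mult_left_mono abs_Im_le_cmod) simp
  ultimately show ?thesis unfolding b_def by linarith
qed

text \<open>Dominated convergence in time: at every time in \<open>J\<close> the rescaled imaginary
  part of the pairing tends to 0 under the majorant \<open>2 * b\<^sup>2 * G s\<close>, while the
  rescaled masses tend to a positive multiple of the squared norms.\<close>

lemma mass_conservation: "l2norm (u T) = l2norm (u 0)"
proof -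
  define c where "c = (LINT a::'a|lborel. bump a)\<^sup>2"
  define b where "b = (\<integral>\<^sup>+a. ennreal \<bar>bump (a::'a)\<bar> \<partial>lborel)"
  define e where "e n = real (Suc n) ^ (2 * DIM('a))" for n
  have c: "0 < c" unfolding c_def using bump_integral_pos[where ?'a='a] by simp
  have TT: "T \<in> {0..T}" "0 \<in> {0..T}" using T by simp_all
  have bf: "b < \<infinity>"
    using averaging_kernel_bump(1)[where ?'a='a] unfolding averaging_kernel_def integrable_iff_bounded b_def real_norm_def by simp
  have l1: "(\<lambda>n. e n * (mass (real (Suc n)) T - mass (real (Suc n)) 0)) \<longlonglongrightarrow> c * (l2norm (u T))\<^sup>2 - c * (l2norm (u 0))\<^sup>2"
    unfolding right_diff_distrib e_def c_def by (intro tendsto_diff mass_scaled_tendsto TT)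
  have "(\<lambda>n. LINT s|lborel. e n * (indicat_real J s * Im (pairing (real (Suc n)) s))) \<longlonglongrightarrow> (LINT s::real|lborel. 0)"
  proof (rule integral_dominated_convergence)
    have "(\<integral>\<^sup>+s. ennreal (indicat_real J s * enn2real (2 * b\<^sup>2 * G s)) \<partial>lborel) \<le> (\<integral>\<^sup>+s. (2 * b\<^sup>2) * (G s * indicator {0..T} s) \<partial>lborel)"
    proof (rule nn_integral_mono)
      fix s
      show "ennreal (indicat_real J s * enn2real (2 * b\<^sup>2 * G s)) \<le> (2 * b\<^sup>2) * (G s * indicator {0..T} s)"
      proof (cases "s \<in> J")
        case True
        then have "2 * b\<^sup>2 * G s < top" using bf by (simp add: ennreal_mult_less_top power2_eq_square J_def)
        then show ?thesis using True by (auto simp: J_def mult.assoc)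
      qed simp
    qed
    also have "\<dots> = (2 * b\<^sup>2) * (\<integral>\<^sup>+s\<in>{0..T}. G s \<partial>lborel)" by (rule nn_integral_cmult) simp
    also have "\<dots> < \<infinity>" using bf Gi by (simp add: ennreal_mult_less_top power2_eq_square)
    finally show "integrable lborel (\<lambda>s. indicat_real J s * enn2real (2 * b\<^sup>2 * G s))"
      by (intro integrableI_nonneg) simp_all
    show "AE s in lborel. norm (e n * (indicat_real J s * Im (pairing (real (Suc n)) s))) \<le> indicat_real J s * enn2real (2 * b\<^sup>2 * G s)" for n
    proof (rule AE_I2)
      fix s
      show "norm (e n * (indicat_real J s * Im (pairing (real (Suc n)) s))) \<le> indicat_real J s * enn2real (2 * b\<^sup>2 * G s)"
        using pairing_scaled_bound[of s "real (Suc n)"] unfolding e_def b_def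
        by (cases "s \<in> J") (simp_all add: abs_mult del: of_nat_Suc)
    qed
    show "AE s in lborel. (\<lambda>n. e n * (indicat_real J s * Im (pairing (real (Suc n)) s))) \<longlonglongrightarrow> 0"
    proof (rule AE_I2)
      fix s
      show "(\<lambda>n. e n * (indicat_real J s * Im (pairing (real (Suc n)) s))) \<longlonglongrightarrow> 0"
        using pairing_scaled_tendsto[of s] unfolding e_def by (cases "s \<in> J") simp_all
    qed
    show "(\<lambda>s. e n * (indicat_real J s * Im (pairing (real (Suc n)) s))) \<in> borel_measurable lborel" for n
      using borel_measurable_times[OF borel_measurable_const mass_balance(1)[of "real (Suc n)"]] by simp
  qed simp
  then have "(\<lambda>n. (- 2 * lam) * (LINT s|lborel. e n * (indicat_real J s * Im (pairing (real (Suc n)) s)))) \<longlonglongrightarrow> (- 2 * lam) * (LINT s::real|lborel. 0)"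
    by (rule tendsto_mult_left)
  moreover have "(- 2 * lam) * (LINT s|lborel. e n * (indicat_real J s * Im (pairing (real (Suc n)) s))) = e n * (mass (real (Suc n)) T - mass (real (Suc n)) 0)" for n
    using mass_balance(2)[of "real (Suc n)"] by (simp del: of_nat_Suc)
  ultimately have l2: "(\<lambda>n. e n * (mass (real (Suc n)) T - mass (real (Suc n)) 0)) \<longlonglongrightarrow> 0" by simp
  have "c * (l2norm (u T))\<^sup>2 - c * (l2norm (u 0))\<^sup>2 = 0" by (rule LIMSEQ_unique[OF l1 l2])
  then have "(l2norm (u T))\<^sup>2 = (l2norm (u 0))\<^sup>2" using c by simp
  then show ?thesis by (rule power2_eq_imp_eq) simp_all
qed

end

section \<open>Sobolev embedding\<close>

lemma powr_half_square: "((t::real) powr (z / 2))\<^sup>2 = t powr z"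
  by (simp add: power2_eq_square flip: powr_add)

lemma dyadic_index:
  fixes y :: real
  assumes "1 < y"
  shows "\<exists>k::nat. 2 ^ k < y \<and> y \<le> 2 ^ Suc k"
proof -
  obtain n :: nat where n: "y < 2 ^ n" using real_arch_pow[of 2 y] by auto
  define m where "m = (LEAST n. y \<le> 2 ^ n)"
  have m: "y \<le> 2 ^ m" unfolding m_def by (rule LeastI[of _ n]) (use n in simp)
  have "m \<noteq> 0" using m assms by (intro notI) simp
  then obtain k where k: "m = Suc k" by (cases m) auto
  have "\<not> y \<le> 2 ^ k" using not_less_Least[of k "\<lambda>n. y \<le> 2 ^ n"] k unfolding m_def[symmetric] by simp
  then show ?thesis using m k by (intro exI[of _ k]) auto
qed

text \<open>Dyadic balls in place of polar coordinates. On the shell ending at radius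
  \<open>2 ^ k\<close> the weight is of order \<open>(1 / a) ^ k\<close> with
  \<open>a = 4 powr \<beta>\<close>, and the volume of the ball grows like
  \<open>(2 ^ k) ^ DIM('a)\<close>; the hypothesis puts the ratio \<open>q\<close> of the resulting
  geometric series below 1.\<close>

lemma bessel_weight_integrable:
  assumes "real DIM('a::euclidean_space) < 2 * \<beta>"
  shows "integrable lborel (\<lambda>\<xi>::'a. (1 + (norm \<xi>)\<^sup>2) powr (- \<beta>))"
proof (rule integrableI_nonneg)
  have \<beta>: "0 < \<beta>" using assms DIM_positive[where 'a='a] by simp
  define \<omega> where "\<omega> = unit_ball_vol (real DIM('a))"
  have \<omega>: "0 \<le> \<omega>" by (simp add: \<omega>_def)
  define a where "a = 4 powr \<beta>"
  have ia: "1 / a = 4 powr (- \<beta>)" by (simp add: a_def powr_minus_divide)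
  have [measurable]: "cball (0::'a) r \<in> sets borel" for r by simp
  define q where "q = 2 powr (real DIM('a) - 2 * \<beta>)"
  have q: "0 < q" "q < 1" using assms powr_less_mono[of "real DIM('a) - 2 * \<beta>" 0 2] by (auto simp: q_def)
  have bound: "ennreal ((1 + (norm \<xi>)\<^sup>2) powr (- \<beta>)) \<le> (\<Sum>k. ennreal (a * (1 / a) ^ k) * indicator (cball 0 (2 ^ k)) \<xi>)" for \<xi> :: 'a
  proof -
    have "\<exists>k::nat. norm \<xi> \<le> 2 ^ k \<and> (1 + (norm \<xi>)\<^sup>2) powr (- \<beta>) \<le> a * (1 / a) ^ k"
    proof (cases "norm \<xi> \<le> 1")
      case True
      have "(1 + (norm \<xi>)\<^sup>2) powr (- \<beta>) \<le> 1 powr (- \<beta>)" using \<beta> by (intro powr_mono2') auto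
      also have "\<dots> \<le> a" using \<beta> by (simp add: a_def ge_one_powr_ge_zero)
      finally show ?thesis using True by (intro exI[of _ 0]) simp
    next
      case False
      then obtain k where k: "2 ^ k < norm \<xi>" "norm \<xi> \<le> 2 ^ Suc k" using dyadic_index[of "norm \<xi>"] by auto
      have "(2 ^ k)\<^sup>2 \<le> (norm \<xi>)\<^sup>2" using k by (intro power_mono) auto
      then have "(4::real) ^ k \<le> 1 + (norm \<xi>)\<^sup>2" by (simp add: power2_eq_square flip: power_mult_distrib)
      then have "(1 + (norm \<xi>)\<^sup>2) powr (- \<beta>) \<le> (4 ^ k) powr (- \<beta>)" using \<beta> by (intro powr_mono2') auto
      also have "\<dots> = (1 / a) ^ k"
        unfolding ia by (simp add: powr_realpow[symmetric] powr_powr mult.commute)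
      \<comment> \<open>The extra factor \<open>a\<close> in the series pays for using the ball of
        index \<open>Suc k\<close>, which contains the point, while the weight is estimated at the
        inner radius of index \<open>k\<close>.\<close>
      also have "\<dots> = a * (1 / a) ^ Suc k" by (simp add: a_def)
      finally show ?thesis using k(2) by (intro exI[of _ "Suc k"]) simp
    qed
    then obtain k where k: "norm \<xi> \<le> 2 ^ k" "(1 + (norm \<xi>)\<^sup>2) powr (- \<beta>) \<le> a * (1 / a) ^ k" by blast
    have "ennreal ((1 + (norm \<xi>)\<^sup>2) powr (- \<beta>)) \<le> ennreal (a * (1 / a) ^ k) * indicator (cball 0 (2 ^ k)) \<xi>"
      using k by (simp add: ennreal_leI)
    also have "\<dots> \<le> (\<Sum>k. ennreal (a * (1 / a) ^ k) * indicator (cball 0 (2 ^ k)) \<xi>)"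
    proof -
      define F where "F k = ennreal (a * (1 / a) ^ k) * indicator (cball 0 (2 ^ k)) \<xi>" for k :: nat
      have "F k \<le> suminf F" using sum_le_suminf[of F "{k}"] by simp
      then show ?thesis by (simp only: F_def[abs_def])
    qed
    finally show ?thesis .
  qed
  have "(\<integral>\<^sup>+\<xi>. ennreal ((1 + (norm (\<xi>::'a))\<^sup>2) powr (- \<beta>)) \<partial>lborel)
    \<le> (\<integral>\<^sup>+\<xi>. (\<Sum>k. ennreal (a * (1 / a) ^ k) * indicator (cball (0::'a) (2 ^ k)) \<xi>) \<partial>lborel)"
    by (intro nn_integral_mono bound)
  also have "\<dots> = (\<Sum>k. \<integral>\<^sup>+\<xi>. ennreal (a * (1 / a) ^ k) * indicator (cball (0::'a) (2 ^ k)) \<xi> \<partial>lborel)"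
    by (rule nn_integral_suminf) simp
  also have "\<dots> = (\<Sum>k. ennreal (a * \<omega> * q ^ k))"
  proof (intro arg_cong[where f=suminf] ext)
    fix k :: nat
    have e: "(1 / a) ^ k * (2 ^ k) ^ DIM('a) = q ^ k"
    proof -
      have "4 powr (- \<beta>) = (2 powr 2) powr (- \<beta>)" by simp
      also have "\<dots> = 2 powr (- (2 * \<beta>))" by (simp only: powr_powr mult_minus_right)
      finally have "q = (1 / a) * 2 ^ DIM('a)"
        unfolding ia q_def by (simp add: powr_realpow[symmetric] powr_add[symmetric])
      then show ?thesis by (simp only: power_mult_distrib power_mult[symmetric] mult.commute)
    qed
    have "(\<integral>\<^sup>+\<xi>. ennreal (a * (1 / a) ^ k) * indicator (cball (0::'a) (2 ^ k)) \<xi> \<partial>lborel) = ennreal (a * (1 / a) ^ k) * ennreal (\<omega> * (2 ^ k) ^ DIM('a))"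
      by (subst nn_integral_cmult_indicator) (simp_all add: emeasure_cball \<omega>_def)
    also have "\<dots> = ennreal (a * \<omega> * ((1 / a) ^ k * (2 ^ k) ^ DIM('a)))"
      using \<omega> by (subst ennreal_mult[symmetric]) (simp_all add: a_def mult_ac)
    finally show "(\<integral>\<^sup>+\<xi>. ennreal (a * (1 / a) ^ k) * indicator (cball (0::'a) (2 ^ k)) \<xi> \<partial>lborel) = ennreal (a * \<omega> * q ^ k)"
      unfolding e .
  qed
  also have "\<dots> = ennreal (\<Sum>k. a * \<omega> * q ^ k)"
    using \<omega> q by (intro suminf_ennreal2 summable_mult summable_geometric) (auto simp: a_def)
  also have "\<dots> < \<infinity>" by simp
  finally show "(\<integral>\<^sup>+\<xi>. ennreal ((1 + (norm (\<xi>::'a))\<^sup>2) powr (- \<beta>)) \<partial>lborel) < \<infinity>" .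
qed simp_all

text \<open>The transform of \<open>(1 - \<Delta>)^(m / 2) f\<close>; its \<open>l2norm\<close> is
  the Sobolev norm as a real number.\<close>

definition bessel :: "nat \<Rightarrow> ('a::euclidean_space \<Rightarrow> complex) \<Rightarrow> 'a \<Rightarrow> complex" where
  "bessel m f \<xi> = complex_of_real (sqrt (1 + (norm \<xi>)\<^sup>2) ^ m) * fourier_L2 f \<xi>"

lemma sobolev_bessel:
  assumes "f \<in> sobolev m"
  shows "f \<in> L2" "bessel m f \<in> L2" "sobolev_norm m f = ennreal (l2norm (bessel m f))"
proof -
  show f: "f \<in> L2" using assms by (simp add: sobolev_def)
  have [measurable]: "fourier_L2 f \<in> borel_measurable borel" by (intro L2_measurable fourier_L2_spec f)
  have m: "bessel m f \<in> borel_measurable borel" unfolding bessel_def[abs_def] by measurable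
  have n: "sobolev_norm m f = Lp_norm 2 (bessel m f)"
    using f by (simp add: sobolev_norm_def bessel_def[abs_def])
  then show b: "bessel m f \<in> L2" using assms m by (simp add: L2_def sobolev_def)
  show "sobolev_norm m f = ennreal (l2norm (bessel m f))" unfolding n by (rule Lp_norm_2_L2[OF b])
qed

lemma bessel_diff:
  assumes "f \<in> L2" "g \<in> L2"
  shows "AE \<xi> in lborel. bessel m (\<lambda>x. f x - g x) \<xi> = bessel m f \<xi> - bessel m g \<xi>"
  using fourier_L2_diff[OF assms] by eventually_elim (simp add: bessel_def right_diff_distrib)

lemma l2norm_le_bessel:
  assumes "f \<in> sobolev m" shows "l2norm f \<le> l2norm (bessel m f)"
proof -
  have "l2norm (fourier_L2 f) \<le> l2norm (bessel m f)"
  proof (rule L2_dominated(2)[OF L2_measurable[OF fourier_L2_spec(1)[OF sobolev_bessel(1)[OF assms]]] sobolev_bessel(2)[OF assms]])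
    fix \<xi> :: 'a
    have "1 \<le> sqrt (1 + (norm \<xi>)\<^sup>2) ^ m" by (intro one_le_power) simp
    then have "1 * cmod (fourier_L2 f \<xi>) \<le> sqrt (1 + (norm \<xi>)\<^sup>2) ^ m * cmod (fourier_L2 f \<xi>)"
      by (intro mult_right_mono) auto
    then show "cmod (fourier_L2 f \<xi>) \<le> cmod (bessel m f \<xi>)" by (simp add: bessel_def norm_mult norm_power)
  qed
  then show ?thesis by (simp add: l2norm_fourier_L2 sobolev_bessel(1)[OF assms])
qed

text \<open>The reverse triangle inequality makes the norm a continuous function of time, hence
  bounded on a compact interval.\<close>

lemma sobolev_norm_bounded_on_compact:
  assumes c: "continuous_into_sobolev m I u" and I: "{0..T} \<subseteq> I"
  shows "\<exists>H. \<forall>t\<in>{0..T}. l2norm (bessel m (u t)) \<le> H"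
proof -
  have S: "u t \<in> sobolev m" if "t \<in> I" for t using c that by (simp add: continuous_into_sobolev_def)
  have "continuous_on {0..T} (\<lambda>t. l2norm (bessel m (u t)))"
  proof (rule continuous_on_subset[OF _ I], unfold continuous_on_def, rule ballI)
    fix t assume t: "t \<in> I"
    have lim: "((\<lambda>s. sobolev_norm m (\<lambda>x. u s x - u t x)) \<longlongrightarrow> 0) (at t within I)"
      using c t by (simp add: continuous_into_sobolev_def)
    have "\<forall>\<^sub>F s in at t within I. sobolev_norm m (\<lambda>x. u s x - u t x) < 1"
      using order_tendstoD(2)[OF lim] by simp
    moreover have "\<forall>\<^sub>F s in at t within I. s \<in> I" by (simp add: eventually_at_filter)
    ultimately have ev: "\<forall>\<^sub>F s in at t within I. \<bar>l2norm (bessel m (u s)) - l2norm (bessel m (u t))\<bar> \<le> enn2real (sobolev_norm m (\<lambda>x. u s x - u t x))"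
    proof eventually_elim
      case (elim s)
      note us = S[OF elim(2)] and ut = S[OF t]
      \<comment> \<open>The norm of the difference is finite for \<open>s\<close> close to
        \<open>t\<close>, which puts the difference into the space.\<close>
      have D: "(\<lambda>x. u s x - u t x) \<in> sobolev m"
        using elim(1) by (simp add: sobolev_def L2_diff sobolev_bessel(1)[OF us] sobolev_bessel(1)[OF ut] less_trans[OF _ ennreal_one_less_top])
      have "l2norm (bessel m (\<lambda>x. u s x - u t x)) = l2norm (\<lambda>\<xi>. bessel m (u s) \<xi> - bessel m (u t) \<xi>)"
        by (rule l2norm_cong_AE[OF L2_measurable[OF sobolev_bessel(2)[OF D]]
            L2_measurable[OF L2_diff[OF sobolev_bessel(2)[OF us] sobolev_bessel(2)[OF ut]]]
            bessel_diff[OF sobolev_bessel(1)[OF us] sobolev_bessel(1)[OF ut]]])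
      then show ?case
        using l2norm_diff_le[OF sobolev_bessel(2)[OF us] sobolev_bessel(2)[OF ut]] by (simp add: sobolev_bessel(3)[OF D])
    qed
    have "((\<lambda>s. enn2real (sobolev_norm m (\<lambda>x. u s x - u t x))) \<longlongrightarrow> enn2real 0) (at t within I)"
      using lim tendsto_enn2real[of "\<lambda>s. sobolev_norm m (\<lambda>x. u s x - u t x)" 0 "at t within I"] by simp
    then have "((\<lambda>s. enn2real (sobolev_norm m (\<lambda>x. u s x - u t x))) \<longlongrightarrow> 0) (at t within I)" by simp
    then show "((\<lambda>t. l2norm (bessel m (u t))) \<longlongrightarrow> l2norm (bessel m (u t))) (at t within I)"
      by (rule Lim_null_comparison[THEN LIM_zero_cancel, rotated]) (use ev in simp)
  qed
  then have "compact ((\<lambda>t. l2norm (bessel m (u t))) ` {0..T})" by (rule compact_continuous_image) simp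
  then have "bounded ((\<lambda>t. l2norm (bessel m (u t))) ` {0..T})" by (rule compact_imp_bounded)
  then show ?thesis unfolding bounded_iff by (auto simp: abs_le_iff)
qed

text \<open>Tested against the phase of \<open>f\<close> on a piece of the level set, Parseval's identity only needs the low
  frequencies of \<open>f\<close> in \<open>L\<^sup>1\<close> and the high ones in \<open>L\<^sup>2\<close>; no Fourier inversion is involved. The
  splitting frequency is chosen to absorb the first contribution.\<close>

lemma level_set_bound:
  fixes f :: "'a::euclidean_space \<Rightarrow> complex"
  assumes f: "f \<in> sobolev 1" and H: "l2norm (bessel 1 f) \<le> H" "0 < H"
    and \<gamma>: "0 < \<gamma>" "real DIM('a) < 2 * (1 + \<gamma>)" and s: "0 < s"
    and M: "M\<^sup>2 = (LINT \<xi>::'a|lborel. (1 + (norm \<xi>)\<^sup>2) powr (- (1 + \<gamma>)))" "0 < M"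
  shows "emeasure lborel {x. s < cmod (f x)} \<le> ennreal (4 * H\<^sup>2 * (2 * H * M) powr (2 / \<gamma>) * s powr (- (2 + 2 / \<gamma>)))"
proof -
  note fL = sobolev_bessel(1)[OF f] and bL = sobolev_bessel(2)[OF f]
  have [measurable]: "f \<in> borel_measurable borel" "fourier_L2 f \<in> borel_measurable borel"
    by (intro L2_measurable fL fourier_L2_spec)+
  \<comment> \<open>Frequencies with \<open>1 + |\<xi>|\<^sup>2 \<le> b\<close> count as low. This
    value makes \<open>H * M * b powr (\<gamma> / 2)\<close> equal to \<open>s / 2\<close>, so that
    the low part contributes at most half of the left side \<open>s * e\<close>.\<close>
  define b where "b = (s / (2 * H * M)) powr (2 / \<gamma>)"
  have b: "0 < b" using s H M by (simp add: b_def)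
  define C where "C = 4 * H\<^sup>2 / (s\<^sup>2 * b)"
  have bound: "measure lborel {x. s < cmod (f x) \<and> norm x \<le> real n} \<le> C" for n
  proof -
    \<comment> \<open>Intersecting with a ball keeps the measure \<open>e\<close> finite, so that it
      can be absorbed; the radius goes to infinity at the end.\<close>
    define E where "E = {x. s < cmod (f x) \<and> norm x \<le> real n}"
    have [measurable]: "E \<in> sets borel" unfolding E_def by measurable
    have "emeasure lborel E \<le> emeasure lborel (cball (0::'a) (real n))"
      by (rule emeasure_mono) (auto simp: E_def)
    also have "\<dots> < \<infinity>" by (rule emeasure_lborel_cball_finite)
    finally have Ef: "emeasure lborel E < \<infinity>" .
    define e where "e = measure lborel E"
    have e0: "0 \<le> e" by (simp add: e_def)
    \<comment> \<open>The phase of \<open>f\<close> on \<open>E\<close>: the pairing with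
      \<open>f\<close> becomes the integral of \<open>|f|\<close> over \<open>E\<close>, which is at
      least \<open>s * e\<close>.\<close>
    define g where "g x = indicator E x * (f x / complex_of_real (cmod (f x)))" for x
    have gm[measurable]: "g \<in> borel_measurable borel" unfolding g_def[abs_def] by measurable
    have gc: "cmod (g x) = indicat_real E x" for x
      using s by (auto simp: g_def indicator_def E_def norm_divide)
    have g1: "integrable lborel g"
      by (rule Bochner_Integration.integrable_bound[of _ "indicat_real E"]) (use Ef in \<open>auto simp: gc\<close>)
    have sq: "(indicat_real E x)\<^sup>2 = indicat_real E x" for x by (simp add: indicator_def)
    have gL: "g \<in> L2" using Ef by (simp add: L2_iff gc sq)
    have gn: "l2norm g = sqrt e" by (simp add: l2norm_def gc sq e_def)
    \<comment> \<open>The transform is bounded by the L^1 norm of \<open>g\<close>, which is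
      \<open>e\<close>, the normalising constant being at most 1.\<close>
    have Fg: "AE \<xi> in lborel. cmod (fourier_L2 g \<xi>) \<le> e"
      using fourier_L2_integrable[OF gL g1]
    proof eventually_elim
      case (elim \<xi>)
      have c1: "(2 * pi) powr (- real DIM('a) / 2) \<le> 1"
        using powr_mono[of "- real DIM('a) / 2" 0 "2 * pi"] pi_gt3 by simp
      have "cmod (LINT x|lborel. cis (- (x \<bullet> \<xi>)) * g x) \<le> (LINT x|lborel. cmod (cis (- (x \<bullet> \<xi>)) * g x))"
        by (rule integral_norm_bound)
      also have "\<dots> = e" by (simp add: norm_mult gc e_def)
      finally have "(2 * pi) powr (- real DIM('a) / 2) * cmod (LINT x|lborel. cis (- (x \<bullet> \<xi>)) * g x) \<le> 1 * e"
        using c1 by (intro mult_mono) auto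
      then show ?case unfolding elim by (simp add: fourier_integral_def norm_mult)
    qed
    define p where "p \<xi> = 1 + (norm \<xi>)\<^sup>2" for \<xi> :: 'a
    have p: "1 \<le> p \<xi>" for \<xi> by (simp add: p_def)
    have pm[measurable]: "p \<in> borel_measurable borel" unfolding p_def[abs_def] by measurable
    \<comment> \<open>On low frequencies \<open>|bessel 1 f| * |l|\<close> dominates
      \<open>|fourier_L2 f|\<close>, and \<open>l\<close> is square integrable because
      \<open>2 * (1 + \<gamma>)\<close> exceeds the dimension.\<close>
    define l where "l \<xi> = complex_of_real (b powr (\<gamma> / 2) * p \<xi> powr (- (1 + \<gamma>) / 2))" for \<xi>
    have lsq: "(cmod (l \<xi>))\<^sup>2 = b powr \<gamma> * p \<xi> powr (- (1 + \<gamma>))" for \<xi>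
      by (simp only: l_def norm_of_real power2_abs power_mult_distrib powr_half_square)
    have lm[measurable]: "l \<in> borel_measurable borel" unfolding l_def[abs_def] by measurable
    have lL: "l \<in> L2" using bessel_weight_integrable[OF \<gamma>(2)] by (simp add: L2_iff lsq p_def)
    have ln: "l2norm l = b powr (\<gamma> / 2) * M"
    proof -
      have "(l2norm l)\<^sup>2 = (b powr (\<gamma> / 2) * M)\<^sup>2"
        unfolding l2norm_sq lsq p_def power_mult_distrib powr_half_square M(1) by simp
      then show ?thesis by (rule power2_eq_imp_eq) (use M in simp_all)
    qed
    note CS1 = L2_Cauchy_Schwarz[OF bL lL] and CS2 = L2_Cauchy_Schwarz[OF bL fourier_L2_spec(1)[OF gL]]
    have "s * e = (LINT x|lborel. s * indicat_real E x)" by (simp add: e_def)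
    also have "\<dots> \<le> (LINT x|lborel. Re (f x * cnj (g x)))"
    proof (rule integral_mono)
      show "integrable lborel (\<lambda>x. s * indicat_real E x)" using Ef by simp
      show "integrable lborel (\<lambda>x. Re (f x * cnj (g x)))"
        by (rule integrable_Re[OF l2norm_add_sq(2)[OF fL gL]])
      fix x
      show "s * indicat_real E x \<le> Re (f x * cnj (g x))"
      proof (cases "x \<in> E")
        case True
        then have fx: "s < cmod (f x)" by (simp add: E_def)
        have "f x * cnj (g x) = (f x * cnj (f x)) / complex_of_real (cmod (f x))" using True by (simp add: g_def)
        also have "\<dots> = complex_of_real (cmod (f x))"
          unfolding complex_norm_square[symmetric] using fx s by (simp add: power2_eq_square)
        finally show ?thesis using fx True by simp
      qed (simp add: g_def)
    qed
    also have "\<dots> = (LINT \<xi>|lborel. Re (fourier_L2 f \<xi> * cnj (fourier_L2 g \<xi>)))" by (rule parseval[OF fL gL])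
    also have "\<dots> \<le> (LINT \<xi>|lborel. e * (cmod (bessel 1 f \<xi>) * cmod (l \<xi>)) + b powr (- 1 / 2) * (cmod (bessel 1 f \<xi>) * cmod (fourier_L2 g \<xi>)))"
    proof (rule integral_mono_AE)
      show "integrable lborel (\<lambda>\<xi>. Re (fourier_L2 f \<xi> * cnj (fourier_L2 g \<xi>)))"
        by (rule integrable_Re[OF l2norm_add_sq(2)[OF fourier_L2_spec(1)[OF fL] fourier_L2_spec(1)[OF gL]]])
      show "integrable lborel (\<lambda>\<xi>. e * (cmod (bessel 1 f \<xi>) * cmod (l \<xi>)) + b powr (- 1 / 2) * (cmod (bessel 1 f \<xi>) * cmod (fourier_L2 g \<xi>)))"
        using CS1(1) CS2(1) by simp
      show "AE \<xi> in lborel. Re (fourier_L2 f \<xi> * cnj (fourier_L2 g \<xi>)) \<le> e * (cmod (bessel 1 f \<xi>) * cmod (l \<xi>)) + b powr (- 1 / 2) * (cmod (bessel 1 f \<xi>) * cmod (fourier_L2 g \<xi>))"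
        using Fg
      proof eventually_elim
        case (elim \<xi>)
        define F where "F = cmod (fourier_L2 f \<xi>)"
        have F0: "0 \<le> F" by (simp add: F_def)
        have B: "cmod (bessel 1 f \<xi>) = p \<xi> powr (1 / 2) * F"
          using p[of \<xi>] by (simp add: bessel_def norm_mult F_def powr_half_sqrt p_def)
        have R: "Re (fourier_L2 f \<xi> * cnj (fourier_L2 g \<xi>)) \<le> F * cmod (fourier_L2 g \<xi>)"
          using complex_Re_le_cmod[of "fourier_L2 f \<xi> * cnj (fourier_L2 g \<xi>)"] unfolding norm_mult complex_mod_cnj F_def .
        show ?case
        proof (cases "p \<xi> \<le> b")
          case True
          have "p \<xi> powr (\<gamma> / 2) \<le> b powr (\<gamma> / 2)" using True p[of \<xi>] \<gamma> by (intro powr_mono2) auto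
          then have "p \<xi> powr (\<gamma> / 2) * (p \<xi> powr (1 / 2) * p \<xi> powr (- (1 + \<gamma>) / 2)) \<le> b powr (\<gamma> / 2) * (p \<xi> powr (1 / 2) * p \<xi> powr (- (1 + \<gamma>) / 2))"
            by (intro mult_right_mono) auto
          moreover have "p \<xi> powr (\<gamma> / 2) * (p \<xi> powr (1 / 2) * p \<xi> powr (- (1 + \<gamma>) / 2)) = 1"
          proof -
            have "\<gamma> / 2 + (1 / 2 + - (1 + \<gamma>) / 2) = 0" by (simp add: field_simps)
            then show ?thesis using p[of \<xi>] by (simp only: powr_add[symmetric]) simp
          qed
          ultimately have one: "1 \<le> p \<xi> powr (1 / 2) * (b powr (\<gamma> / 2) * p \<xi> powr (- (1 + \<gamma>) / 2))" by (simp add: mult_ac)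
          have "F * cmod (fourier_L2 g \<xi>) \<le> F * e * 1" using elim F0 by (simp add: mult_left_mono)
          also have "\<dots> \<le> F * e * (p \<xi> powr (1 / 2) * (b powr (\<gamma> / 2) * p \<xi> powr (- (1 + \<gamma>) / 2)))"
            using one F0 e0 by (intro mult_left_mono) auto
          also have "\<dots> = e * (cmod (bessel 1 f \<xi>) * cmod (l \<xi>))"
            unfolding B l_def by (simp add: norm_mult)
          finally have "F * cmod (fourier_L2 g \<xi>) \<le> e * (cmod (bessel 1 f \<xi>) * cmod (l \<xi>))" .
          moreover have "0 \<le> b powr (- 1 / 2) * (cmod (bessel 1 f \<xi>) * cmod (fourier_L2 g \<xi>))" by simp
          ultimately show ?thesis using R by linarith
        next
          case False
          have "1 = b powr (- 1 / 2) * b powr (1 / 2)" using b by (simp flip: powr_add)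
          also have "\<dots> \<le> b powr (- 1 / 2) * p \<xi> powr (1 / 2)"
            using False b by (intro mult_left_mono powr_mono2) auto
          finally have "1 * (F * cmod (fourier_L2 g \<xi>)) \<le> (b powr (- 1 / 2) * p \<xi> powr (1 / 2)) * (F * cmod (fourier_L2 g \<xi>))"
            using F0 by (intro mult_right_mono) auto
          then have "F * cmod (fourier_L2 g \<xi>) \<le> b powr (- 1 / 2) * (cmod (bessel 1 f \<xi>) * cmod (fourier_L2 g \<xi>))"
            unfolding B by (simp add: mult_ac)
          moreover have "0 \<le> e * (cmod (bessel 1 f \<xi>) * cmod (l \<xi>))" using e0 by simp
          ultimately show ?thesis using R by linarith
        qed
      qed
    qed
    also have "\<dots> = e * (LINT \<xi>|lborel. cmod (bessel 1 f \<xi>) * cmod (l \<xi>)) + b powr (- 1 / 2) * (LINT \<xi>|lborel. cmod (bessel 1 f \<xi>) * cmod (fourier_L2 g \<xi>))"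
      using CS1(1) CS2(1) by simp
    also have "\<dots> \<le> e * (H * (b powr (\<gamma> / 2) * M)) + b powr (- 1 / 2) * (H * sqrt e)"
    proof (intro add_mono mult_left_mono e0)
      have "l2norm (bessel 1 f) * l2norm l \<le> H * l2norm l" by (intro mult_right_mono H) simp
      with CS1(2) show "(LINT \<xi>|lborel. cmod (bessel 1 f \<xi>) * cmod (l \<xi>)) \<le> H * (b powr (\<gamma> / 2) * M)" unfolding ln by linarith
      have "l2norm (bessel 1 f) * l2norm (fourier_L2 g) \<le> H * l2norm (fourier_L2 g)" by (intro mult_right_mono H) simp
      with CS2(2) show "(LINT \<xi>|lborel. cmod (bessel 1 f \<xi>) * cmod (fourier_L2 g \<xi>)) \<le> H * sqrt e"
        unfolding l2norm_fourier_L2[OF gL] gn by linarith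
    qed simp
    also have "b powr (\<gamma> / 2) = s / (2 * H * M)" using \<gamma> s H M by (simp add: b_def powr_powr)
    also have "e * (H * (s / (2 * H * M) * M)) = s / 2 * e" using H M by simp
    finally have "s / 2 * e \<le> b powr (- 1 / 2) * (H * sqrt e)" by simp
    then have "(s / 2 * e)\<^sup>2 \<le> (b powr (- 1 / 2) * (H * sqrt e))\<^sup>2" using s e0 by (intro power_mono) auto
    moreover have "(b powr (- 1 / 2))\<^sup>2 = 1 / b" unfolding powr_half_square using b by (simp add: powr_minus_divide)
    ultimately have "s\<^sup>2 / 4 * e * e \<le> H\<^sup>2 / b * e"
      using e0 by (simp add: power_mult_distrib power_divide power2_eq_square[of e] mult_ac)
    \<comment> \<open>One factor \<open>e\<close> cancels unless it is 0, and then the bound is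
      trivial.\<close>
    then have "e = 0 \<or> s\<^sup>2 / 4 * e \<le> H\<^sup>2 / b"
      using e0 mult_right_le_imp_le[of "s\<^sup>2 / 4 * e" e "H\<^sup>2 / b"] by linarith
    then have "e \<le> C"
    proof
      assume "e = 0" then show ?thesis using b s by (simp add: C_def)
    next
      assume "s\<^sup>2 / 4 * e \<le> H\<^sup>2 / b"
      then show ?thesis using s b by (simp add: C_def field_simps)
    qed
    then show ?thesis by (simp add: e_def E_def)
  qed
  have C0: "0 \<le> C" using b by (simp add: C_def)
  have Ceq: "C = 4 * H\<^sup>2 * (2 * H * M) powr (2 / \<gamma>) * s powr (- (2 + 2 / \<gamma>))"
  proof -
    have "s powr (- (2 + 2 / \<gamma>)) = 1 / (s\<^sup>2 * s powr (2 / \<gamma>))"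
      using s by (simp only: powr_minus_divide powr_add powr_numeral less_imp_le)
    then show ?thesis using s H M by (simp add: C_def b_def powr_divide)
  qed
  have "(\<lambda>n. emeasure lborel {x. s < cmod (f x) \<and> norm x \<le> real n}) \<longlonglongrightarrow> emeasure lborel (\<Union>n. {x. s < cmod (f x) \<and> norm x \<le> real n})"
    by (rule Lim_emeasure_incseq) (auto simp: incseq_def)
  also have "(\<Union>n. {x. s < cmod (f x) \<and> norm x \<le> real n}) = {x. s < cmod (f x)}"
    using real_arch_simple by auto
  finally show ?thesis unfolding Ceq[symmetric]
  proof (rule LIMSEQ_le_const2, intro exI[of _ 0] allI impI)
    fix n
    have "emeasure lborel {x. s < cmod (f x) \<and> norm x \<le> real n} < \<infinity>"
      by (rule le_less_trans[OF emeasure_mono emeasure_lborel_cball_finite[of 0 "real n"]]) auto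
    then show "emeasure lborel {x. s < cmod (f x) \<and> norm x \<le> real n} \<le> ennreal C"
      using bound[of n] C0 by (simp add: emeasure_eq_ennreal_measure ennreal_leI)
  qed
qed

text \<open>Where \<open>|f| \<le> 1\<close> the L^2 norm suffices. Elsewhere dyadic levels are
  summed: the set where \<open>|f| > 2 ^ k\<close> has measure of order
  \<open>(2 ^ k) powr (- (2 + 2 / \<gamma>))\<close>, so the series converges when
  \<open>\<alpha> < 2 / \<gamma>\<close>. Subcriticality of \<alpha> allows such a \<gamma> together
  with \<open>N < 2 * (1 + \<gamma>)\<close>.\<close>

lemma sobolev_embedding:
  assumes \<alpha>: "0 < \<alpha>" "DIM('a::euclidean_space) > 2 \<Longrightarrow> \<alpha> < 4 / (real DIM('a) - 2)"
  shows "\<exists>C. \<forall>f::'a \<Rightarrow> complex. f \<in> sobolev 1 \<longrightarrow> l2norm (bessel 1 f) \<le> H \<longrightarrow>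
    (\<integral>\<^sup>+x. ennreal (cmod (f x) powr (\<alpha> + 2)) \<partial>lborel) \<le> ennreal C"
proof -
  \<comment> \<open>\<open>level_set_bound\<close> wants a strictly positive bound on the norm,
    whatever \<open>H\<close> is.\<close>
  define H' where "H' = max H 1"
  have H': "0 < H'" "H \<le> H'" by (auto simp: H'_def)
  define N where "N = real DIM('a)"
  define \<mu> where "\<mu> = max 0 ((N - 2) / 2)"
  \<comment> \<open>The midpoint of the admissible range: above \<open>(N - 2) / 2\<close> for the
    weight to be integrable, below \<open>2 / \<alpha>\<close> for the dyadic series to converge;
    the maximum with 0 in \<open>\<mu>\<close> makes it positive.\<close>
  define \<gamma> where "\<gamma> = (\<mu> + 2 / \<alpha>) / 2"
  have "(N - 2) / 2 < 2 / \<alpha>"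
  proof (cases "DIM('a) > 2")
    case True
    then show ?thesis using \<alpha> by (simp add: N_def field_simps)
  next
    case False
    then have "(N - 2) / 2 \<le> 0" by (simp add: N_def)
    also have "0 < 2 / \<alpha>" using \<alpha> by simp
    finally show ?thesis .
  qed
  then have \<mu>: "\<mu> < 2 / \<alpha>" "0 \<le> \<mu>" "(N - 2) / 2 \<le> \<mu>" using \<alpha> by (simp_all add: \<mu>_def)
  have \<gamma>: "0 < \<gamma>" "N < 2 * (1 + \<gamma>)" "\<gamma> < 2 / \<alpha>"
  proof -
    define A where "A = 2 / \<alpha>"
    have "\<gamma> = (\<mu> + A) / 2" "\<mu> < A" using \<mu>(1) by (simp_all add: \<gamma>_def A_def)
    then have "0 < \<gamma>" "\<gamma> < A" and "2 * \<mu> < 2 * \<gamma>" using \<mu>(2) by simp_all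
    moreover have "N \<le> 2 * \<mu> + 2" using \<mu>(3) by simp
    ultimately show "0 < \<gamma>" "N < 2 * (1 + \<gamma>)" "\<gamma> < 2 / \<alpha>" by (simp_all add: A_def)
  qed
  have \<alpha>\<gamma>: "\<alpha> < 2 / \<gamma>" using \<gamma> \<alpha> by (simp add: field_simps)
  define M where "M = sqrt (LINT \<xi>::'a|lborel. (1 + (norm \<xi>)\<^sup>2) powr (- (1 + \<gamma>))) "
  have wi: "integrable lborel (\<lambda>\<xi>::'a. (1 + (norm \<xi>)\<^sup>2) powr (- (1 + \<gamma>)))"
    by (rule bessel_weight_integrable) (use \<gamma> in \<open>simp add: N_def\<close>)
  have pos: "0 < (1 + (norm \<xi>)\<^sup>2) powr (- (1 + \<gamma>))" for \<xi> :: 'a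
    by (simp add: add_pos_nonneg less_imp_neq[symmetric])
  have "0 < (LINT \<xi>::'a|lborel. (1 + (norm \<xi>)\<^sup>2) powr (- (1 + \<gamma>)))"
  proof -
    have n0: "(LINT \<xi>::'a|lborel. (1 + (norm \<xi>)\<^sup>2) powr (- (1 + \<gamma>))) \<noteq> 0"
    proof
      assume "(LINT \<xi>::'a|lborel. (1 + (norm \<xi>)\<^sup>2) powr (- (1 + \<gamma>))) = 0"
      then have "AE \<xi>::'a in lborel. (1 + (norm \<xi>)\<^sup>2) powr (- (1 + \<gamma>)) = 0"
        using integral_nonneg_eq_0_iff_AE[OF wi] by simp
      then have "AE \<xi>::'a in lborel. False" by eventually_elim (use pos in \<open>simp add: less_imp_neq[symmetric]\<close>)
      then show False using emeasure_lborel_UNIV[where ?'a='a] by (simp add: AE_iff_null space_lborel null_sets_def)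
    qed
    have "0 \<le> (LINT \<xi>::'a|lborel. (1 + (norm \<xi>)\<^sup>2) powr (- (1 + \<gamma>)))"
      by (intro integral_nonneg_AE AE_I2) simp
    then show ?thesis by (rule le_neq_trans[OF _ n0[symmetric]])
  qed
  then have M: "M\<^sup>2 = (LINT \<xi>::'a|lborel. (1 + (norm \<xi>)\<^sup>2) powr (- (1 + \<gamma>)))" "0 < M"
    by (simp_all add: M_def)
  define D where "D = 4 * H'\<^sup>2 * (2 * H' * M) powr (2 / \<gamma>)"
  have D: "0 \<le> D" by (simp add: D_def)
  define P where "P = \<alpha> + 2"
  define q where "q = 2 powr (P - (2 + 2 / \<gamma>))"
  have q: "0 < q" "q < 1" using \<alpha>\<gamma> powr_less_mono[of "P - (2 + 2 / \<gamma>)" 0 2] by (auto simp: q_def P_def)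
  show ?thesis
  proof (intro exI[of _ "H'\<^sup>2 + (\<Sum>k. 2 powr P * D * q ^ k)"] allI impI)
    fix f :: "'a \<Rightarrow> complex"
    assume f: "f \<in> sobolev 1" and "l2norm (bessel 1 f) \<le> H"
    then have fH: "l2norm (bessel 1 f) \<le> H'" using H' by linarith
    note fL = sobolev_bessel(1)[OF f]
    have fm[measurable]: "f \<in> borel_measurable borel" using fL by (rule L2_measurable)
    have point: "ennreal (cmod (f x) powr P) \<le> ennreal ((cmod (f x))\<^sup>2) + (\<Sum>k. ennreal ((2 ^ Suc k) powr P) * indicator {x. 2 ^ k < cmod (f x)} x)" for x
    proof (cases "cmod (f x) \<le> 1")
      case True
      have "cmod (f x) powr P \<le> (cmod (f x))\<^sup>2"
      proof (cases "f x = 0")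
        case False
        then have "cmod (f x) powr P \<le> cmod (f x) powr 2"
          using True \<alpha> by (intro powr_mono') (auto simp: P_def)
        then show ?thesis by (simp add: powr_numeral)
      qed simp
      then show ?thesis by (simp add: ennreal_leI add_increasing2)
    next
      case False
      then obtain k where k: "2 ^ k < cmod (f x)" "cmod (f x) \<le> 2 ^ Suc k" using dyadic_index[of "cmod (f x)"] by auto
      define F where "F k = ennreal ((2 ^ Suc k) powr P) * indicator {x. 2 ^ k < cmod (f x)} x" for k
      have "ennreal (cmod (f x) powr P) \<le> F k"
        using k \<alpha> by (simp add: F_def P_def ennreal_leI powr_mono2 del: power_Suc)
      also have "F k \<le> suminf F" using sum_le_suminf[of F "{k}"] by simp
      finally show ?thesis unfolding F_def[abs_def] by (simp add: add_increasing)
    qed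
    have "(\<integral>\<^sup>+x. ennreal (cmod (f x) powr P) \<partial>lborel) \<le> (\<integral>\<^sup>+x. ennreal ((cmod (f x))\<^sup>2) + (\<Sum>k. ennreal ((2 ^ Suc k) powr P) * indicator {x. 2 ^ k < cmod (f x)} x) \<partial>lborel)"
      by (intro nn_integral_mono point)
    also have "\<dots> = (\<integral>\<^sup>+x. ennreal ((cmod (f x))\<^sup>2) \<partial>lborel) + (\<integral>\<^sup>+x. (\<Sum>k. ennreal ((2 ^ Suc k) powr P) * indicator {x. 2 ^ k < cmod (f x)} x) \<partial>lborel)"
      by (rule nn_integral_add) simp_all
    also have "(\<integral>\<^sup>+x. (\<Sum>k. ennreal ((2 ^ Suc k) powr P) * indicator {x. 2 ^ k < cmod (f x)} x) \<partial>lborel) = (\<Sum>k. \<integral>\<^sup>+x. ennreal ((2 ^ Suc k) powr P) * indicator {x. 2 ^ k < cmod (f x)} x \<partial>lborel)"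
      by (rule nn_integral_suminf) simp
    also have "(\<integral>\<^sup>+x. ennreal ((cmod (f x))\<^sup>2) \<partial>lborel) = ennreal ((l2norm f)\<^sup>2)"
      by (rule nn_integral_sq[OF L2_integrable[OF fL]])
    also have "\<dots> + (\<Sum>k. \<integral>\<^sup>+x. ennreal ((2 ^ Suc k) powr P) * indicator {x. 2 ^ k < cmod (f x)} x \<partial>lborel) \<le> ennreal (H'\<^sup>2) + (\<Sum>k. ennreal (2 powr P * D * q ^ k))"
    proof (intro add_mono suminf_le)
      have "l2norm f \<le> H'" using l2norm_le_bessel[OF f] fH by linarith
      then show "ennreal ((l2norm f)\<^sup>2) \<le> ennreal (H'\<^sup>2)" by (intro ennreal_leI power_mono) auto
      fix k :: nat
      have "(\<integral>\<^sup>+x. ennreal ((2 ^ Suc k) powr P) * indicator {x. 2 ^ k < cmod (f x)} x \<partial>lborel) = ennreal ((2 ^ Suc k) powr P) * emeasure lborel {x. 2 ^ k < cmod (f x)}"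
        by (rule nn_integral_cmult_indicator) simp
      also have "\<dots> \<le> ennreal ((2 ^ Suc k) powr P) * ennreal (D * (2 ^ k) powr (- (2 + 2 / \<gamma>)))"
        unfolding D_def
        by (intro mult_left_mono level_set_bound[OF f fH H'(1) \<gamma>(1) _ _ M]) (use \<gamma> in \<open>simp_all add: N_def\<close>)
      also have "\<dots> = ennreal ((2 ^ Suc k) powr P * (D * (2 ^ k) powr (- (2 + 2 / \<gamma>))))"
        using D by (intro ennreal_mult[symmetric]) auto
      also have "(2 ^ Suc k) powr P * (D * (2 ^ k) powr (- (2 + 2 / \<gamma>))) = 2 powr P * D * q ^ k"
      proof -
        have e: "(2 ^ k) powr z = (2 powr z) ^ k" for z :: real
          by (simp add: powr_realpow[symmetric] powr_powr mult.commute)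
        have "(2 ^ Suc k) powr P = 2 powr P * (2 powr P) ^ k" by (simp add: powr_mult e)
        moreover have "q ^ k = (2 powr P) ^ k * (2 powr (- (2 + 2 / \<gamma>))) ^ k"
          unfolding q_def power_mult_distrib[symmetric] powr_add[symmetric] by (simp only: diff_conv_add_uminus)
        ultimately show ?thesis unfolding e by simp
      qed
      finally show "(\<integral>\<^sup>+x. ennreal ((2 ^ Suc k) powr P) * indicator {x. 2 ^ k < cmod (f x)} x \<partial>lborel) \<le> ennreal (2 powr P * D * q ^ k)" .
    qed simp_all
    also have "(\<Sum>k. ennreal (2 powr P * D * q ^ k)) = ennreal (\<Sum>k. 2 powr P * D * q ^ k)"
      using D q by (intro suminf_ennreal2 summable_mult summable_geometric) auto
    also have "ennreal (H'\<^sup>2) + \<dots> = ennreal (H'\<^sup>2 + (\<Sum>k. 2 powr P * D * q ^ k))"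
      using D q by (intro ennreal_plus[symmetric] suminf_nonneg summable_mult summable_geometric) auto
    finally show "(\<integral>\<^sup>+x. ennreal (cmod (f x) powr (\<alpha> + 2)) \<partial>lborel) \<le> ennreal (H'\<^sup>2 + (\<Sum>k. 2 powr P * D * q ^ k))"
      by (simp add: P_def)
  qed
qed

section \<open>Decay estimate\<close>

lemma ennreal_powr_measurable[measurable (raw)]:
  assumes [measurable]: "f \<in> borel_measurable M"
  shows "(\<lambda>x. ennreal_powr (f x) p) \<in> borel_measurable M"
  unfolding ennreal_powr_def by measurable

text \<open>Raises the exponent of the norm from \<open>p\<close> to \<open>q\<close> at the price
  of the constant 1, which is integrable over bounded times. An infinite norm makes the right side
  infinite.\<close>

lemma nn_integral_powr_le_Lp_norm:
  assumes [measurable]: "f \<in> borel_measurable borel" and p: "0 < p" "p \<le> q"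
  shows "(\<integral>\<^sup>+x. ennreal (cmod (f x) powr p) \<partial>lborel) \<le> 1 + ennreal_powr (Lp_norm (ennreal p) f) q"
proof -
  define I where "I = (\<integral>\<^sup>+x. ennreal (cmod (f x) powr p) \<partial>lborel)"
  have L: "Lp_norm (ennreal p) f = ennreal_powr I (1 / p)"
    using p by (simp add: Lp_norm_def I_def)
  show ?thesis
  proof (cases I)
    case (real i)
    have "i = (i powr (1 / p)) powr p" using real p by (simp add: powr_powr)
    also have "\<dots> \<le> (i powr (1 / p)) powr q + 1" using p by (intro powr_less_succ) auto
    finally have "ennreal i \<le> ennreal (1 + (i powr (1 / p)) powr q)" by (intro ennreal_leI) simp
    then show ?thesis unfolding L I_def[symmetric] using real by (simp add: ennreal_powr_def)
  next
    case top
    then show ?thesis unfolding L by (simp add: ennreal_powr_def)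
  qed
qed

lemma nls_solution_mass:
  fixes u :: "real \<Rightarrow> 'a::euclidean_space \<Rightarrow> complex"
  assumes lam: "lam \<noteq> 0" and m: "m \<in> {0, 1}" and \<alpha>: "0 < \<alpha>"
    and m0: "m = 0 \<Longrightarrow> \<alpha> \<le> 4 / real DIM('a)"
    and m1: "m = 1 \<Longrightarrow> DIM('a) > 2 \<Longrightarrow> \<alpha> < 4 / (real DIM('a) - 2)"
    and sol: "nls_solution m lam \<alpha> \<phi> T1 \<infinity> u" and T: "0 < T"
  shows "l2norm (u T) = l2norm (u 0)"
proof -
  define I where "I = time_interval T1 \<infinity>"
  have T1: "0 < T1" and c: "continuous_into_sobolev m I u" and sat: "satisfies_nls lam \<alpha> I u"
    and str: "m = 0 \<Longrightarrow> locally_Lq_Lp (4 * (\<alpha> + 2) / (real DIM('a) * \<alpha>)) (\<alpha> + 2) I u"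
    using sol by (auto simp: nls_solution_def I_def)
  have I: "{0..T} \<subseteq> I"
  proof
    fix t assume "t \<in> {0..T}"
    then have "- T1 < 0" "0 \<le> ereal t" using T1 ereal_minus_less_minus[of T1 0] by simp_all
    then have "- T1 < ereal t" by (rule less_le_trans)
    then show "t \<in> I" by (simp add: I_def time_interval_def)
  qed
  have S: "u t \<in> sobolev m" if "t \<in> {0..T}" for t
    using c I that by (auto simp: continuous_into_sobolev_def)
  obtain H where H: "\<And>t. t \<in> {0..T} \<Longrightarrow> l2norm (bessel m (u t)) \<le> H"
    using sobolev_norm_bounded_on_compact[OF c I] by blast
  have "\<exists>G. G \<in> borel_measurable borel \<and> (\<integral>\<^sup>+s\<in>{0..T}. G s \<partial>lborel) < \<infinity> \<and>
    (\<forall>t\<in>{0..T}. (\<integral>\<^sup>+x. ennreal (cmod (u t x) powr (\<alpha> + 2)) \<partial>lborel) \<le> G t)"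
  proof (cases "m = 0")
    case True
    define q where "q = 4 * (\<alpha> + 2) / (real DIM('a) * \<alpha>)"
    have "\<alpha> * real DIM('a) \<le> 4" using m0[OF True] by (simp add: field_simps)
    \<comment> \<open>For positive \<alpha> the bound \<open>\<alpha> \<le> 4 / N\<close> is
      equivalent to this comparison of the time exponent with \<open>\<alpha> + 2\<close>.\<close>
    then have q: "\<alpha> + 2 \<le> q" using \<alpha> mult_right_mono[of "\<alpha> * real DIM('a)" 4 "\<alpha> + 2"]
      by (simp add: q_def pos_le_divide_eq mult_ac)
    \<comment> \<open>The cut-off is built in because measurability of the norm in time is provided
      for compact intervals only.\<close>
    define A where "A s = indicator {0..T} s * Lp_norm (ennreal (\<alpha> + 2)) (u s)" for s
    have Am[measurable]: "A \<in> borel_measurable borel"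
      and Ai: "(\<integral>\<^sup>+s\<in>{0..T}. ennreal_powr (Lp_norm (ennreal (\<alpha> + 2)) (u s)) q \<partial>lborel) < \<infinity>"
      using str[OF True] I unfolding locally_Lq_Lp_def A_def[abs_def] q_def by auto
    define G where "G s = 1 + ennreal_powr (A s) q" for s
    have Gm: "G \<in> borel_measurable borel" unfolding G_def[abs_def] by measurable
    have "(\<integral>\<^sup>+s\<in>{0..T}. G s \<partial>lborel) = (\<integral>\<^sup>+s. indicator {0..T} s + ennreal_powr (A s) q * indicator {0..T} s \<partial>lborel)"
      by (intro nn_integral_cong) (simp add: G_def distrib_right)
    also have "\<dots> = (\<integral>\<^sup>+s. indicator {0..T} s \<partial>lborel) + (\<integral>\<^sup>+s. ennreal_powr (A s) q * indicator {0..T} s \<partial>lborel)"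
      by (rule nn_integral_add) simp_all
    also have "(\<integral>\<^sup>+s. ennreal_powr (A s) q * indicator {0..T} s \<partial>lborel) = (\<integral>\<^sup>+s\<in>{0..T}. ennreal_powr (Lp_norm (ennreal (\<alpha> + 2)) (u s)) q \<partial>lborel)"
      by (intro nn_integral_cong) (simp add: A_def indicator_def)
    also have "(\<integral>\<^sup>+s. indicator {0..T} s \<partial>lborel) + \<dots> < \<infinity>" using Ai T by simp
    finally have Gi: "(\<integral>\<^sup>+s\<in>{0..T}. G s \<partial>lborel) < \<infinity>" .
    have "(\<integral>\<^sup>+x. ennreal (cmod (u t x) powr (\<alpha> + 2)) \<partial>lborel) \<le> G t" if t: "t \<in> {0..T}" for t
      using nn_integral_powr_le_Lp_norm[OF L2_measurable[OF sobolev_bessel(1)[OF S[OF t]]], of "\<alpha> + 2" q] \<alpha> q t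
      by (simp add: G_def A_def)
    with Gm Gi show ?thesis by blast
  next
    case False
    then have m: "m = 1" using m by simp
    \<comment> \<open>For \<open>m = 1\<close> a constant majorant will do: the H^1 norm stays below
      \<open>H\<close> on \<open>{0..T}\<close>, and the embedding is uniform on that ball.\<close>
    obtain C where C: "\<And>f::'a \<Rightarrow> complex. f \<in> sobolev 1 \<Longrightarrow> l2norm (bessel 1 f) \<le> H \<Longrightarrow> (\<integral>\<^sup>+x. ennreal (cmod (f x) powr (\<alpha> + 2)) \<partial>lborel) \<le> ennreal C"
      using sobolev_embedding[OF \<alpha> m1[OF m], of H] by blast
    show ?thesis
    proof (intro exI[of _ "\<lambda>_. ennreal C"] conjI ballI)
      show "(\<integral>\<^sup>+s\<in>{0..T}. ennreal C \<partial>lborel) < \<infinity>"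
        using T by (subst nn_integral_cmult_indicator) (simp_all add: ennreal_mult_less_top)
      show "(\<integral>\<^sup>+x. ennreal (cmod (u t x) powr (\<alpha> + 2)) \<partial>lborel) \<le> ennreal C" if "t \<in> {0..T}" for t
        by (rule C) (use S[OF that] H[OF that] m in auto)
    qed simp
  qed
  then obtain G where G: "G \<in> borel_measurable borel" "(\<integral>\<^sup>+s\<in>{0..T}. G s \<partial>lborel) < \<infinity>"
    "\<And>t. t \<in> {0..T} \<Longrightarrow> (\<integral>\<^sup>+x. ennreal (cmod (u t x) powr (\<alpha> + 2)) \<partial>lborel) \<le> G t" by blast
  interpret nls_flow u lam \<alpha> T G
  proof
    show "\<exists>B. \<forall>t\<in>{0..T}. l2norm (u t) \<le> B"
      using l2norm_le_bessel[OF S] H by (intro exI[of _ H]) (blast intro: order_trans)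
    show "satisfies_nls lam \<alpha> {0..T} u"
      using sat I unfolding satisfies_nls_def Let_def by blast
  qed (use T \<alpha> lam G S sobolev_bessel(1) in auto)
  show ?thesis by (rule mass_conservation)
qed

lemma corresponding_solution_mass:
  fixes u :: "real \<Rightarrow> 'a::euclidean_space \<Rightarrow> complex"
  assumes lam: "lam \<noteq> 0" and m: "m \<in> {0, 1}" and \<alpha>: "0 \<le> \<alpha>"
    and m0: "m = 0 \<Longrightarrow> \<alpha> \<le> 4 / real DIM('a)"
    and m1: "m = 1 \<Longrightarrow> DIM('a) > 2 \<Longrightarrow> \<alpha> < 4 / (real DIM('a) - 2)"
    and \<phi>: "\<phi> \<in> L2"
    and sol: "corresponding_solution m lam \<alpha> \<phi> T1 \<infinity> u" and t: "0 < t"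
  shows "u t \<in> L2" "l2norm (u t) = l2norm \<phi>"
proof -
  have "u t \<in> L2 \<and> l2norm (u t) = l2norm \<phi>"
  proof (cases "\<alpha> = 0")
    case True
    then have c: "continuous_into_sobolev m UNIV u" and ae: "AE x in lborel. u t x = cis (lam * t) * schroedinger_group t \<phi> x"
      using sol by (simp_all add: corresponding_solution_def)
    have uL: "u t \<in> L2" using c by (auto simp: continuous_into_sobolev_def intro: sobolev_bessel(1))
    note gL = schroedinger_group_L2[OF \<phi>, of t]
    have "l2norm (u t) = l2norm (\<lambda>x. cis (lam * t) * schroedinger_group t \<phi> x)"
      by (rule l2norm_cong_AE[OF L2_measurable[OF uL] L2_measurable[OF L2_cmult(1)[OF gL(1)]] ae])
    then show ?thesis using uL gL by (simp add: L2_cmult)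
  next
    case False
    then have N: "nls_solution m lam \<alpha> \<phi> T1 \<infinity> u"
      using sol by (simp add: corresponding_solution_def maximal_nls_solution_def)
    then have T1: "0 < T1" and c: "continuous_into_sobolev m (time_interval T1 \<infinity>) u" and ae: "AE x in lborel. u 0 x = \<phi> x"
      by (auto simp: nls_solution_def)
    have I: "s \<in> time_interval T1 \<infinity>" if "0 \<le> s" for s
    proof -
      have "- T1 < 0" "0 \<le> ereal s" using T1 that ereal_minus_less_minus[of T1 0] by simp_all
      then have "- T1 < ereal s" by (rule less_le_trans)
      then show ?thesis by (simp add: time_interval_def)
    qed
    have uL: "u s \<in> L2" if "0 \<le> s" for s
      using c I[OF that] by (auto simp: continuous_into_sobolev_def intro: sobolev_bessel(1))
    have "l2norm (u t) = l2norm (u 0)"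
      by (rule nls_solution_mass[OF lam m _ m0 m1 N t]) (use \<alpha> False in auto)
    also have "\<dots> = l2norm \<phi>"
      by (rule l2norm_cong_AE[OF L2_measurable[OF uL] L2_measurable[OF \<phi>] ae]) simp
    finally show ?thesis using uL[of t] t by simp
  qed
  then show "u t \<in> L2" "l2norm (u t) = l2norm \<phi>" by auto
qed

section \<open>Modulations, translations and tails\<close>

definition modulation_defect :: "('a::euclidean_space \<Rightarrow> complex) \<Rightarrow> 'a \<Rightarrow> real" where
  "modulation_defect w a = l2norm (\<lambda>x. (cis (x \<bullet> a) - 1) * w x)"

text \<open>Both phases met below, the linear one \<open>x \<bullet> a\<close> and the quadratic
  one, change by at most a multiple \<eta> of \<open>2 * norm x + 1\<close>, and unimodular numbers
  differ by at most 2. One weight thus controls both.\<close>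

definition tail_weight :: "('a::euclidean_space \<Rightarrow> complex) \<Rightarrow> real \<Rightarrow> real" where
  "tail_weight w \<eta> = l2norm (\<lambda>x. complex_of_real (min 2 (\<eta> * (2 * norm x + 1))) * w x)"

lemma norm_cis_diff_le: "cmod (cis a - cis b) \<le> min 2 \<bar>a - b\<bar>"
proof -
  have "cmod (cis a - cis b) \<le> 2" using norm_triangle_ineq4[of "cis a" "cis b"] by simp
  moreover have "cmod (cis a - cis b) \<le> \<bar>a - b\<bar>"
  proof -
    have "cis a - cis b = cis b * (cis (a - b) - 1)" by (simp add: right_diff_distrib cis_mult)
    then have "cmod (cis a - cis b) = cmod (cis (a - b) - 1)" by (simp add: norm_mult)
    also have "\<dots> = 2 * \<bar>sin ((a - b) / 2)\<bar>" using dist_exp_i_1[of "a - b"] by (simp add: cis_conv_exp mult.commute)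
    also have "\<dots> \<le> 2 * \<bar>(a - b) / 2\<bar>" by (intro mult_left_mono abs_sin_x_le_abs_x) simp
    finally show ?thesis by simp
  qed
  ultimately show ?thesis by simp
qed

lemma L2_bounded_mult:
  assumes w: "w \<in> L2" and k: "k \<in> borel_measurable borel" and b: "\<And>x. cmod (k x) \<le> B"
  shows "(\<lambda>x. k x * w x) \<in> L2"
proof (rule L2_dominated(1)[OF _ L2_cmult(1)[OF w, of "complex_of_real B"]])
  show "(\<lambda>x. k x * w x) \<in> borel_measurable borel" by (intro borel_measurable_times k L2_measurable w)
  show "cmod (k x * w x) \<le> cmod (complex_of_real B * w x)" for x
    using b[of x] by (simp add: norm_mult mult_right_mono)
qed

lemma tail_weight_L2:
  assumes "w \<in> L2" "0 \<le> \<eta>"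
  shows "(\<lambda>x. complex_of_real (min 2 (\<eta> * (2 * norm x + 1))) * w x) \<in> L2"
  by (rule L2_bounded_mult[OF assms(1), of _ 2]) (use assms(2) in auto)

text \<open>Dominated convergence: the weight is at most 2 and tends to 0 pointwise with
  \<eta>.\<close>

lemma tail_weight_tendsto:
  assumes w: "w \<in> L2" and e: "0 < e"
  shows "\<exists>\<eta>>0. tail_weight w \<eta> < e"
proof -
  have [measurable]: "w \<in> borel_measurable borel" using w by (rule L2_measurable)
  define \<eta> where "\<eta> n = 1 / real (Suc n)" for n
  have \<eta>: "\<eta> \<longlonglongrightarrow> 0" using LIMSEQ_inverse_real_of_nat by (simp add: \<eta>_def[abs_def] inverse_eq_divide)
  have \<eta>0: "0 < \<eta> n" for n by (simp add: \<eta>_def)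
  let ?f = "\<lambda>n x. (cmod (complex_of_real (min 2 (\<eta> n * (2 * norm x + 1))) * w x))\<^sup>2"
  have "(\<lambda>n. LINT x|lborel. ?f n x) \<longlonglongrightarrow> (LINT x::'a|lborel. 0)"
  proof (rule integral_dominated_convergence[where w="\<lambda>x. (cmod (2 * w x))\<^sup>2"])
    show "integrable lborel (\<lambda>x. (cmod (2 * w x))\<^sup>2)" by (rule L2_integrable[OF L2_cmult(1)[OF w]])
    show "AE x in lborel. norm (?f n x) \<le> (cmod (2 * w x))\<^sup>2" for n
    proof (rule AE_I2)
      fix x :: 'a
      have "\<bar>min 2 (\<eta> n * (2 * norm x + 1))\<bar> \<le> 2" using \<eta>0[of n] by simp
      then have "cmod (complex_of_real (min 2 (\<eta> n * (2 * norm x + 1))) * w x) \<le> cmod (2 * w x)"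
        unfolding norm_mult norm_of_real by (intro mult_right_mono) auto
      from power_mono[OF this norm_ge_zero, of 2]
      show "norm (?f n x) \<le> (cmod (2 * w x))\<^sup>2" by (simp only: real_norm_def abs_power2)
    qed
    show "AE x in lborel. (\<lambda>n. ?f n x) \<longlonglongrightarrow> 0"
    proof (rule AE_I2)
      fix x :: 'a
      have "(\<lambda>n. ?f n x) \<longlonglongrightarrow> (cmod (complex_of_real (min 2 (0 * (2 * norm x + 1))) * w x))\<^sup>2"
        by (intro tendsto_intros \<eta>)
      then show "(\<lambda>n. ?f n x) \<longlonglongrightarrow> 0" by simp
    qed
  qed simp_all
  then have "(\<lambda>n. tail_weight w (\<eta> n)) \<longlonglongrightarrow> sqrt 0"
    unfolding tail_weight_def l2norm_def by (intro tendsto_real_sqrt) simp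
  then have "(\<lambda>n. tail_weight w (\<eta> n)) \<longlonglongrightarrow> 0" by simp
  from LIMSEQ_D[OF this e] obtain n where "norm (tail_weight w (\<eta> n) - 0) < e" by blast
  then show ?thesis using \<eta>0[of n] by (intro exI[of _ "\<eta> n"]) simp
qed

lemma modulation_defect_le:
  assumes w: "w \<in> L2" and a: "norm a \<le> \<eta>"
  shows "modulation_defect w a \<le> tail_weight w \<eta>"
proof -
  have [measurable]: "w \<in> borel_measurable borel" using w by (rule L2_measurable)
  have \<eta>: "0 \<le> \<eta>" using a norm_ge_zero[of a] by linarith
  show ?thesis unfolding modulation_defect_def tail_weight_def
  proof (rule L2_dominated(2)[OF _ tail_weight_L2[OF w \<eta>]])
    fix x
    have "\<bar>x \<bullet> a\<bar> \<le> norm x * norm a" by (rule Cauchy_Schwarz_ineq2)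
    also have "\<dots> \<le> \<eta> * norm x" using mult_right_mono[OF a norm_ge_zero[of x]] by (simp add: mult.commute)
    also have "\<dots> \<le> \<eta> * (2 * norm x + 1)" using \<eta> by (intro mult_left_mono) auto
    finally have "cmod (cis (x \<bullet> a) - 1) \<le> min 2 (\<eta> * (2 * norm x + 1))"
      using norm_cis_diff_le[of "x \<bullet> a" 0] by simp
    then have "cmod (cis (x \<bullet> a) - 1) \<le> \<bar>min 2 (\<eta> * (2 * norm x + 1))\<bar>" by linarith
    then show "cmod ((cis (x \<bullet> a) - 1) * w x) \<le> cmod (complex_of_real (min 2 (\<eta> * (2 * norm x + 1))) * w x)"
      unfolding norm_mult norm_of_real by (intro mult_right_mono) auto
  qed measurable
qed

lemma modulation_defect_fourier:
  assumes w: "w \<in> L2"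
  shows "modulation_defect w a = l2norm (\<lambda>\<xi>. fourier_L2 w (\<xi> - a) - fourier_L2 w \<xi>)"
proof -
  note F = fourier_L2_spec(1)[OF w]
  have mL: "(\<lambda>x. cis (x \<bullet> a) * w x) \<in> L2" by (rule L2_unimodular(1)[OF w]) simp_all
  have "modulation_defect w a = l2norm (\<lambda>x. cis (x \<bullet> a) * w x - w x)"
    by (simp add: modulation_defect_def left_diff_distrib)
  also have "\<dots> = l2norm (\<lambda>\<xi>. fourier_L2 (\<lambda>x. cis (x \<bullet> a) * w x) \<xi> - fourier_L2 w \<xi>)"
    by (rule l2norm_fourier_L2_diff[OF mL w, symmetric])
  also have "\<dots> = l2norm (\<lambda>\<xi>. fourier_L2 w (\<xi> - a) - fourier_L2 w \<xi>)"
  proof (rule l2norm_cong_AE)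
    show "(\<lambda>\<xi>. fourier_L2 (\<lambda>x. cis (x \<bullet> a) * w x) \<xi> - fourier_L2 w \<xi>) \<in> borel_measurable borel"
      by (intro L2_measurable L2_diff fourier_L2_spec mL w)
    show "(\<lambda>\<xi>. fourier_L2 w (\<xi> - a) - fourier_L2 w \<xi>) \<in> borel_measurable borel"
      using L2_shift(1)[OF F, of "- a"] by (intro L2_measurable L2_diff F) simp
    show "AE \<xi> in lborel. fourier_L2 (\<lambda>x. cis (x \<bullet> a) * w x) \<xi> - fourier_L2 w \<xi> = fourier_L2 w (\<xi> - a) - fourier_L2 w \<xi>"
      using fourier_L2_modulate[OF w, of a] by eventually_elim simp
  qed
  finally show ?thesis .
qed

text \<open>A translation of the product acts on the amplitude (\<open>A\<close>) and on the phase
  (\<open>B\<close>). The phase in \<open>A\<close> is unimodular, so by Plancherel its norm is a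
  modulation defect of \<open>w\<close>; in \<open>B\<close> the phases differ by at most
  \<open>\<kappa> * (2 * norm \<xi> + 1)\<close>.\<close>

lemma evolved_translation:
  assumes w: "w \<in> L2" and a: "norm a \<le> 1" "norm a \<le> \<eta>" and \<tau>: "0 \<le> \<tau>" "\<tau> * norm a \<le> \<kappa>"
  defines "h \<equiv> \<lambda>\<xi>. cis (- \<tau> * (norm \<xi>)\<^sup>2) * fourier_L2 w \<xi>"
  shows "l2norm (\<lambda>\<xi>. h (\<xi> - a) - h \<xi>) \<le> tail_weight w \<eta> + tail_weight (fourier_L2 w) \<kappa>"
proof -
  note F = fourier_L2_spec(1)[OF w]
  have [measurable]: "fourier_L2 w \<in> borel_measurable borel" using F by (rule L2_measurable)
  have \<kappa>: "0 \<le> \<kappa>" using \<tau> mult_nonneg_nonneg[OF \<tau>(1) norm_ge_zero[of a]] by linarith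
  define A where "A \<xi> = cis (- \<tau> * (norm (\<xi> - a))\<^sup>2) * (fourier_L2 w (\<xi> - a) - fourier_L2 w \<xi>)" for \<xi>
  define B where "B \<xi> = (cis (- \<tau> * (norm (\<xi> - a))\<^sup>2) - cis (- \<tau> * (norm \<xi>)\<^sup>2)) * fourier_L2 w \<xi>" for \<xi>
  have D: "(\<lambda>\<xi>. fourier_L2 w (\<xi> - a) - fourier_L2 w \<xi>) \<in> L2"
    using L2_shift(1)[OF F, of "- a"] by (intro L2_diff F) simp
  have A: "A \<in> L2" "l2norm A = modulation_defect w a"
    unfolding A_def[abs_def] modulation_defect_fourier[OF w] by (intro L2_unimodular[OF D]; simp)+
  have Bb: "cmod (B \<xi>) \<le> cmod (complex_of_real (min 2 (\<kappa> * (2 * norm \<xi> + 1))) * fourier_L2 w \<xi>)" for \<xi>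
  proof -
    have "(norm (\<xi> - a))\<^sup>2 - (norm \<xi>)\<^sup>2 = a \<bullet> a - 2 * (\<xi> \<bullet> a)"
      unfolding power2_norm_eq_inner by (simp add: inner_diff_left inner_diff_right inner_commute)
    then have "\<bar>(norm (\<xi> - a))\<^sup>2 - (norm \<xi>)\<^sup>2\<bar> \<le> norm a * norm a + 2 * (norm \<xi> * norm a)"
      using Cauchy_Schwarz_ineq2[of \<xi> a] Cauchy_Schwarz_ineq2[of a a] by linarith
    also have "\<dots> \<le> norm a * (2 * norm \<xi> + 1)"
      using mult_left_mono[OF a(1) norm_ge_zero[of a]] by (simp add: algebra_simps)
    finally have "\<tau> * \<bar>(norm (\<xi> - a))\<^sup>2 - (norm \<xi>)\<^sup>2\<bar> \<le> \<tau> * (norm a * (2 * norm \<xi> + 1))" using \<tau>(1) by (rule mult_left_mono)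
    also have "\<dots> \<le> \<kappa> * (2 * norm \<xi> + 1)" using \<tau>(2) by (simp add: mult.assoc[symmetric] mult_right_mono)
    finally have "\<bar>- \<tau> * (norm (\<xi> - a))\<^sup>2 - - \<tau> * (norm \<xi>)\<^sup>2\<bar> \<le> \<kappa> * (2 * norm \<xi> + 1)"
      using \<tau>(1) by (simp add: abs_mult[of \<tau>, symmetric, unfolded abs_of_nonneg[OF \<tau>(1)]] right_diff_distrib abs_minus_commute flip: right_diff_distrib)
    then have "cmod (cis (- \<tau> * (norm (\<xi> - a))\<^sup>2) - cis (- \<tau> * (norm \<xi>)\<^sup>2)) \<le> \<bar>min 2 (\<kappa> * (2 * norm \<xi> + 1))\<bar>"
      using norm_cis_diff_le[of "- \<tau> * (norm (\<xi> - a))\<^sup>2" "- \<tau> * (norm \<xi>)\<^sup>2"] by linarith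
    then show ?thesis unfolding B_def norm_mult norm_of_real by (intro mult_right_mono) auto
  qed
  have Bm: "B \<in> borel_measurable borel" unfolding B_def[abs_def] by measurable
  note B = L2_dominated[OF Bm tail_weight_L2[OF F \<kappa>] Bb]
  have "(\<lambda>\<xi>. h (\<xi> - a) - h \<xi>) = (\<lambda>\<xi>. A \<xi> + B \<xi>)"
    by (rule ext) (simp add: h_def A_def B_def algebra_simps)
  then show ?thesis
    using l2norm_triangle[OF A(1) B(1)] A(2) B(2) modulation_defect_le[OF w a(2)] by (simp add: tail_weight_def)
qed

text \<open>All translates of the transform of \<open>u t\<close> by less than \<open>\<kappa> / t\<close> are close to it. Only the Cauchy property
  of \<open>T (-t) (u t)\<close> enters, so neither inversion nor surjectivity of the Fourier transform is needed.\<close>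

lemma asymptotic_equicontinuity:
  fixes u :: "real \<Rightarrow> 'a::euclidean_space \<Rightarrow> complex"
  assumes u: "\<And>t. 0 < t \<Longrightarrow> u t \<in> L2" and p: "u_plus \<in> L2"
    and lim: "((\<lambda>t. Lp_norm 2 (\<lambda>x. schroedinger_group (- t) (u t) x - u_plus x)) \<longlongrightarrow> 0) at_top"
    and \<delta>: "0 < \<delta>"
  shows "\<exists>\<kappa>>0. \<exists>t1\<ge>1. \<forall>t\<ge>t1. \<forall>a. norm a \<le> \<kappa> / t \<longrightarrow> modulation_defect (u t) a \<le> \<delta>"
proof -
  have ev: "\<forall>\<^sub>F t in at_top. Lp_norm 2 (\<lambda>x. schroedinger_group (- t) (u t) x - u_plus x) < ennreal (\<delta> / 16)"
    using order_tendstoD(2)[OF lim] \<delta> by simp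
  obtain B where B: "\<And>t. t \<ge> B \<Longrightarrow> Lp_norm 2 (\<lambda>x. schroedinger_group (- t) (u t) x - u_plus x) < ennreal (\<delta> / 16)"
    using ev unfolding eventually_at_top_linorder by blast
  define t0 where "t0 = max B 1"
  have t0: "0 < t0" "1 \<le> t0" "B \<le> t0" by (simp_all add: t0_def)
  define S where "S t = schroedinger_group (- t) (u t)" for t
  have SL: "S t \<in> L2" if "0 < t" for t unfolding S_def by (rule schroedinger_group_L2(1)[OF u[OF that]])
  have S: "l2norm (\<lambda>x. S t x - u_plus x) < \<delta> / 16" if "t0 \<le> t" for t
  proof -
    have "0 < t" "B \<le> t" using that t0 by linarith+
    then show ?thesis
      using B[OF \<open>B \<le> t\<close>] L2_diff[OF SL[OF \<open>0 < t\<close>] p] by (simp add: Lp_norm_2_L2 S_def[symmetric] ennreal_less_iff)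
  qed
  \<comment> \<open>The reference function is frozen at time \<open>t0\<close>; at later
    \<open>t\<close> its transform is carried by the free evolution over the time
    \<open>t - t0\<close>.\<close>
  define w where "w = u t0"
  have w: "w \<in> L2" unfolding w_def by (rule u[OF t0(1)])
  note Fw = fourier_L2_spec(1)[OF w]
  obtain \<kappa> where \<kappa>: "0 < \<kappa>" "tail_weight (fourier_L2 w) \<kappa> < \<delta> / 4"
    using tail_weight_tendsto[OF Fw, of "\<delta> / 4"] \<delta> by auto
  obtain \<eta> where \<eta>: "0 < \<eta>" "tail_weight w \<eta> < \<delta> / 4"
    using tail_weight_tendsto[OF w, of "\<delta> / 4"] \<delta> by auto
  \<comment> \<open>Three demands on \<open>t \<ge> t1\<close>: closeness of the profile to
    \<open>u_plus\<close>, \<open>\<kappa> / t \<le> 1\<close> for the quadratic phase, and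
    \<open>\<kappa> / t \<le> \<eta>\<close> for the tail of \<open>w\<close>.\<close>
  define t1 where "t1 = Max {t0, \<kappa>, \<kappa> / \<eta>}"
  have t1: "t0 \<le> t1" "\<kappa> \<le> t1" "\<kappa> / \<eta> \<le> t1" by (simp_all add: t1_def)
  have main: "modulation_defect (u t) a \<le> \<delta>" if t: "t1 \<le> t" and a: "norm a \<le> \<kappa> / t" for t a
  proof -
    have tt: "t0 \<le> t" "\<kappa> \<le> t" "\<kappa> / \<eta> \<le> t" "0 < t" using t t1 t0 by linarith+
    have a1: "norm a \<le> 1"
      using a tt by (intro order_trans[OF a]) (simp add: divide_le_eq)
    have "\<kappa> / t \<le> \<eta>" using tt \<eta>(1) by (simp add: field_simps)
    then have a2: "norm a \<le> \<eta>" using a by linarith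
    have "t * norm a \<le> \<kappa>" using a tt(4) by (simp add: field_simps)
    moreover have "(t - t0) * norm a \<le> t * norm a" using t0 by (intro mult_right_mono) auto
    ultimately have a3: "(t - t0) * norm a \<le> \<kappa>" by linarith
    note ut = u[OF tt(4)] and Fu = fourier_L2_spec(1)[OF u[OF tt(4)]]
    define h where "h = (\<lambda>\<xi>::'a. cis (- (t - t0) * (norm \<xi>)\<^sup>2) * fourier_L2 w \<xi>)"
    have hL: "h \<in> L2" unfolding h_def by (rule L2_unimodular(1)[OF Fw]) simp_all
    have dL: "(\<lambda>\<xi>. fourier_L2 (u t) \<xi> - h \<xi>) \<in> L2" by (rule L2_diff[OF Fu hL])
    \<comment> \<open>Multiplying by the unimodular \<open>cis (t * (norm \<xi>)\<^sup>2)\<close>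
      turns this into the distance between the profiles \<open>S t\<close> and
      \<open>S t0\<close>.\<close>
    have "l2norm (\<lambda>\<xi>. fourier_L2 (u t) \<xi> - h \<xi>) = l2norm (\<lambda>\<xi>. cis (t * (norm \<xi>)\<^sup>2) * (fourier_L2 (u t) \<xi> - h \<xi>))"
      by (rule L2_unimodular(2)[OF dL, symmetric]) simp_all
    also have "(\<lambda>\<xi>. cis (t * (norm \<xi>)\<^sup>2) * (fourier_L2 (u t) \<xi> - h \<xi>)) = (\<lambda>\<xi>. cis (- (- t) * (norm \<xi>)\<^sup>2) * fourier_L2 (u t) \<xi> - cis (- (- t0) * (norm \<xi>)\<^sup>2) * fourier_L2 w \<xi>)"
    proof
      fix \<xi> :: 'a
      have "cis (t * (norm \<xi>)\<^sup>2) * cis (- (t - t0) * (norm \<xi>)\<^sup>2) = cis (- (- t0) * (norm \<xi>)\<^sup>2)"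
        unfolding cis_mult by (simp add: algebra_simps)
      then show "cis (t * (norm \<xi>)\<^sup>2) * (fourier_L2 (u t) \<xi> - h \<xi>) = cis (- (- t) * (norm \<xi>)\<^sup>2) * fourier_L2 (u t) \<xi> - cis (- (- t0) * (norm \<xi>)\<^sup>2) * fourier_L2 w \<xi>"
        unfolding h_def right_diff_distrib mult.assoc[symmetric] by simp
    qed
    also have "l2norm \<dots> = l2norm (\<lambda>x. S t x - S t0 x)"
      unfolding S_def w_def by (rule schroedinger_group_diff[OF ut u[OF t0(1)], symmetric])
    also have "\<dots> \<le> l2norm (\<lambda>x. S t x - u_plus x) + l2norm (\<lambda>x. u_plus x - S t0 x)"
      by (rule l2norm_diff_triangle[OF SL[OF tt(4)] p SL[OF t0(1)]])
    also have "\<dots> \<le> \<delta> / 8"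
      using S[OF tt(1)] S[OF order_refl] by (simp add: l2norm_minus_commute[of u_plus])
    finally have d: "l2norm (\<lambda>\<xi>. fourier_L2 (u t) \<xi> - h \<xi>) \<le> \<delta> / 8" .
    have E: "l2norm (\<lambda>\<xi>. h (\<xi> - a) - h \<xi>) \<le> tail_weight w \<eta> + tail_weight (fourier_L2 w) \<kappa>"
      unfolding h_def by (rule evolved_translation[OF w a1 a2 _ a3]) (use tt in simp)
    have sh: "(\<lambda>\<xi>. f (\<xi> - a)) \<in> L2" "l2norm (\<lambda>\<xi>. f (\<xi> - a)) = l2norm f" if "f \<in> L2" for f :: "'a \<Rightarrow> complex"
      using L2_shift[OF that, of "- a"] by simp_all
    have "modulation_defect (u t) a = l2norm (\<lambda>\<xi>. fourier_L2 (u t) (\<xi> - a) - fourier_L2 (u t) \<xi>)"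
      by (rule modulation_defect_fourier[OF ut])
    also have "\<dots> \<le> l2norm (\<lambda>\<xi>. fourier_L2 (u t) (\<xi> - a) - h (\<xi> - a)) + l2norm (\<lambda>\<xi>. h (\<xi> - a) - fourier_L2 (u t) \<xi>)"
      by (rule l2norm_diff_triangle[OF sh(1)[OF Fu] sh(1)[OF hL] Fu])
    also have "l2norm (\<lambda>\<xi>. h (\<xi> - a) - fourier_L2 (u t) \<xi>) \<le> l2norm (\<lambda>\<xi>. h (\<xi> - a) - h \<xi>) + l2norm (\<lambda>\<xi>. h \<xi> - fourier_L2 (u t) \<xi>)"
      by (rule l2norm_diff_triangle[OF sh(1)[OF hL] hL Fu])
    \<comment> \<open>The budget is twice \<open>\<delta> / 8\<close> for replacing the transform by
      \<open>h\<close>, and twice \<open>\<delta> / 4\<close> for the two tails.\<close>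
    finally show ?thesis
      using sh(2)[OF dL] d E \<kappa>(2) \<eta>(2) l2norm_minus_commute[of h "fourier_L2 (u t)"] \<delta> by linarith
  qed
  have "1 \<le> t1" using t0 t1 by linarith
  with main have "\<exists>t1\<ge>1. \<forall>t\<ge>t1. \<forall>a. norm a \<le> \<kappa> / t \<longrightarrow> modulation_defect (u t) a \<le> \<delta>" by blast
  with \<kappa>(1) show ?thesis by blast
qed

section \<open>Concentration of mass by averaging over modulations\<close>

lemma averaged_modulation:
  fixes y \<delta> :: real
  assumes \<delta>: "0 < \<delta>" and y: "2 \<le> \<delta> * \<bar>y\<bar>"
  shows "ennreal \<delta> \<le> (\<integral>\<^sup>+\<theta>. ennreal ((cmod (cis (\<theta> * y) - 1))\<^sup>2) * indicator {0..\<delta>} \<theta> \<partial>lborel)"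
proof -
  have y0: "y \<noteq> 0" using y by auto
  have eq: "(cmod (cis (\<theta> * y) - 1))\<^sup>2 = 2 - 2 * cos (\<theta> * y)" for \<theta>
  proof -
    have "(cmod (cis (\<theta> * y) - 1))\<^sup>2 = (cos (\<theta> * y) - 1)\<^sup>2 + (sin (\<theta> * y))\<^sup>2" by (simp add: cmod_power2)
    also have "\<dots> = ((sin (\<theta> * y))\<^sup>2 + (cos (\<theta> * y))\<^sup>2) + 1 - 2 * cos (\<theta> * y)" by (simp add: power2_eq_square algebra_simps)
    finally show ?thesis by simp
  qed
  define F where "F \<theta> = 2 * \<theta> - 2 * sin (\<theta> * y) / y" for \<theta>
  have "(\<integral>\<^sup>+\<theta>. ennreal ((cmod (cis (\<theta> * y) - 1))\<^sup>2) * indicator {0..\<delta>} \<theta> \<partial>lborel) = ennreal (F \<delta> - F 0)"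
  proof (rule nn_integral_FTC_Icc)
    show "(\<lambda>\<theta>. (cmod (cis (\<theta> * y) - 1))\<^sup>2) \<in> borel_measurable borel" by measurable
    show "(F has_real_derivative (cmod (cis (\<theta> * y) - 1))\<^sup>2) (at \<theta>)" for \<theta>
      unfolding eq F_def using y0 by (auto intro!: derivative_eq_intros)
  qed (use \<delta> in auto)
  \<comment> \<open>The integral is \<open>2 * \<delta>\<close> minus an oscillating part of size at
    most \<open>2 / |y|\<close>. The threshold 2 in the hypothesis on \<open>y\<close> bounds that
    part by \<open>\<delta>\<close>.\<close>
  moreover have "\<delta> \<le> F \<delta> - F 0"
  proof -
    have "sin (\<delta> * y) / y \<le> \<bar>sin (\<delta> * y) / y\<bar>" by (rule abs_ge_self)
    also have "\<dots> \<le> 1 / \<bar>y\<bar>" unfolding abs_divide by (intro divide_right_mono abs_sin_le_one) simp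
    also have "\<dots> \<le> \<delta> / 2" using y y0 by (simp add: field_simps)
    finally show ?thesis by (simp add: F_def mult.commute)
  qed
  ultimately show ?thesis by (simp add: ennreal_leI)
qed

text \<open>Far out in direction \<open>b\<close>, the factor
  \<open>|cis (\<theta> * (x \<bullet> b)) - 1|\<^sup>2\<close> has average at least 1 over
  \<open>\<theta>\<close> in \<open>{0..\<delta>}\<close>. Exchanging the integrals lets this
  pointwise lower bound meet the bound \<open>\<epsilon>\<^sup>2\<close> available for each single
  \<theta>.\<close>

lemma slab_mass:
  fixes w :: "'a::euclidean_space \<Rightarrow> complex"
  assumes w: "w \<in> L2" and b: "b \<in> Basis" and \<delta>: "0 < \<delta>"
    and D: "\<And>a. norm a \<le> \<delta> \<Longrightarrow> modulation_defect w a \<le> \<epsilon>"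
  shows "(\<integral>\<^sup>+x\<in>{x. 2 \<le> \<delta> * \<bar>x \<bullet> b\<bar>}. ennreal ((cmod (w x))\<^sup>2) \<partial>lborel) \<le> ennreal (\<epsilon>\<^sup>2)"
proof -
  have wm[measurable]: "w \<in> borel_measurable borel" using w by (rule L2_measurable)
  define E where "E = {x. 2 \<le> \<delta> * \<bar>x \<bullet> b\<bar>}"
  have Em[measurable]: "E \<in> sets borel" unfolding E_def by measurable
  define k where "k \<theta> x = ennreal ((cmod ((cis (\<theta> * (x \<bullet> b)) - 1) * w x))\<^sup>2) * indicator {0..\<delta>} \<theta>" for \<theta> and x :: 'a
  have km[measurable]: "case_prod k \<in> borel_measurable (lborel \<Otimes>\<^sub>M lborel)"
    unfolding k_def case_prod_beta by measurable
  have "ennreal \<delta> * (\<integral>\<^sup>+x\<in>E. ennreal ((cmod (w x))\<^sup>2) \<partial>lborel) = (\<integral>\<^sup>+x. ennreal \<delta> * (ennreal ((cmod (w x))\<^sup>2) * indicator E x) \<partial>lborel)"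
    by (rule nn_integral_cmult[symmetric]) measurable
  also have "\<dots> \<le> (\<integral>\<^sup>+x. \<integral>\<^sup>+\<theta>. k \<theta> x \<partial>lborel \<partial>lborel)"
  proof (rule nn_integral_mono)
    fix x
    show "ennreal \<delta> * (ennreal ((cmod (w x))\<^sup>2) * indicator E x) \<le> (\<integral>\<^sup>+\<theta>. k \<theta> x \<partial>lborel)"
    proof (cases "x \<in> E")
      case True
      have "ennreal \<delta> * ennreal ((cmod (w x))\<^sup>2) \<le> (\<integral>\<^sup>+\<theta>. ennreal ((cmod (cis (\<theta> * (x \<bullet> b)) - 1))\<^sup>2) * indicator {0..\<delta>} \<theta> \<partial>lborel) * ennreal ((cmod (w x))\<^sup>2)"
        using averaged_modulation[OF \<delta>, of "x \<bullet> b"] True by (intro mult_right_mono) (auto simp: E_def)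
      also have "\<dots> = (\<integral>\<^sup>+\<theta>. (ennreal ((cmod (cis (\<theta> * (x \<bullet> b)) - 1))\<^sup>2) * indicator {0..\<delta>} \<theta>) * ennreal ((cmod (w x))\<^sup>2) \<partial>lborel)"
        by (rule nn_integral_multc[symmetric]) measurable
      also have "\<dots> = (\<integral>\<^sup>+\<theta>. k \<theta> x \<partial>lborel)"
        by (intro nn_integral_cong) (simp add: k_def norm_mult power_mult_distrib ennreal_mult mult_ac)
      finally show ?thesis using True by simp
    qed simp
  qed
  also have "\<dots> = (\<integral>\<^sup>+\<theta>. \<integral>\<^sup>+x. k \<theta> x \<partial>lborel \<partial>lborel)"
    by (rule lborel_pair.Fubini'[OF km])
  also have "\<dots> \<le> (\<integral>\<^sup>+\<theta>. ennreal (\<epsilon>\<^sup>2) * indicator {0..\<delta>} \<theta> \<partial>lborel)"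
  proof (rule nn_integral_mono)
    fix \<theta>
    show "(\<integral>\<^sup>+x. k \<theta> x \<partial>lborel) \<le> ennreal (\<epsilon>\<^sup>2) * indicator {0..\<delta>} \<theta>"
    proof (cases "\<theta> \<in> {0..\<delta>}")
      case True
      have mL: "(\<lambda>x. (cis (x \<bullet> (\<theta> *\<^sub>R b)) - 1) * w x) \<in> L2"
        by (rule L2_bounded_mult[OF w, of _ 2]) (use norm_cis_diff_le[of _ 0] in simp_all)
      have "(\<integral>\<^sup>+x. k \<theta> x \<partial>lborel) = (\<integral>\<^sup>+x. ennreal ((cmod ((cis (x \<bullet> (\<theta> *\<^sub>R b)) - 1) * w x))\<^sup>2) \<partial>lborel)"
        using True by (intro nn_integral_cong) (simp add: k_def)
      also have "\<dots> = ennreal ((modulation_defect w (\<theta> *\<^sub>R b))\<^sup>2)"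
        unfolding modulation_defect_def by (rule nn_integral_sq[OF L2_integrable[OF mL]])
      also have "\<dots> \<le> ennreal (\<epsilon>\<^sup>2)"
        using D[of "\<theta> *\<^sub>R b"] True b by (intro ennreal_leI power_mono) (auto simp: modulation_defect_def)
      finally show ?thesis using True by simp
    qed (simp add: k_def)
  qed
  also have "\<dots> = ennreal (\<epsilon>\<^sup>2) * ennreal \<delta>" using \<delta> by (subst nn_integral_cmult_indicator) simp_all
  finally have "ennreal \<delta> * (\<integral>\<^sup>+x\<in>E. ennreal ((cmod (w x))\<^sup>2) \<partial>lborel) \<le> ennreal \<delta> * ennreal (\<epsilon>\<^sup>2)" by (simp add: mult.commute)
  then show ?thesis using \<delta> unfolding E_def[symmetric] by (simp add: ennreal_mult_le_mult_iff)
qed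

text \<open>A point outside the cube has a coordinate of modulus beyond \<open>2 / \<delta>\<close>,
  so the complement is covered by one two-sided slab for each coordinate, each of mass at most
  \<open>\<epsilon>\<^sup>2\<close>.\<close>

lemma concentrated_mass:
  fixes w :: "'a::euclidean_space \<Rightarrow> complex"
  assumes w: "w \<in> L2" and \<delta>: "0 < \<delta>"
    and D: "\<And>a. norm a \<le> \<delta> \<Longrightarrow> modulation_defect w a \<le> \<epsilon>"
  shows "ennreal ((l2norm w)\<^sup>2 - real DIM('a) * \<epsilon>\<^sup>2) \<le> (\<integral>\<^sup>+x\<in>cbox (- (2 / \<delta>) *\<^sub>R One) ((2 / \<delta>) *\<^sub>R One). ennreal ((cmod (w x))\<^sup>2) \<partial>lborel)"
proof -
  have wm[measurable]: "w \<in> borel_measurable borel" using w by (rule L2_measurable)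
  let ?Q = "cbox (- (2 / \<delta>) *\<^sub>R One) ((2 / \<delta>) *\<^sub>R One) :: 'a set"
  define f where "f x = ennreal ((cmod (w x))\<^sup>2)" for x
  have fm[measurable]: "f \<in> borel_measurable borel" unfolding f_def[abs_def] by measurable
  have Qm[measurable]: "?Q \<in> sets borel" by simp
  have Em[measurable]: "{x::'a. 2 \<le> \<delta> * \<bar>x \<bullet> b\<bar>} \<in> sets borel" for b by measurable
  have cover: "f x \<le> f x * indicator ?Q x + (\<Sum>b\<in>Basis. f x * indicator {x. 2 \<le> \<delta> * \<bar>x \<bullet> b\<bar>} x)" for x
  proof (cases "x \<in> ?Q")
    case True
    then show ?thesis by (simp add: add_increasing2)
  next
    case False
    then obtain b where b: "b \<in> Basis" "2 / \<delta> < \<bar>x \<bullet> b\<bar>" by (force simp: mem_box)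
    then have m: "x \<in> {x. 2 \<le> \<delta> * \<bar>x \<bullet> b\<bar>}" using \<delta> by (simp add: field_simps)
    have "f x = f x * indicator {x. 2 \<le> \<delta> * \<bar>x \<bullet> b\<bar>} x" using m by simp
    also have "\<dots> \<le> (\<Sum>b\<in>Basis. f x * indicator {x. 2 \<le> \<delta> * \<bar>x \<bullet> b\<bar>} x)"
      by (rule member_le_sum[OF b(1)]) simp_all
    finally show ?thesis by (simp add: add_increasing)
  qed
  have "ennreal ((l2norm w)\<^sup>2) = (\<integral>\<^sup>+x. f x \<partial>lborel)"
    unfolding f_def by (rule nn_integral_sq[OF L2_integrable[OF w], symmetric])
  also have "\<dots> \<le> (\<integral>\<^sup>+x. f x * indicator ?Q x + (\<Sum>b\<in>Basis. f x * indicator {x. 2 \<le> \<delta> * \<bar>x \<bullet> b\<bar>} x) \<partial>lborel)"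
    by (intro nn_integral_mono cover)
  also have "\<dots> = (\<integral>\<^sup>+x\<in>?Q. f x \<partial>lborel) + (\<integral>\<^sup>+x. (\<Sum>b\<in>Basis. f x * indicator {x. 2 \<le> \<delta> * \<bar>x \<bullet> b\<bar>} x) \<partial>lborel)"
    by (rule nn_integral_add) measurable
  also have "(\<integral>\<^sup>+x. (\<Sum>b\<in>Basis. f x * indicator {x. 2 \<le> \<delta> * \<bar>x \<bullet> b\<bar>} x) \<partial>lborel) = (\<Sum>b\<in>Basis. (\<integral>\<^sup>+x\<in>{x. 2 \<le> \<delta> * \<bar>x \<bullet> b\<bar>}. f x \<partial>lborel))"
    by (rule nn_integral_sum) measurable
  also have "(\<integral>\<^sup>+x\<in>?Q. f x \<partial>lborel) + \<dots> \<le> (\<integral>\<^sup>+x\<in>?Q. f x \<partial>lborel) + (\<Sum>b\<in>(Basis::'a set). ennreal (\<epsilon>\<^sup>2))"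
    unfolding f_def by (intro add_left_mono sum_mono slab_mass[OF w _ \<delta> D])
  also have "(\<Sum>b\<in>(Basis::'a set). ennreal (\<epsilon>\<^sup>2)) = ennreal (real DIM('a) * \<epsilon>\<^sup>2)"
    by (simp add: ennreal_mult ennreal_of_nat_eq_real_of_nat)
  finally have *: "ennreal ((l2norm w)\<^sup>2) \<le> (\<integral>\<^sup>+x\<in>?Q. f x \<partial>lborel) + ennreal (real DIM('a) * \<epsilon>\<^sup>2)" .
  have "ennreal ((l2norm w)\<^sup>2 - real DIM('a) * \<epsilon>\<^sup>2) = ennreal ((l2norm w)\<^sup>2) - ennreal (real DIM('a) * \<epsilon>\<^sup>2)"
    by (rule ennreal_minus[symmetric]) simp
  also have "\<dots> \<le> (\<integral>\<^sup>+x\<in>?Q. f x \<partial>lborel)"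
    using * by (simp add: ennreal_minus_le_iff add.commute)
  finally show ?thesis unfolding f_def .
qed

text \<open>Values below the height \<open>\<mu>\<close> carry at most half of the mass in
  \<open>Q\<close>, since \<open>\<mu>\<^sup>2 * V = c / 2\<close>; above it,
  \<open>|w|\<^sup>2 \<le> \<mu> powr (2 - p) * |w| powr p\<close>. So the integral of
  \<open>|w| powr p\<close> is at least \<open>c / 2 * \<mu> powr (p - 2)\<close>, whose root of
  order \<open>p\<close> is the stated bound.\<close>

lemma Lp_norm_lower_bound:
  fixes w :: "'a::euclidean_space \<Rightarrow> complex"
  assumes wm[measurable]: "w \<in> borel_measurable borel" and Q[measurable]: "Q \<in> sets borel"
    and V: "emeasure lborel Q = ennreal V" "0 < V" and c: "0 < c"
    and mass: "ennreal c \<le> (\<integral>\<^sup>+x\<in>Q. ennreal ((cmod (w x))\<^sup>2) \<partial>lborel)" and r: "2 \<le> r"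
  shows "ennreal ((c / 2) powr enn2real (1 / r) * (c / (2 * V)) powr (1 / 2 - enn2real (1 / r))) \<le> Lp_norm r w"
proof (cases r)
  case (real p)
  have p: "2 \<le> p" using r real by simp
  have rp: "r = ennreal p" and p0: "0 < p" using real p by auto
  have e: "enn2real (1 / r) = 1 / p" using real p by (simp add: divide_ennreal[of 1 p, simplified])
  define \<mu> where "\<mu> = (c / (2 * V)) powr (1 / 2)"
  have \<mu>: "0 < \<mu>" using c V by (simp add: \<mu>_def)
  have \<mu>sq: "\<mu>\<^sup>2 = c / (2 * V)" unfolding \<mu>_def powr_half_square using c V by simp
  have point: "(cmod (w x))\<^sup>2 \<le> \<mu> powr (2 - p) * cmod (w x) powr p + \<mu>\<^sup>2" for x
  proof (cases "cmod (w x) \<le> \<mu>")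
    case True
    then have "(cmod (w x))\<^sup>2 \<le> \<mu>\<^sup>2" by (intro power_mono) auto
    then show ?thesis by (simp add: add_increasing)
  next
    case False
    then have z: "\<mu> < cmod (w x)" by simp
    then have z0: "0 < cmod (w x)" using \<mu> by linarith
    have "(cmod (w x))\<^sup>2 = cmod (w x) powr (2 - p) * cmod (w x) powr p"
      using z0 by (simp add: powr_numeral flip: powr_add)
    also have "\<dots> \<le> \<mu> powr (2 - p) * cmod (w x) powr p"
      using z \<mu> p by (intro mult_right_mono powr_mono2') auto
    finally show ?thesis by (simp add: add_increasing2)
  qed
  define I where "I = (\<integral>\<^sup>+x. ennreal (cmod (w x) powr p) \<partial>lborel)"
  have L: "Lp_norm r w = ennreal_powr I (1 / p)"
    unfolding rp using p0 by (simp add: Lp_norm_def I_def)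
  have "ennreal c \<le> (\<integral>\<^sup>+x. ennreal (\<mu> powr (2 - p)) * ennreal (cmod (w x) powr p) + ennreal (\<mu>\<^sup>2) * indicator Q x \<partial>lborel)"
  proof (rule order_trans[OF mass], rule nn_integral_mono)
    fix x
    show "ennreal ((cmod (w x))\<^sup>2) * indicator Q x \<le> ennreal (\<mu> powr (2 - p)) * ennreal (cmod (w x) powr p) + ennreal (\<mu>\<^sup>2) * indicator Q x"
      using ennreal_leI[OF point[of x]] by (cases "x \<in> Q") (simp_all add: ennreal_mult)
  qed
  also have "\<dots> = ennreal (\<mu> powr (2 - p)) * I + ennreal (\<mu>\<^sup>2) * ennreal V"
    unfolding I_def by (subst nn_integral_add) (simp_all add: nn_integral_cmult V)
  also have "ennreal (\<mu>\<^sup>2) * ennreal V = ennreal (c / 2)"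
    using V c by (simp add: \<mu>sq ennreal_mult[symmetric])
  finally have ineq: "ennreal c \<le> ennreal (\<mu> powr (2 - p)) * I + ennreal (c / 2)" .
  have ex: "(c / 2) powr (1 / p) * (c / (2 * V)) powr (1 / 2 - 1 / p) = (c / 2 * \<mu> powr (p - 2)) powr (1 / p)"
  proof -
    have "1 / 2 * (p - 2) * (1 / p) = 1 / 2 - 1 / p" using p0 by (simp add: field_simps)
    then have "(\<mu> powr (p - 2)) powr (1 / p) = (c / (2 * V)) powr (1 / 2 - 1 / p)"
      unfolding \<mu>_def powr_powr by simp
    then show ?thesis using c powr_mult[of "c / 2" "\<mu> powr (p - 2)" "1 / p"] by simp
  qed
  show ?thesis
  proof (cases I)
    case (real i)
    have "c \<le> \<mu> powr (2 - p) * i + c / 2"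
      using ineq real c by (simp add: ennreal_mult[symmetric] flip: ennreal_plus)
    then have "c / 2 * \<mu> powr (p - 2) \<le> (\<mu> powr (2 - p) * i) * \<mu> powr (p - 2)"
      by (intro mult_right_mono) auto
    also have "\<dots> = i * (\<mu> powr (2 - p) * \<mu> powr (p - 2))" by (simp add: mult_ac)
    also have "\<mu> powr (2 - p) * \<mu> powr (p - 2) = 1" using \<mu> by (simp flip: powr_add)
    finally have "(c / 2 * \<mu> powr (p - 2)) powr (1 / p) \<le> i powr (1 / p)"
      using c p0 by (intro powr_mono2) auto
    then show ?thesis unfolding e ex L using real by (simp add: ennreal_powr_def ennreal_leI)
  qed (simp add: L ennreal_powr_def)
next
  case top
  define S where "S = esssup lborel (\<lambda>x. ennreal (cmod (w x)))"
  have L: "Lp_norm r w = S" using top by (simp add: Lp_norm_def S_def)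
  \<comment> \<open>With \<open>1 / r = 0\<close> the first factor of the bound is 1 and the
    exponent of the second is \<open>1 / 2\<close>.\<close>
  have e: "enn2real (1 / r) = 0" using top by simp
  show ?thesis
  proof (cases S)
    case (real z)
    have "AE x in lborel. ennreal (cmod (w x)) \<le> S" unfolding S_def by (rule esssup_AE)
    then have ae: "AE x in lborel. cmod (w x) \<le> z" by eventually_elim (use real in simp)
    have "(\<integral>\<^sup>+x\<in>Q. ennreal ((cmod (w x))\<^sup>2) \<partial>lborel) \<le> (\<integral>\<^sup>+x. ennreal (z\<^sup>2) * indicator Q x \<partial>lborel)"
      by (rule nn_integral_mono_AE) (use ae in eventually_elim, auto intro!: mult_right_mono ennreal_leI power_mono)
    also have "\<dots> = ennreal (z\<^sup>2 * V)" using V by (simp add: nn_integral_cmult ennreal_mult)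
    finally have "ennreal c \<le> ennreal (z\<^sup>2 * V)" using mass by (rule order_trans[rotated])
    then have "c \<le> z\<^sup>2 * V" using V by simp
    then have "c / (2 * V) \<le> z\<^sup>2" using V c by (simp add: field_simps)
    then have "(c / (2 * V)) powr (1 / 2) \<le> (z\<^sup>2) powr (1 / 2)" using c V by (intro powr_mono2) auto
    also have "\<dots> = z" using real by (simp add: powr_half_sqrt)
    finally show ?thesis unfolding e L using real c by (simp add: ennreal_leI)
  qed (simp add: L)
qed

theorem lemma4p5:
  fixes m :: nat and lam \<alpha> :: real and T1 T2 :: ereal
    and \<phi> u_plus :: "real ^ 'n \<Rightarrow> complex"
    and u :: "real \<Rightarrow> real ^ 'n \<Rightarrow> complex"
  assumes "lam \<noteq> 0" and "m \<in> {0, 1}"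
    and "0 \<le> \<alpha>"
    and "m = 0 \<Longrightarrow> \<alpha> \<le> 4 / real CARD('n)"
    and "m = 1 \<Longrightarrow> CARD('n) > 2 \<Longrightarrow> \<alpha> < 4 / (real CARD('n) - 2)"
    and "\<phi> \<in> sobolev m"
    and "corresponding_solution m lam \<alpha> \<phi> T1 T2 u"
    and "T2 = \<infinity>"
    and "\<not> (AE x in lborel. \<phi> x = 0)"
    and "u_plus \<in> L2"
    and "((\<lambda>t. Lp_norm 2 (\<lambda>x. schroedinger_group (- t) (u t) x - u_plus x)) \<longlongrightarrow> 0) at_top"
  shows "\<forall>r::ennreal. 2 \<le> r \<longrightarrow>
    0 < Liminf at_top (\<lambda>t::real.
          ennreal (\<bar>t\<bar> powr (real CARD('n) * (1/2 - enn2real (1 / r)))) * Lp_norm r (u t))"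
proof (intro allI impI)
  fix r :: ennreal assume r: "2 \<le> r"
  define N where "N = real CARD('n)"
  have N: "1 \<le> N" by (simp add: N_def Suc_leI)
  have dim: "real DIM(real ^ 'n) = N" by (simp add: N_def)
  note \<phi>L = sobolev_bessel(1)[OF assms(6)]
  have sol: "corresponding_solution m lam \<alpha> \<phi> T1 \<infinity> u" using assms(7,8) by simp
  have uL: "u t \<in> L2" and um: "l2norm (u t) = l2norm \<phi>" if "0 < t" for t
    by (rule corresponding_solution_mass[OF assms(1-3) _ _ \<phi>L sol that]; use assms(4,5) in simp)+
  define M where "M = (l2norm \<phi>)\<^sup>2"
  have M: "0 < M"
    using assms(9) l2norm_eq_0_AE[OF \<phi>L] by (simp add: M_def)
  \<comment> \<open>Each of the \<open>N\<close> slabs outside the cube takes at most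
    \<open>\<epsilon>\<^sup>2\<close>; this value leaves half of the mass inside.\<close>
  define \<epsilon> where "\<epsilon> = sqrt (M / (2 * N))"
  have \<epsilon>: "0 < \<epsilon>" "N * \<epsilon>\<^sup>2 = M / 2" using M N by (simp_all add: \<epsilon>_def)
  obtain \<kappa> t1 where \<kappa>: "0 < \<kappa>" and t1: "1 \<le> t1"
    and D: "\<And>t a. t1 \<le> t \<Longrightarrow> norm a \<le> \<kappa> / t \<Longrightarrow> modulation_defect (u t) a \<le> \<epsilon>"
    using asymptotic_equicontinuity[OF uL assms(10,11) \<epsilon>(1)] by blast
  define c where "c = M / 2"
  have c: "0 < c" using M by (simp add: c_def)
  define s where "s = 1 / 2 - enn2real (1 / r)"
  \<comment> \<open>The bound of \<open>Lp_norm_lower_bound\<close> for a cube of volume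
    \<open>(4 * t / \<kappa>) powr N\<close>, with the power of \<open>t\<close> split off.\<close>
  define C where "C = (c / 2) powr enn2real (1 / r) * (c / (2 * (4 / \<kappa>) powr N)) powr s"
  have C: "0 < C" using c \<kappa> by (simp add: C_def)
  have low: "ennreal C \<le> ennreal (\<bar>t\<bar> powr (N * s)) * Lp_norm r (u t)" if t: "t1 \<le> t" for t
  proof -
    have t0: "0 < t" using t t1 by linarith
    define Q where "Q = (cbox (- (2 / (\<kappa> / t)) *\<^sub>R One) ((2 / (\<kappa> / t)) *\<^sub>R One) :: (real ^ 'n) set)"
    have mass: "ennreal c \<le> (\<integral>\<^sup>+x\<in>Q. ennreal ((cmod (u t x))\<^sup>2) \<partial>lborel)"
      using concentrated_mass[OF uL[OF t0] _ D[OF t], of "\<kappa> / t"] \<kappa> t0 \<epsilon>(2)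
      unfolding Q_def dim um[OF t0] M_def[symmetric] c_def by simp
    \<comment> \<open>The modulations of length up to \<open>\<kappa> / t\<close> confine the mass
      to coordinates between \<open>- 2 * t / \<kappa>\<close> and \<open>2 * t / \<kappa>\<close>,
      a cube of side \<open>4 * t / \<kappa>\<close>.\<close>
    define V where "V = (4 * t / \<kappa>) powr N"
    have V0: "0 < V" using t0 \<kappa> by (simp add: V_def)
    have V: "emeasure lborel Q = ennreal V"
    proof -
      have one: "One \<bullet> b = 1" if "b \<in> Basis" for b :: "real ^ 'n"
        using that by (simp add: inner_sum_left inner_Basis)
      have "emeasure lborel Q = ennreal (\<Prod>b\<in>(Basis :: (real ^ 'n) set). ((2 / (\<kappa> / t)) *\<^sub>R One - (- (2 / (\<kappa> / t)) *\<^sub>R One)) \<bullet> b)"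
        unfolding Q_def using t0 \<kappa> by (intro emeasure_lborel_cbox) (simp add: one)
      also have "(\<Prod>b\<in>(Basis :: (real ^ 'n) set). ((2 / (\<kappa> / t)) *\<^sub>R One - (- (2 / (\<kappa> / t)) *\<^sub>R One)) \<bullet> b) = (\<Prod>b\<in>(Basis :: (real ^ 'n) set). 4 * t / \<kappa>)"
        by (intro prod.cong refl) (simp only: inner_diff_left inner_scaleR_left one, simp)
      finally have "emeasure lborel Q = ennreal (\<Prod>b\<in>(Basis :: (real ^ 'n) set). 4 * t / \<kappa>)" .
      then show ?thesis using t0 \<kappa> by (simp add: V_def N_def powr_realpow)
    qed
    have "(c / (2 * V)) powr s = (c / (2 * (4 / \<kappa>) powr N)) powr s * t powr (- (N * s))"
    proof -
      have "V = (4 / \<kappa>) powr N * t powr N" using t0 \<kappa> powr_mult[of "4 / \<kappa>" t N] by (simp add: V_def)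
      then have "c / (2 * V) = c / (2 * (4 / \<kappa>) powr N) * t powr (- N)" by (simp add: powr_minus_divide)
      then have "(c / (2 * V)) powr s = (c / (2 * (4 / \<kappa>) powr N) * t powr (- N)) powr s" by (simp only:)
      also have "\<dots> = (c / (2 * (4 / \<kappa>) powr N)) powr s * (t powr (- N)) powr s"
        by (rule powr_mult)
      also have "(t powr (- N)) powr s = t powr (- (N * s))" by (simp add: powr_powr)
      finally show ?thesis .
    qed
    then have "C * t powr (- (N * s)) = (c / 2) powr enn2real (1 / r) * (c / (2 * V)) powr s" by (simp add: C_def)
    then have "ennreal (C * t powr (- (N * s))) \<le> Lp_norm r (u t)"
      using Lp_norm_lower_bound[OF L2_measurable[OF uL[OF t0]] _ V V0 c mass r] by (simp add: Q_def s_def)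
    then have "ennreal (\<bar>t\<bar> powr (N * s)) * ennreal (C * t powr (- (N * s))) \<le> ennreal (\<bar>t\<bar> powr (N * s)) * Lp_norm r (u t)"
      by (rule mult_left_mono) simp
    moreover have "ennreal (\<bar>t\<bar> powr (N * s)) * ennreal (C * t powr (- (N * s))) = ennreal C"
      using t0 C by (simp add: ennreal_mult[symmetric] powr_minus)
    ultimately show ?thesis by simp
  qed
  have "0 < ennreal C" using C by simp
  also have "\<dots> \<le> Liminf at_top (\<lambda>t. ennreal (\<bar>t\<bar> powr (N * s)) * Lp_norm r (u t))"
    by (rule Liminf_bounded) (use low in \<open>auto simp: eventually_at_top_linorder intro!: exI[of _ t1]\<close>)
  finally show "0 < Liminf at_top (\<lambda>t::real. ennreal (\<bar>t\<bar> powr (real CARD('n) * (1/2 - enn2real (1 / r)))) * Lp_norm r (u t))"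
    by (simp add: N_def s_def)
qed

end
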